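(* Let $V$ be a smoothly loop contractible abelian Lie group and let $\mathfrak{U}=\{U_i\mid i\in I\}$ be an open covering of a (possibly infinite dimensional) manifold $M$ such that, for each $q\ge0$, the covering $\{U_i^{q+1}\mid i\in I\}$ of $\mathfrak{U}[q]$ is smoothly numerable. Then the inclusion $A_s^*(\mathfrak{U};V)\hookrightarrow A^*(\mathfrak{U};V)$ of cochain complexes induces an isomorphism in cohomology, and the cohomologies $\check{H}(\mathfrak{U};V)$, $H_s(\mathfrak{U};V)$, $H_c(\mathfrak{U};V)$ and $H(\mathfrak{U};V)$ are isomorphic.
   Context: Manifolds and Lie groups are smooth, real and possibly infinite dimensional (smoothness in the sense of the Bertram–Glöckner–Neeb differential calculus). A Lie group $G$ is smoothly loop contractible if there is a smooth contraction $\Phi:G\times[0,1]\to G$ to the identity (a smooth homotopy between $\mathrm{id}_G$ and the constant map to the identity element) such that each $\Phi_t=\Phi(-,t)$ is a homomorphism of Lie groups. A smooth partition of unity is a family of smooth real functions with sum $1$ whose supports form a locally finite covering. An open covering $\{W_i\mid i\in I\}$ of a manifold is smoothly numerable if there is a smooth partition of unity $\{\varphi_i\mid i\in I\}$ subordinate to it ($\operatorname{supp}\varphi_i\subseteq W_i$). For an open covering $\mathfrak{U}=\{U_i\mid i\in I\}$ of $M$ put $\mathfrak{U}[q]:=\bigcup_{i}U_i^{q+1}$, an open submanifold of $M^{q+1}$. $A^q(\mathfrak{U};V)$, $A_c^q(\mathfrak{U};V)$, $A_s^q(\mathfrak{U};V)$ are the groups of all, of all continuous, and of all smooth functions $\mathfrak{U}[q]\to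 V$; they form cochain complexes with $df(u_0,\dots,u_{q+1})=\sum_k(-1)^kf(u_0,\dots,\hat u_k,\dots,u_{q+1})$, with cohomologies $H(\mathfrak{U};V)$, $H_c(\mathfrak{U};V)$, $H_s(\mathfrak{U};V)$. $\check{C}^*(\mathfrak{U};V)$ is the Čech complex of the covering: $\check{C}^p(\mathfrak{U};V)$ consists of the families $(v_{i_0\ldots i_p})$ of elements of $V$ (constant functions on $U_{i_0}\cap\dots\cap U_{i_p}$, for non-empty intersections) which change by the sign of the permutation when the indices are permuted, with the usual Čech coboundary; its cohomology is $\check{H}(\mathfrak{U};V)$. *)

theory Defs
  imports "HOL-Analysis.Analysis" "HOL-Algebra.Module" "HOL-Algebra.Coset"
    "HOL-Algebra.Product_Groups" "HOL-Combinatorics.Permutations"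
begin

section \<open>Hausdorff real topological vector spaces\<close>

text \<open>Model spaces are modules over the field of reals together with a topology. As usual for
  \<^typ>\<open>('a, 'b) module\<close>, the fields \<^const>\<open>monoid.mult\<close> and \<^const>\<open>monoid.one\<close> inherited from rings
  carry no meaning. No local convexity is assumed.\<close>

record 'a tvs = "(real, 'a) module" +
  tvs_topology :: "'a topology"

definition real_ring :: "real ring" where
  "real_ring = \<lparr>carrier = UNIV, monoid.mult = (*), one = 1, zero = 0, add = (+)\<rparr>"

locale tvs = module: Module.module real_ring E for E :: "'a tvs" (structure) +
  assumes topspace_tvs: "topspace (tvs_topology E) = carrier E"
    and Hausdorff_tvs: "Hausdorff_space (tvs_topology E)"
    and continuous_add:
      "continuous_map (prod_topology (tvs_topology E) (tvs_topology E)) (tvs_topology E)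
         (\<lambda>(x, y). x \<oplus>\<^bsub>E\<^esub> y)"
    and continuous_smult:
      "continuous_map (prod_topology euclideanreal (tvs_topology E)) (tvs_topology E)
         (\<lambda>(a, x). a \<odot>\<^bsub>E\<^esub> x)"

definition real_tvs :: "real tvs" where
  "real_tvs = \<lparr>carrier = UNIV, monoid.mult = (*), one = 1, zero = 0, add = (+), smult = (*),
     tvs_topology = euclideanreal\<rparr>"

definition tvs_prod :: "'a tvs \<Rightarrow> 'b tvs \<Rightarrow> ('a \<times> 'b) tvs" where
  "tvs_prod E F = \<lparr>carrier = carrier E \<times> carrier F,
     monoid.mult = undefined, one = undefined,
     zero = (\<zero>\<^bsub>E\<^esub>, \<zero>\<^bsub>F\<^esub>),
     add = (\<lambda>x y. (fst x \<oplus>\<^bsub>E\<^esub> fst y, snd x \<oplus>\<^bsub>F\<^esub> snd y)),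
     smult = (\<lambda>a x. (a \<odot>\<^bsub>E\<^esub> fst x, a \<odot>\<^bsub>F\<^esub> snd x)),
     tvs_topology = prod_topology (tvs_topology E) (tvs_topology F)\<rparr>"

text \<open>\<open>tvs_power E q\<close> is the power of \<open>E\<close> with the \<open>q + 1\<close> coordinates \<open>0, \<dots>, q\<close>.\<close>

definition tvs_power :: "'a tvs \<Rightarrow> nat \<Rightarrow> (nat \<Rightarrow> 'a) tvs" where
  "tvs_power E q = \<lparr>carrier = {..q} \<rightarrow>\<^sub>E carrier E,
     monoid.mult = undefined, one = undefined,
     zero = (\<lambda>i\<in>{..q}. \<zero>\<^bsub>E\<^esub>),
     add = (\<lambda>x y. \<lambda>i\<in>{..q}. x i \<oplus>\<^bsub>E\<^esub> y i),
     smult = (\<lambda>a x. \<lambda>i\<in>{..q}. a \<odot>\<^bsub>E\<^esub> x i),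
     tvs_topology = product_topology (\<lambda>_. tvs_topology E) {..q}\<rparr>"


section \<open>The Bertram--Gloeckner--Neeb differential calculus\<close>

text \<open>For a subset \<open>U\<close> of a topological vector space \<open>X\<close> one puts
  \<open>U\<^sup>[\<^sup>1\<^sup>] = {(x, v, t) \<in> U \<times> X \<times> \<real>. x + t v \<in> U}\<close>. A map \<open>f\<close> on \<open>U\<close> is \<open>C\<^sup>0\<close> if it is continuous, and
  \<open>C\<^sup>k\<^sup>+\<^sup>1\<close> if it is continuous and there is a \<open>C\<^sup>k\<close> map \<open>f\<^sup>[\<^sup>1\<^sup>]\<close> on \<open>U\<^sup>[\<^sup>1\<^sup>]\<close> with
  \<open>f (x + t v) - f x = t f\<^sup>[\<^sup>1\<^sup>] (x, v, t)\<close>. The map \<open>f\<^sup>[\<^sup>1\<^sup>]\<close> is unique if \<open>U\<close> has dense interior,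
  which covers both open sets and the product of an open set with \<open>[0,1]\<close>, and \<open>U\<^sup>[\<^sup>1\<^sup>]\<close> has dense
  interior again.

  The iterated spaces \<open>X \<mapsto> X \<times> X \<times> \<real>\<close> have growing types; their points are therefore
  encoded in one datatype of binary trees, the points of the \<open>k\<close>-th iterate being the full trees of
  depth \<open>k\<close> (those in the topological space \<open>bgn_topology E k\<close>).\<close>

datatype 'a bgn = Pt (bgn_base: 'a) | Nd (bgn_pos: "'a bgn") (bgn_dir: "'a bgn") (bgn_par: real)

fun bgn_add :: "'a tvs \<Rightarrow> 'a bgn \<Rightarrow> 'a bgn \<Rightarrow> 'a bgn" where
  "bgn_add E (Pt x) (Pt y) = Pt (x \<oplus>\<^bsub>E\<^esub> y)"
| "bgn_add E (Nd x v s) (Nd y w t) = Nd (bgn_add E x y) (bgn_add E v w) (s + t)"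
| "bgn_add E _ _ = undefined"

primrec bgn_smult :: "'a tvs \<Rightarrow> real \<Rightarrow> 'a bgn \<Rightarrow> 'a bgn" where
  "bgn_smult E a (Pt x) = Pt (a \<odot>\<^bsub>E\<^esub> x)"
| "bgn_smult E a (Nd x v t) = Nd (bgn_smult E a x) (bgn_smult E a v) (a * t)"

primrec bgn_topology :: "'a tvs \<Rightarrow> nat \<Rightarrow> 'a bgn topology" where
  "bgn_topology E 0 = pullback_topology (range Pt) bgn_base (tvs_topology E)"
| "bgn_topology E (Suc k) =
     pullback_topology {Nd x v t |x v t. True} (\<lambda>p. (bgn_pos p, bgn_dir p, bgn_par p))
       (prod_topology (bgn_topology E k) (prod_topology (bgn_topology E k) euclideanreal))"

primrec bgn_dom :: "'a tvs \<Rightarrow> 'a set \<Rightarrow> nat \<Rightarrow> 'a bgn set" where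
  "bgn_dom E U 0 = Pt ` U"
| "bgn_dom E U (Suc k) =
     {Nd x v t |x v t. x \<in> bgn_dom E U k \<and> v \<in> topspace (bgn_topology E k) \<and>
                       bgn_add E x (bgn_smult E t v) \<in> bgn_dom E U k}"

text \<open>\<open>bgn_C E F U k j g\<close>: the map \<open>g\<close> on the \<open>j\<close>-th iterate of \<open>U\<close> is \<open>C\<^sup>k\<close>.\<close>

primrec bgn_C :: "'a tvs \<Rightarrow> 'b tvs \<Rightarrow> 'a set \<Rightarrow> nat \<Rightarrow> nat \<Rightarrow> ('a bgn \<Rightarrow> 'b) \<Rightarrow> bool" where
  "bgn_C E F U 0 j g \<longleftrightarrow>
     continuous_map (subtopology (bgn_topology E j) (bgn_dom E U j)) (tvs_topology F) g"
| "bgn_C E F U (Suc k) j g \<longleftrightarrow>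
     continuous_map (subtopology (bgn_topology E j) (bgn_dom E U j)) (tvs_topology F) g \<and>
     (\<exists>g1. (\<forall>x v t. Nd x v t \<in> bgn_dom E U (Suc j) \<longrightarrow>
              g (bgn_add E x (bgn_smult E t v)) \<ominus>\<^bsub>F\<^esub> g x = t \<odot>\<^bsub>F\<^esub> g1 (Nd x v t)) \<and>
           bgn_C E F U k (Suc j) g1)"

definition bgn_smooth :: "'a tvs \<Rightarrow> 'b tvs \<Rightarrow> 'a set \<Rightarrow> ('a \<Rightarrow> 'b) \<Rightarrow> bool" where
  "bgn_smooth E F U f \<longleftrightarrow> (\<forall>k. bgn_C E F U k 0 (\<lambda>p. f (bgn_base p)))"


section \<open>Manifolds and smooth maps\<close>

text \<open>A chart is a pair consisting of its domain and its coordinate map; the values of the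
  coordinate map outside the domain are irrelevant. Atlases are not required to be maximal.\<close>

record ('m, 'e) manifold =
  mtop :: "'m topology"
  model :: "'e tvs"
  atlas :: "('m set \<times> ('m \<Rightarrow> 'e)) set"

locale manifold =
  fixes M :: "('m, 'e) manifold"
  assumes tvs_model: "tvs (model M)"
    and Hausdorff_manifold: "Hausdorff_space (mtop M)"
    and chart_domain_open: "(D, \<phi>) \<in> atlas M \<Longrightarrow> openin (mtop M) D"
    and chart_image_open: "(D, \<phi>) \<in> atlas M \<Longrightarrow> openin (tvs_topology (model M)) (\<phi> ` D)"
    and chart_homeomorphic:
      "(D, \<phi>) \<in> atlas M \<Longrightarrow>
         homeomorphic_map (subtopology (mtop M) D)
           (subtopology (tvs_topology (model M)) (\<phi> ` D)) \<phi>"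
    and charts_cover: "(\<Union>(D, \<phi>)\<in>atlas M. D) = topspace (mtop M)"
    and transition_smooth:
      "(D, \<phi>) \<in> atlas M \<Longrightarrow> (D', \<psi>) \<in> atlas M \<Longrightarrow>
         bgn_smooth (model M) (model M) (\<phi> ` (D \<inter> D')) (\<psi> \<circ> inv_into D \<phi>)"

definition smooth_map :: "('m, 'e) manifold \<Rightarrow> ('n, 'f) manifold \<Rightarrow> ('m \<Rightarrow> 'n) \<Rightarrow> bool" where
  "smooth_map M N f \<longleftrightarrow> continuous_map (mtop M) (mtop N) f \<and>
     (\<forall>(D, \<phi>) \<in> atlas M. \<forall>(D', \<psi>) \<in> atlas N.
        bgn_smooth (model M) (model N) (\<phi> ` (D \<inter> f -` D')) (\<psi> \<circ> f \<circ> inv_into D \<phi>))"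

definition real_line :: "(real, real) manifold" where
  "real_line = \<lparr>mtop = euclideanreal, model = real_tvs, atlas = {(UNIV, id)}\<rparr>"

text \<open>The interval \<open>[0,1]\<close> is a manifold with boundary and not a \<open>manifold\<close> as above: the image
  of its chart is not open in the model space. It has dense interior, however, so that
  \<open>smooth_map\<close> keeps its meaning for the interval and for its products with manifolds.\<close>

definition unit_interval :: "(real, real) manifold" where
  "unit_interval = \<lparr>mtop = top_of_set {0..1}, model = real_tvs, atlas = {({0..1}, id)}\<rparr>"

definition manifold_prod :: "('m, 'e) manifold \<Rightarrow> ('n, 'f) manifold \<Rightarrow> ('m \<times> 'n, 'e \<times> 'f) manifold"
  where
  "manifold_prod M N = \<lparr>mtop = prod_topology (mtop M) (mtop N),
     model = tvs_prod (model M) (model N),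
     atlas = {(D \<times> D', map_prod \<phi> \<psi>) |D \<phi> D' \<psi>. (D, \<phi>) \<in> atlas M \<and> (D', \<psi>) \<in> atlas N}\<rparr>"

definition manifold_power :: "('m, 'e) manifold \<Rightarrow> nat \<Rightarrow> (nat \<Rightarrow> 'm, nat \<Rightarrow> 'e) manifold" where
  "manifold_power M q = \<lparr>mtop = product_topology (\<lambda>_. mtop M) {..q},
     model = tvs_power (model M) q,
     atlas = {(\<Pi>\<^sub>E i\<in>{..q}. fst (c i), \<lambda>x. \<lambda>i\<in>{..q}. snd (c i) (x i)) |c. c \<in> {..q} \<rightarrow> atlas M}\<rparr>"

definition open_submanifold :: "('m, 'e) manifold \<Rightarrow> 'm set \<Rightarrow> ('m, 'e) manifold" where
  "open_submanifold M W = \<lparr>mtop = subtopology (mtop M) W, model = model M,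
     atlas = {(D \<inter> W, \<phi>) |D \<phi>. (D, \<phi>) \<in> atlas M}\<rparr>"


section \<open>Lie groups and smooth loop contractibility\<close>

record ('v, 'f) lie_group = "'v monoid" +
  mfd :: "('v, 'f) manifold"

locale lie_group = group V + mfd: manifold "mfd V" for V :: "('v, 'f) lie_group" (structure) +
  assumes carrier_eq: "topspace (mtop (mfd V)) = carrier V"
    and smooth_mult: "smooth_map (manifold_prod (mfd V) (mfd V)) (mfd V) (\<lambda>(x, y). x \<otimes> y)"
    and smooth_inv: "smooth_map (mfd V) (mfd V) (\<lambda>x. inv x)"

definition lie_hom :: "('v, 'f) lie_group \<Rightarrow> ('w, 'g) lie_group \<Rightarrow> ('v \<Rightarrow> 'w) set" where
  "lie_hom V W = {h \<in> hom V W. smooth_map (mfd V) (mfd W) h}"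

definition smoothly_loop_contractible :: "('v, 'f) lie_group \<Rightarrow> bool" where
  "smoothly_loop_contractible V \<longleftrightarrow>
     (\<exists>\<Phi>. smooth_map (manifold_prod (mfd V) unit_interval) (mfd V) \<Phi> \<and>
          (\<forall>g\<in>carrier V. \<Phi> (g, 0) = g \<and> \<Phi> (g, 1) = \<one>\<^bsub>V\<^esub>) \<and>
          (\<forall>t\<in>{0..1}. (\<lambda>g. \<Phi> (g, t)) \<in> lie_hom V V))"


section \<open>Coverings and smooth partitions of unity\<close>

definition open_covering :: "('m, 'e) manifold \<Rightarrow> 'i set \<Rightarrow> ('i \<Rightarrow> 'm set) \<Rightarrow> bool" where
  "open_covering M I U \<longleftrightarrow> (\<forall>i\<in>I. openin (mtop M) (U i)) \<and> (\<Union>i\<in>I. U i) = topspace (mtop M)"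

definition supp_on :: "('m, 'e) manifold \<Rightarrow> ('m \<Rightarrow> real) \<Rightarrow> 'm set" where
  "supp_on M f = mtop M closure_of {x \<in> topspace (mtop M). f x \<noteq> 0}"

text \<open>Local finiteness is that of the indexed family of supports. It makes the index set of
  the sum below finite.\<close>

definition smooth_partition_of_unity ::
    "('m, 'e) manifold \<Rightarrow> 'i set \<Rightarrow> ('i \<Rightarrow> 'm \<Rightarrow> real) \<Rightarrow> bool" where
  "smooth_partition_of_unity M I \<phi> \<longleftrightarrow>
     (\<forall>i\<in>I. smooth_map M real_line (\<phi> i)) \<and>
     (\<Union>i\<in>I. supp_on M (\<phi> i)) = topspace (mtop M) \<and>
     (\<forall>x\<in>topspace (mtop M). \<exists>W. openin (mtop M) W \<and> x \<in> W \<and>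
        finite {i \<in> I. supp_on M (\<phi> i) \<inter> W \<noteq> {}}) \<and>
     (\<forall>x\<in>topspace (mtop M). (\<Sum>i\<in>{i \<in> I. \<phi> i x \<noteq> 0}. \<phi> i x) = 1)"

definition smoothly_numerable :: "('m, 'e) manifold \<Rightarrow> 'i set \<Rightarrow> ('i \<Rightarrow> 'm set) \<Rightarrow> bool" where
  "smoothly_numerable M I W \<longleftrightarrow> open_covering M I W \<and>
     (\<exists>\<phi>. smooth_partition_of_unity M I \<phi> \<and> (\<forall>i\<in>I. supp_on M (\<phi> i) \<subseteq> W i))"

text \<open>\<open>cov_power I U q\<close> is the neighbourhood \<open>\<UU>[q]\<close> of the diagonal; its points are the tuples
  \<open>(u\<^sub>0, \<dots>, u\<^sub>q)\<close>, as extensional functions on \<open>{0, \<dots>, q}\<close>.\<close>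

definition cov_power :: "'i set \<Rightarrow> ('i \<Rightarrow> 'm set) \<Rightarrow> nat \<Rightarrow> (nat \<Rightarrow> 'm) set" where
  "cov_power I U q = (\<Union>i\<in>I. {..q} \<rightarrow>\<^sub>E U i)"


section \<open>Cohomology of cochain complexes of abelian groups\<close>

text \<open>A cochain complex is given by its groups \<open>C q\<close> and its differentials
  \<open>d q : C q \<rightarrow> C (q + 1)\<close> for \<open>q \<ge> 0\<close>.\<close>

definition coboundaries :: "(nat \<Rightarrow> 'c monoid) \<Rightarrow> (nat \<Rightarrow> 'c \<Rightarrow> 'c) \<Rightarrow> nat \<Rightarrow> 'c set" where
  "coboundaries C d q = (case q of 0 \<Rightarrow> {\<one>\<^bsub>C 0\<^esub>} | Suc p \<Rightarrow> d p ` carrier (C p))"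

definition cohomology :: "(nat \<Rightarrow> 'c monoid) \<Rightarrow> (nat \<Rightarrow> 'c \<Rightarrow> 'c) \<Rightarrow> nat \<Rightarrow> 'c set monoid" where
  "cohomology C d q =
     (C q)\<lparr>carrier := kernel (C q) (C (Suc q)) (d q)\<rparr> Mod coboundaries C d q"

text \<open>The map in cohomology induced by a morphism \<open>h\<close> of cochain complexes from \<open>(C, d)\<close> to
  \<open>(C', d')\<close>: the class of a cocycle \<open>z\<close> is mapped to the class of \<open>h q z\<close>.\<close>

definition cohomology_map ::
    "(nat \<Rightarrow> 'c' monoid) \<Rightarrow> (nat \<Rightarrow> 'c' \<Rightarrow> 'c') \<Rightarrow> (nat \<Rightarrow> 'c \<Rightarrow> 'c') \<Rightarrow> nat \<Rightarrow> 'c set \<Rightarrow> 'c' set" where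
  "cohomology_map C' d' h q X = coboundaries C' d' q <#>\<^bsub>C' q\<^esub> (h q ` X)"


section \<open>The complexes of the covering\<close>

text \<open>\<open>face q k\<close> deletes the \<open>k\<close>-th entry of a tuple \<open>(u\<^sub>0, \<dots>, u\<^sub>q\<^sub>+\<^sub>1)\<close>. The group \<open>V\<close> is written
  multiplicatively, so the alternating sum becomes a product of powers with exponents
  \<open>1\<close> and \<open>-1\<close>. The same differential serves for the functions on \<open>S q = \<UU>[q]\<close> and for the
  Cech cochains, where \<open>S q\<close> is a set of index tuples.\<close>

definition face :: "nat \<Rightarrow> nat \<Rightarrow> (nat \<Rightarrow> 'x) \<Rightarrow> nat \<Rightarrow> 'x" where
  "face q k u = (\<lambda>j\<in>{..q}. u (if j < k then j else Suc j))"

definition alt_diff ::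
    "('v, 'b) monoid_scheme \<Rightarrow> (nat \<Rightarrow> (nat \<Rightarrow> 'x) set) \<Rightarrow> nat \<Rightarrow> ((nat \<Rightarrow> 'x) \<Rightarrow> 'v) \<Rightarrow> ((nat \<Rightarrow> 'x) \<Rightarrow> 'v)"
  where
  "alt_diff V S q f =
     (\<lambda>u\<in>S (Suc q). \<Otimes>\<^bsub>V\<^esub>k\<in>{..Suc q}. f (face q k u) [^]\<^bsub>V\<^esub> ((-1) ^ k :: int))"

definition A_all :: "'i set \<Rightarrow> ('i \<Rightarrow> 'm set) \<Rightarrow> ('v, 'f) lie_group \<Rightarrow> nat \<Rightarrow> ((nat \<Rightarrow> 'm) \<Rightarrow> 'v) monoid"
  where
  "A_all I U V q = product_group (cov_power I U q) (\<lambda>_. V)"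

definition A_cont :: "('m, 'e) manifold \<Rightarrow> 'i set \<Rightarrow> ('i \<Rightarrow> 'm set) \<Rightarrow> ('v, 'f) lie_group \<Rightarrow> nat \<Rightarrow>
    ((nat \<Rightarrow> 'm) \<Rightarrow> 'v) monoid" where
  "A_cont M I U V q = (A_all I U V q)\<lparr>carrier := {f \<in> carrier (A_all I U V q).
     continuous_map (mtop (open_submanifold (manifold_power M q) (cov_power I U q)))
       (mtop (mfd V)) f}\<rparr>"

definition A_smooth :: "('m, 'e) manifold \<Rightarrow> 'i set \<Rightarrow> ('i \<Rightarrow> 'm set) \<Rightarrow> ('v, 'f) lie_group \<Rightarrow> nat \<Rightarrow>
    ((nat \<Rightarrow> 'm) \<Rightarrow> 'v) monoid" where
  "A_smooth M I U V q = (A_all I U V q)\<lparr>carrier := {f \<in> carrier (A_all I U V q).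
     smooth_map (open_submanifold (manifold_power M q) (cov_power I U q)) (mfd V) f}\<rparr>"

text \<open>Index tuples \<open>(i\<^sub>0, \<dots>, i\<^sub>p)\<close> with non-empty intersection.\<close>

definition nerve_tuples :: "'i set \<Rightarrow> ('i \<Rightarrow> 'm set) \<Rightarrow> nat \<Rightarrow> (nat \<Rightarrow> 'i) set" where
  "nerve_tuples I U p = {i \<in> {..p} \<rightarrow>\<^sub>E I. (\<Inter>k\<in>{..p}. U (i k)) \<noteq> {}}"

definition cech :: "'i set \<Rightarrow> ('i \<Rightarrow> 'm set) \<Rightarrow> ('v, 'b) monoid_scheme \<Rightarrow> nat \<Rightarrow> ((nat \<Rightarrow> 'i) \<Rightarrow> 'v) monoid"
  where
  "cech I U V p = (product_group (nerve_tuples I U p) (\<lambda>_. V))\<lparr>carrier :=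
     {v \<in> nerve_tuples I U p \<rightarrow>\<^sub>E carrier V.
        \<forall>i\<in>nerve_tuples I U p. \<forall>\<sigma>. \<sigma> permutes {..p} \<longrightarrow> v (i \<circ> \<sigma>) = v i [^]\<^bsub>V\<^esub> sign \<sigma>}\<rparr>"

definition H_all :: "'i set \<Rightarrow> ('i \<Rightarrow> 'm set) \<Rightarrow> ('v, 'f) lie_group \<Rightarrow> nat \<Rightarrow>
    ((nat \<Rightarrow> 'm) \<Rightarrow> 'v) set monoid" where
  "H_all I U V = cohomology (A_all I U V) (alt_diff V (cov_power I U))"

definition H_cont :: "('m, 'e) manifold \<Rightarrow> 'i set \<Rightarrow> ('i \<Rightarrow> 'm set) \<Rightarrow> ('v, 'f) lie_group \<Rightarrow> nat \<Rightarrow>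
    ((nat \<Rightarrow> 'm) \<Rightarrow> 'v) set monoid" where
  "H_cont M I U V = cohomology (A_cont M I U V) (alt_diff V (cov_power I U))"

definition H_smooth :: "('m, 'e) manifold \<Rightarrow> 'i set \<Rightarrow> ('i \<Rightarrow> 'm set) \<Rightarrow> ('v, 'f) lie_group \<Rightarrow> nat \<Rightarrow>
    ((nat \<Rightarrow> 'm) \<Rightarrow> 'v) set monoid" where
  "H_smooth M I U V = cohomology (A_smooth M I U V) (alt_diff V (cov_power I U))"

definition H_cech :: "'i set \<Rightarrow> ('i \<Rightarrow> 'm set) \<Rightarrow> ('v, 'b) monoid_scheme \<Rightarrow> nat \<Rightarrow>
    ((nat \<Rightarrow> 'i) \<Rightarrow> 'v) set monoid" where
  "H_cech I U V = cohomology (cech I U V) (alt_diff V (nerve_tuples I U))"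

end

theory Submission
  imports Defs
begin

text \<open>
  All the complexes in question are edges of one kind of double complex. A cochain of bidegree \<open>(p, q)\<close> is
  a function of \<open>p\<close> indices and \<open>q\<close> points such that all the points lie in all the sets with these indices;
  it is alternating in the indices, and smooth, continuous or arbitrary in the points. For \<open>p = 0\<close> only a
  tuple of points remains, and one has the functions on the neighbourhoods \<open>\<UU>[q - 1]\<close> of the diagonal; for
  \<open>q = 0\<close> one has the Cech cochains. The differentials omit an index or a point. If the rows with \<open>q > 0\<close>
  and the columns with \<open>p > 0\<close> are exact, the usual diagram chase along the antidiagonals relates the
  cohomologies of the two edges (\<open>zigzag_total\<close>, \<open>zigzag_onto\<close>, \<open>zigzag_trivial\<close>), whence the isomorphism
  with Cech cohomology for each of the three classes of functions (\<open>cohomology_iso_cech\<close>). The chase in the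
  smooth double complex is a chase in the double complex of all functions. Therefore a smooth cocycle and an
  arbitrary one that lead to the same Cech cocycle are cohomologous, which makes the inclusion of the smooth
  cochains an isomorphism in cohomology (\<open>cohomology_inclusion_iso\<close>).

  The columns are exact because a point of the intersection of the sets can be inserted in front of the
  given points (\<open>columns_exact\<close>). The rows are exact because of the partitions of unity (\<open>rows_exact\<close>). With
  values in a vector space, a contraction of the rows would be \<open>f \<mapsto> \<Sum>\<^sub>j \<phi>\<^sub>j(u) f(j, i, u)\<close>. In the group \<open>V\<close>,
  for the moment written additively, the loop contraction \<open>\<Phi>\<close> provides a substitute for the
  multiplication of \<open>v\<close> by \<open>\<phi>\<^sub>j(u)\<close>, namely \<open>\<Phi>(v, s) - \<Phi>(v, s + \<phi>\<^sub>j(u))\<close> where \<open>s\<close> is the sum of the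
  \<open>\<phi>\<^sub>i(u)\<close> over all \<open>i\<close> that precede \<open>j\<close> in a well-order. It is additive in \<open>v\<close> since each \<open>\<Phi>(-, t)\<close> is a
  homomorphism, it vanishes where \<open>\<phi>\<^sub>j\<close> does, and the sum over \<open>j\<close> telescopes to
  \<open>\<Phi>(v, 0) - \<Phi>(v, 1) = v\<close> (\<open>telescoping_product\<close>, \<open>mu_sum\<close>). The functions \<open>\<phi>\<^sub>j\<close> may take negative
  values, so that \<open>s\<close> may leave the interval \<open>[0,1]\<close>; the contraction is therefore composed with a smooth
  map \<open>\<real> \<rightarrow> [0,1]\<close> that fixes \<open>0\<close> and \<open>1\<close> (\<open>unit_bump\<close>).

  Locally finite products of such functions, extended by the neutral element outside the supports, have to
  be smooth again (\<open>reg_partition\<close>). This rests on the chain rule (\<open>Ck_compose\<close>) and on the fact that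
  smoothness is a local property (\<open>Ck_locally\<close>), the only place where the calculus needs an idea: its
  definition by difference quotients compares points that need not be close to each other.
\<close>

section \<open>Subquotients of abelian groups\<close>

lemma (in comm_group) subgroup_comm_group:
  assumes "subgroup Z G" shows "comm_group (G\<lparr>carrier := Z\<rparr>)"
  using subgroup.subgroup_is_group[OF assms is_group] subgroup.mem_carrier[OF assms]
  by (intro group.group_comm_groupI) (auto intro: m_comm)

lemma FactGroup_rcos_eq_iff:
  assumes "comm_group G" "subgroup Z G" "subgroup B G" "B \<subseteq> Z" "x \<in> Z" "y \<in> Z"
  shows "B #>\<^bsub>G\<lparr>carrier := Z\<rparr>\<^esub> x = B #>\<^bsub>G\<lparr>carrier := Z\<rparr>\<^esub> y \<longleftrightarrow> x \<otimes>\<^bsub>G\<^esub> inv\<^bsub>G\<^esub> y \<in> B"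
proof -
  interpret G: comm_group G by fact
  interpret Z: subgroup Z G by fact
  interpret B: subgroup B G by fact
  have xy: "x \<in> carrier G" "y \<in> carrier G" using assms Z.subset by auto
  have "(B #>\<^bsub>G\<^esub> x = B #>\<^bsub>G\<^esub> y) \<longleftrightarrow> x \<otimes>\<^bsub>G\<^esub> inv\<^bsub>G\<^esub> y \<in> B"
  proof
    assume "B #>\<^bsub>G\<^esub> x = B #>\<^bsub>G\<^esub> y"
    then have "x \<in> B #>\<^bsub>G\<^esub> y" using G.rcos_self[OF xy(1) assms(3)] by simp
    then obtain b where b: "b \<in> B" "x = b \<otimes>\<^bsub>G\<^esub> y" by (auto simp: r_coset_def)
    then show "x \<otimes>\<^bsub>G\<^esub> inv\<^bsub>G\<^esub> y \<in> B" using xy by (simp add: G.m_assoc)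
  next
    assume b: "x \<otimes>\<^bsub>G\<^esub> inv\<^bsub>G\<^esub> y \<in> B"
    have "x = (x \<otimes>\<^bsub>G\<^esub> inv\<^bsub>G\<^esub> y) \<otimes>\<^bsub>G\<^esub> y" using xy by (simp add: G.m_assoc)
    then have "x \<in> B #>\<^bsub>G\<^esub> y" using b by (auto simp: r_coset_def)
    then show "B #>\<^bsub>G\<^esub> x = B #>\<^bsub>G\<^esub> y" using G.repr_independence[OF _ xy(2) assms(3)] by metis
  qed
  then show ?thesis by (simp add: r_coset_def)
qed

text \<open>Two elements related to the same one differ by an element related to the unit, which is trivial in the
  quotient. Hence the relation induces a map of the quotients, and by symmetry an isomorphism.\<close>

lemma correspondence_iso:
  fixes G :: "'a monoid" and G' :: "'b monoid"
  assumes G: "comm_group G" "subgroup Z G" "subgroup B G" "B \<subseteq> Z"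
    and G': "comm_group G'" "subgroup Z' G'" "subgroup B' G'" "B' \<subseteq> Z'"
    and R_mult: "\<And>z z' w w'. z \<in> Z \<Longrightarrow> z' \<in> Z' \<Longrightarrow> w \<in> Z \<Longrightarrow> w' \<in> Z' \<Longrightarrow> R z z' \<Longrightarrow> R w w'
                   \<Longrightarrow> R (z \<otimes>\<^bsub>G\<^esub> w) (z' \<otimes>\<^bsub>G'\<^esub> w')"
    and R_inv: "\<And>z z'. z \<in> Z \<Longrightarrow> z' \<in> Z' \<Longrightarrow> R z z' \<Longrightarrow> R (inv\<^bsub>G\<^esub> z) (inv\<^bsub>G'\<^esub> z')"
    and R_total: "\<And>z. z \<in> Z \<Longrightarrow> \<exists>z'\<in>Z'. R z z'"
    and R_onto: "\<And>z'. z' \<in> Z' \<Longrightarrow> \<exists>z\<in>Z. R z z'"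
    and R_trivial: "\<And>z z'. z \<in> Z \<Longrightarrow> z' \<in> Z' \<Longrightarrow> R z z' \<Longrightarrow> z \<in> B \<longleftrightarrow> z' \<in> B'"
  shows "(G\<lparr>carrier := Z\<rparr>) Mod B \<cong> (G'\<lparr>carrier := Z'\<rparr>) Mod B'"
proof -
  let ?Z = "G\<lparr>carrier := Z\<rparr>" and ?Z' = "G'\<lparr>carrier := Z'\<rparr>"
  interpret G: comm_group G by fact
  interpret G': comm_group G' by fact
  interpret Z: subgroup Z G by fact
  interpret Z': subgroup Z' G' by fact
  interpret CZ: comm_group ?Z by (rule G.subgroup_comm_group) fact
  interpret CZ': comm_group ?Z' by (rule G'.subgroup_comm_group) fact
  have sB': "subgroup B' ?Z'" using G' by (simp add: G'.subgroup_incl)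
  have nB': "B' \<lhd> ?Z'" using sB' by (rule CZ'.subgroup_imp_normal)
  interpret Q: comm_group "?Z' Mod B'" using CZ'.abelian_FactGroup[OF sB'] .
  define s where "s z = (SOME z'. z' \<in> Z' \<and> R z z')" for z
  have s: "s z \<in> Z' \<and> R z (s z)" if "z \<in> Z" for z
    unfolding s_def by (rule someI_ex) (use R_total[OF that] in blast)
  define f where "f z = B' #>\<^bsub>?Z'\<^esub> s z" for z
  have f_eq: "f z = B' #>\<^bsub>?Z'\<^esub> z'" if "z \<in> Z" "z' \<in> Z'" "R z z'" for z z'
  proof -
    have "R (z \<otimes>\<^bsub>G\<^esub> inv\<^bsub>G\<^esub> z) (s z \<otimes>\<^bsub>G'\<^esub> inv\<^bsub>G'\<^esub> z')"
      using s[OF that(1)] that by (intro R_mult R_inv) auto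
    then have "s z \<otimes>\<^bsub>G'\<^esub> inv\<^bsub>G'\<^esub> z' \<in> B' \<longleftrightarrow> z \<otimes>\<^bsub>G\<^esub> inv\<^bsub>G\<^esub> z \<in> B"
      using s[OF that(1)] that by (intro R_trivial[symmetric]) auto
    moreover have "z \<otimes>\<^bsub>G\<^esub> inv\<^bsub>G\<^esub> z \<in> B"
      using that(1) subgroup.one_closed[OF G(3)] Z.subset by auto
    ultimately show ?thesis
      unfolding f_def using FactGroup_rcos_eq_iff[OF G', of "s z" z'] s[OF that(1)] that by auto
  qed
  have carrQ: "carrier (?Z' Mod B') = (\<lambda>x. B' #>\<^bsub>?Z'\<^esub> x) ` Z'"
    by (simp add: carrier_FactGroup)
  interpret f: group_hom ?Z "?Z' Mod B'" f
  proof (unfold_locales, rule homI)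
    show "f x \<in> carrier (?Z' Mod B')" if "x \<in> carrier ?Z" for x
      using s[of x] that carrQ by (auto simp: f_def)
    show "f (x \<otimes>\<^bsub>?Z\<^esub> y) = f x \<otimes>\<^bsub>?Z' Mod B'\<^esub> f y" if xy: "x \<in> carrier ?Z" "y \<in> carrier ?Z" for x y
    proof -
      have "f (x \<otimes>\<^bsub>?Z\<^esub> y) = B' #>\<^bsub>?Z'\<^esub> (s x \<otimes>\<^bsub>?Z'\<^esub> s y)"
        by (rule f_eq) (use s[of x] s[of y] xy R_mult in auto)
      also have "\<dots> = f x \<otimes>\<^bsub>?Z' Mod B'\<^esub> f y"
        unfolding f_def mult_FactGroup
        by (rule normal.rcos_sum[OF nB', symmetric]) (use s[of x] s[of y] xy in auto)
      finally show ?thesis .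
    qed
  qed
  have onto: "f ` carrier ?Z = carrier (?Z' Mod B')"
  proof
    show "f ` carrier ?Z \<subseteq> carrier (?Z' Mod B')" using f.hom_closed by auto
    show "carrier (?Z' Mod B') \<subseteq> f ` carrier ?Z"
    proof
      fix X assume "X \<in> carrier (?Z' Mod B')"
      then obtain z' where z': "z' \<in> Z'" "X = B' #>\<^bsub>?Z'\<^esub> z'" by (auto simp: carrQ)
      then obtain z where "z \<in> Z" "R z z'" using R_onto by blast
      then show "X \<in> f ` carrier ?Z" using f_eq z' by auto
    qed
  qed
  have fB': "f z = B' \<longleftrightarrow> s z \<in> B'" if "z \<in> Z" for z
    using FactGroup_rcos_eq_iff[OF G', of "s z" "\<one>\<^bsub>G'\<^esub>"] s[OF that] CZ'.coset_mult_one[of B']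
      subgroup.subset[OF sB'] Z'.subset
    by (auto simp: f_def)
  have "kernel ?Z (?Z' Mod B') f = {z \<in> Z. s z \<in> B'}"
    unfolding kernel_def using fB' by (simp cong: conj_cong)
  also have "\<dots> = {z \<in> Z. z \<in> B}" using s R_trivial by blast
  finally have "kernel ?Z (?Z' Mod B') f = B" using G(4) by auto
  then have "(\<lambda>X. the_elem (f ` X)) \<in> iso (?Z Mod B) (?Z' Mod B')"
    using f.FactGroup_iso_set[OF onto] by simp
  then show ?thesis by (auto simp: is_iso_def)
qed

text \<open>On cosets the inclusion of the pair \<open>(Z, B)\<close> into \<open>(Z', B')\<close> is \<open>B z \<mapsto> B' z\<close>, which is the
  multiplication by the set \<open>B'\<close>.\<close>

lemma subquotient_inclusion_iso:
  fixes G :: "'a monoid"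
  assumes G: "comm_group G" and Z: "subgroup Z G" "subgroup B G" "B \<subseteq> Z"
    and Z': "subgroup Z' G" "subgroup B' G" "B' \<subseteq> Z'" and incl: "Z \<subseteq> Z'" "B \<subseteq> B'"
    and inj: "\<And>z. z \<in> Z \<Longrightarrow> z \<in> B' \<Longrightarrow> z \<in> B"
    and surj: "\<And>z. z \<in> Z' \<Longrightarrow> \<exists>w\<in>Z. z \<otimes>\<^bsub>G\<^esub> inv\<^bsub>G\<^esub> w \<in> B'"
  shows "(\<lambda>X. B' <#>\<^bsub>G\<^esub> X) \<in> iso ((G\<lparr>carrier := Z\<rparr>) Mod B) ((G\<lparr>carrier := Z'\<rparr>) Mod B')"
proof -
  let ?Z = "G\<lparr>carrier := Z\<rparr>" and ?Z' = "G\<lparr>carrier := Z'\<rparr>"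
  interpret G: comm_group G by fact
  interpret Z: subgroup Z G by fact
  interpret Z': subgroup Z' G by fact
  interpret B: subgroup B G by fact
  interpret B': subgroup B' G by fact
  interpret CZ: comm_group ?Z by (rule G.subgroup_comm_group) fact
  interpret CZ': comm_group ?Z' by (rule G.subgroup_comm_group) fact
  have sB: "subgroup B ?Z" using Z by (simp add: G.subgroup_incl)
  have sB': "subgroup B' ?Z'" using Z' by (simp add: G.subgroup_incl)
  have nB: "B \<lhd> ?Z" using sB by (rule CZ.subgroup_imp_normal)
  have nB': "B' \<lhd> ?Z'" using sB' by (rule CZ'.subgroup_imp_normal)
  have image: "B' <#>\<^bsub>G\<^esub> (B #>\<^bsub>?Z\<^esub> z) = B' #>\<^bsub>?Z'\<^esub> z" if "z \<in> Z" for z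
  proof
    have zG: "z \<in> carrier G" using that Z.subset by auto
    show "B' <#>\<^bsub>G\<^esub> (B #>\<^bsub>?Z\<^esub> z) \<subseteq> B' #>\<^bsub>?Z'\<^esub> z"
    proof
      fix x assume "x \<in> B' <#>\<^bsub>G\<^esub> (B #>\<^bsub>?Z\<^esub> z)"
      then obtain b' b where "b' \<in> B'" "b \<in> B" "x = b' \<otimes>\<^bsub>G\<^esub> (b \<otimes>\<^bsub>G\<^esub> z)"
        by (auto simp: set_mult_def r_coset_def)
      then have "x = (b' \<otimes>\<^bsub>G\<^esub> b) \<otimes>\<^bsub>G\<^esub> z" "b' \<otimes>\<^bsub>G\<^esub> b \<in> B'"
        using zG incl(2) by (auto simp: G.m_assoc)
      then show "x \<in> B' #>\<^bsub>?Z'\<^esub> z" unfolding r_coset_def by auto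
    qed
    show "B' #>\<^bsub>?Z'\<^esub> z \<subseteq> B' <#>\<^bsub>G\<^esub> (B #>\<^bsub>?Z\<^esub> z)"
    proof
      fix x assume "x \<in> B' #>\<^bsub>?Z'\<^esub> z"
      then obtain b' where "b' \<in> B'" "x = b' \<otimes>\<^bsub>G\<^esub> z" by (auto simp: r_coset_def)
      moreover from this have "x = b' \<otimes>\<^bsub>G\<^esub> (\<one>\<^bsub>G\<^esub> \<otimes>\<^bsub>G\<^esub> z)" using zG by auto
      ultimately show "x \<in> B' <#>\<^bsub>G\<^esub> (B #>\<^bsub>?Z\<^esub> z)"
        using B.one_closed by (fastforce simp: set_mult_def r_coset_def)
    qed
  qed
  have carr: "carrier (?Z Mod B) = (\<lambda>x. B #>\<^bsub>?Z\<^esub> x) ` Z" "carrier (?Z' Mod B') = (\<lambda>x. B' #>\<^bsub>?Z'\<^esub> x) ` Z'"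
    by (simp_all add: carrier_FactGroup)
  let ?f = "\<lambda>X. B' <#>\<^bsub>G\<^esub> X"
  have hom: "?f \<in> hom (?Z Mod B) (?Z' Mod B')"
  proof (rule homI)
    show "?f X \<in> carrier (?Z' Mod B')" if "X \<in> carrier (?Z Mod B)" for X
      using that image incl(1) by (auto simp: carr)
    show "?f (X \<otimes>\<^bsub>?Z Mod B\<^esub> Y) = ?f X \<otimes>\<^bsub>?Z' Mod B'\<^esub> ?f Y"
      if XY: "X \<in> carrier (?Z Mod B)" "Y \<in> carrier (?Z Mod B)" for X Y
    proof -
      obtain x y where x: "x \<in> Z" "X = B #>\<^bsub>?Z\<^esub> x" and y: "y \<in> Z" "Y = B #>\<^bsub>?Z\<^esub> y"
        using XY by (auto simp: carr)
      have "X \<otimes>\<^bsub>?Z Mod B\<^esub> Y = B #>\<^bsub>?Z\<^esub> (x \<otimes>\<^bsub>?Z\<^esub> y)"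
        unfolding x y mult_FactGroup by (rule normal.rcos_sum[OF nB]) (use x y in auto)
      then have "?f (X \<otimes>\<^bsub>?Z Mod B\<^esub> Y) = B' #>\<^bsub>?Z'\<^esub> (x \<otimes>\<^bsub>?Z'\<^esub> y)" using image x y by simp
      also have "\<dots> = ?f X \<otimes>\<^bsub>?Z' Mod B'\<^esub> ?f Y"
        unfolding mult_FactGroup x y image[OF x(1)] image[OF y(1)]
        by (rule normal.rcos_sum[OF nB', symmetric]) (use x y incl in auto)
      finally show ?thesis .
    qed
  qed
  have "inj_on ?f (carrier (?Z Mod B))"
  proof (rule inj_onI)
    fix X Y assume XY: "X \<in> carrier (?Z Mod B)" "Y \<in> carrier (?Z Mod B)" and eq: "?f X = ?f Y"
    obtain x y where x: "x \<in> Z" "X = B #>\<^bsub>?Z\<^esub> x" and y: "y \<in> Z" "Y = B #>\<^bsub>?Z\<^esub> y"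
      using XY by (auto simp: carr)
    have "x \<otimes>\<^bsub>G\<^esub> inv\<^bsub>G\<^esub> y \<in> B'"
      using eq FactGroup_rcos_eq_iff[OF G Z', of x y] x y incl image by auto
    then have "x \<otimes>\<^bsub>G\<^esub> inv\<^bsub>G\<^esub> y \<in> B" using x y by (intro inj) auto
    then show "X = Y" using FactGroup_rcos_eq_iff[OF G Z, of x y] x y by auto
  qed
  moreover have "?f ` carrier (?Z Mod B) = carrier (?Z' Mod B')"
  proof
    show "?f ` carrier (?Z Mod B) \<subseteq> carrier (?Z' Mod B')" using hom by (auto simp: hom_def)
    show "carrier (?Z' Mod B') \<subseteq> ?f ` carrier (?Z Mod B)"
    proof
      fix X assume "X \<in> carrier (?Z' Mod B')"
      then obtain z where z: "z \<in> Z'" "X = B' #>\<^bsub>?Z'\<^esub> z" by (auto simp: carr)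
      obtain w where w: "w \<in> Z" "z \<otimes>\<^bsub>G\<^esub> inv\<^bsub>G\<^esub> w \<in> B'" using surj z by blast
      then have "X = B' #>\<^bsub>?Z'\<^esub> w" using FactGroup_rcos_eq_iff[OF G Z', of z w] z incl by auto
      then show "X \<in> ?f ` carrier (?Z Mod B)" using image[OF w(1)] w by (auto simp: carr)
    qed
  qed
  ultimately show ?thesis using hom by (simp add: iso_def bij_betw_def)
qed


section \<open>Double complexes with exact rows and columns\<close>

text \<open>\<open>zigzag G dh dv p q x y\<close> relates \<open>x\<close> at the place \<open>(0, p + q)\<close> to \<open>y\<close> at the place \<open>(p, q)\<close> by a chain of
  elements on their antidiagonal in which neighbours have the same image under the two differentials that
  meet. Neither exactness nor a choice of preimages enters, so that the relation is monotone in the groups.\<close>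

inductive zigzag :: "(nat \<Rightarrow> nat \<Rightarrow> 'c monoid) \<Rightarrow> (nat \<Rightarrow> nat \<Rightarrow> 'c \<Rightarrow> 'c) \<Rightarrow> (nat \<Rightarrow> nat \<Rightarrow> 'c \<Rightarrow> 'c) \<Rightarrow>
    nat \<Rightarrow> nat \<Rightarrow> 'c \<Rightarrow> 'c \<Rightarrow> bool" for G dh dv where
  zigzag_0: "x \<in> carrier (G 0 q) \<Longrightarrow> zigzag G dh dv 0 q x x"
| zigzag_Suc: "zigzag G dh dv p (Suc q) x w \<Longrightarrow> y \<in> carrier (G (Suc p) q) \<Longrightarrow>
     dh p (Suc q) w = dv (Suc p) q y \<Longrightarrow> zigzag G dh dv (Suc p) q x y"

inductive_cases zigzag_SucE: "zigzag G dh dv (Suc p) q x y"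
inductive_cases zigzag_0E: "zigzag G dh dv 0 q x y"

text \<open>The row and the column with index \<open>0\<close> are the complexes to be compared, and exactness is required of all
  the others. The differentials commute instead of
  anticommuting, which spares the signs in the zigzags.\<close>

locale double_complex =
  fixes G :: "nat \<Rightarrow> nat \<Rightarrow> 'c monoid" and dh dv :: "nat \<Rightarrow> nat \<Rightarrow> 'c \<Rightarrow> 'c"
  assumes grp: "comm_group (G p q)"
    and dh_hom: "dh p q \<in> hom (G p q) (G (Suc p) q)"
    and dv_hom: "dv p q \<in> hom (G p q) (G p (Suc q))"
    and dh_dh: "x \<in> carrier (G p q) \<Longrightarrow> dh (Suc p) q (dh p q x) = \<one>\<^bsub>G (Suc (Suc p)) q\<^esub>"
    and dv_dv: "x \<in> carrier (G p q) \<Longrightarrow> dv p (Suc q) (dv p q x) = \<one>\<^bsub>G p (Suc (Suc q))\<^esub>"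
    and dh_dv: "x \<in> carrier (G p q) \<Longrightarrow> dh p (Suc q) (dv p q x) = dv (Suc p) q (dh p q x)"
    and row_mono: "x \<in> carrier (G 0 (Suc q)) \<Longrightarrow> dh 0 (Suc q) x = \<one>\<^bsub>G (Suc 0) (Suc q)\<^esub>
                     \<Longrightarrow> x = \<one>\<^bsub>G 0 (Suc q)\<^esub>"
    and row_exact: "x \<in> carrier (G (Suc p) (Suc q)) \<Longrightarrow>
          dh (Suc p) (Suc q) x = \<one>\<^bsub>G (Suc (Suc p)) (Suc q)\<^esub> \<Longrightarrow>
          \<exists>y\<in>carrier (G p (Suc q)). dh p (Suc q) y = x"
    and col_mono: "x \<in> carrier (G (Suc p) 0) \<Longrightarrow> dv (Suc p) 0 x = \<one>\<^bsub>G (Suc p) (Suc 0)\<^esub>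
                     \<Longrightarrow> x = \<one>\<^bsub>G (Suc p) 0\<^esub>"
    and col_exact: "x \<in> carrier (G (Suc p) (Suc q)) \<Longrightarrow>
          dv (Suc p) (Suc q) x = \<one>\<^bsub>G (Suc p) (Suc (Suc q))\<^esub> \<Longrightarrow>
          \<exists>y\<in>carrier (G (Suc p) q). dv (Suc p) q y = x"
begin

sublocale G: comm_group "G p q" for p q by (rule grp)
sublocale dh: group_hom "G p q" "G (Suc p) q" "dh p q" for p q
  by unfold_locales (rule dh_hom)
sublocale dv: group_hom "G p q" "G p (Suc q)" "dv p q" for p q
  by unfold_locales (rule dv_hom)

abbreviation "zz \<equiv> zigzag G dh dv"

definition hcob :: "nat \<Rightarrow> nat \<Rightarrow> 'c set" where
  "hcob p q = (case p of 0 \<Rightarrow> {\<one>\<^bsub>G 0 q\<^esub>} | Suc p' \<Rightarrow> dh p' q ` carrier (G p' q))"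

definition vcob :: "nat \<Rightarrow> nat \<Rightarrow> 'c set" where
  "vcob p q = (case q of 0 \<Rightarrow> {\<one>\<^bsub>G p 0\<^esub>} | Suc q' \<Rightarrow> dv p q' ` carrier (G p q'))"

text \<open>The subquotient \<open>donor_Z p q / donor_B p q\<close> is the donor of the salamander lemma at the place
  \<open>(p, q)\<close>. It interpolates between the cohomology of the column \<open>p = 0\<close> and that of the row
  \<open>q = 0\<close>: exactness makes all donors on an antidiagonal isomorphic, an element at \<open>(p, q + 1)\<close>
  corresponding to one at \<open>(p + 1, q)\<close> if they have the same image at \<open>(p + 1, q + 1)\<close>.\<close>

definition donor_Z :: "nat \<Rightarrow> nat \<Rightarrow> 'c set" where
  "donor_Z p q = {x \<in> carrier (G p q). dh p (Suc q) (dv p q x) = \<one>\<^bsub>G (Suc p) (Suc q)\<^esub>}"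

definition donor_B :: "nat \<Rightarrow> nat \<Rightarrow> 'c set" where
  "donor_B p q = {u \<otimes>\<^bsub>G p q\<^esub> v |u v. u \<in> hcob p q \<and> v \<in> vcob p q}"

lemma hcob_subset: "hcob p q \<subseteq> carrier (G p q)"
  by (auto simp: hcob_def split: nat.splits)

lemma vcob_subset: "vcob p q \<subseteq> carrier (G p q)"
  by (auto simp: vcob_def split: nat.splits)

lemma dh_hcob: "u \<in> hcob p q \<Longrightarrow> dh p q u = \<one>\<^bsub>G (Suc p) q\<^esub>"
  by (auto simp: hcob_def dh_dh split: nat.splits)

lemma dv_vcob: "u \<in> vcob p q \<Longrightarrow> dv p q u = \<one>\<^bsub>G p (Suc q)\<^esub>"
  by (auto simp: vcob_def dv_dv split: nat.splits)

lemma row_ker: "x \<in> carrier (G p (Suc q)) \<Longrightarrow> dh p (Suc q) x = \<one>\<^bsub>G (Suc p) (Suc q)\<^esub> \<Longrightarrow> x \<in> hcob p (Suc q)"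
  using row_mono row_exact by (cases p) (fastforce simp: hcob_def)+

lemma col_ker: "x \<in> carrier (G (Suc p) q) \<Longrightarrow> dv (Suc p) q x = \<one>\<^bsub>G (Suc p) (Suc q)\<^esub> \<Longrightarrow> x \<in> vcob (Suc p) q"
  using col_mono col_exact by (cases q) (fastforce simp: vcob_def)+

lemma step_total:
  assumes "x \<in> donor_Z p (Suc q)"
  shows "\<exists>y\<in>donor_Z (Suc p) q. dh p (Suc q) x = dv (Suc p) q y"
proof -
  have x: "x \<in> carrier (G p (Suc q))" "dh p (Suc (Suc q)) (dv p (Suc q) x) = \<one>\<^bsub>G (Suc p) (Suc (Suc q))\<^esub>"
    using assms by (auto simp: donor_Z_def)
  then obtain y where y: "y \<in> carrier (G (Suc p) q)" "dv (Suc p) q y = dh p (Suc q) x"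
    using col_exact[of "dh p (Suc q) x" p q] by (auto simp: dh_dv)
  then have "y \<in> donor_Z (Suc p) q" using x dh_dh by (simp add: donor_Z_def)
  with y show ?thesis by metis
qed

lemma step_onto:
  assumes "y \<in> donor_Z (Suc p) q"
  shows "\<exists>x\<in>donor_Z p (Suc q). dh p (Suc q) x = dv (Suc p) q y"
proof -
  have y: "y \<in> carrier (G (Suc p) q)" "dh (Suc p) (Suc q) (dv (Suc p) q y) = \<one>\<^bsub>G (Suc (Suc p)) (Suc q)\<^esub>"
    using assms by (auto simp: donor_Z_def)
  then obtain x where x: "x \<in> carrier (G p (Suc q))" "dh p (Suc q) x = dv (Suc p) q y"
    using row_exact[of "dv (Suc p) q y" p q] by auto
  then have "x \<in> donor_Z p (Suc q)" using y by (simp add: donor_Z_def dh_dv dv_dv)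
  with x show ?thesis by metis
qed

text \<open>If \<open>x\<close> is the product of a horizontal coboundary and \<open>dv v\<close>, then \<open>y\<close> and \<open>dh v\<close> have the same vertical
  differential, and \<open>y / dh v\<close> is a vertical coboundary because the column is exact. The converse exchanges
  rows and columns.\<close>

lemma step_trivial:
  assumes x: "x \<in> carrier (G p (Suc q))" and y: "y \<in> carrier (G (Suc p) q)"
    and eq: "dh p (Suc q) x = dv (Suc p) q y"
  shows "x \<in> donor_B p (Suc q) \<longleftrightarrow> y \<in> donor_B (Suc p) q"
proof
  assume "x \<in> donor_B p (Suc q)"
  then obtain u v where uv: "u \<in> hcob p (Suc q)" "v \<in> carrier (G p q)" "x = u \<otimes>\<^bsub>G p (Suc q)\<^esub> dv p q v"
    by (auto simp: donor_B_def vcob_def)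
  have uC: "u \<in> carrier (G p (Suc q))" using uv hcob_subset by auto
  have "dv (Suc p) q y = dv (Suc p) q (dh p q v)"
    using eq uv uC by (simp add: dh_hcob dh_dv)
  then have "dv (Suc p) q (y \<otimes>\<^bsub>G (Suc p) q\<^esub> inv\<^bsub>G (Suc p) q\<^esub> dh p q v) = \<one>\<^bsub>G (Suc p) (Suc q)\<^esub>"
    using y uv by simp
  then have w: "y \<otimes>\<^bsub>G (Suc p) q\<^esub> inv\<^bsub>G (Suc p) q\<^esub> dh p q v \<in> vcob (Suc p) q"
    using y uv by (intro col_ker) auto
  have "y = dh p q v \<otimes>\<^bsub>G (Suc p) q\<^esub> (y \<otimes>\<^bsub>G (Suc p) q\<^esub> inv\<^bsub>G (Suc p) q\<^esub> dh p q v)"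
    using y uv G.m_lcomm[of "dh p q v" "Suc p" q y "inv\<^bsub>G (Suc p) q\<^esub> dh p q v"] by simp
  moreover have "dh p q v \<in> hcob (Suc p) q" using uv by (auto simp: hcob_def)
  ultimately show "y \<in> donor_B (Suc p) q" using w unfolding donor_B_def by blast
next
  assume "y \<in> donor_B (Suc p) q"
  then obtain u v where uv: "u \<in> carrier (G p q)" "v \<in> vcob (Suc p) q" "y = dh p q u \<otimes>\<^bsub>G (Suc p) q\<^esub> v"
    by (auto simp: donor_B_def hcob_def)
  have vC: "v \<in> carrier (G (Suc p) q)" using uv vcob_subset by auto
  have "dh p (Suc q) x = dh p (Suc q) (dv p q u)"
    using eq uv vC by (simp add: dv_vcob dh_dv)
  then have "dh p (Suc q) (x \<otimes>\<^bsub>G p (Suc q)\<^esub> inv\<^bsub>G p (Suc q)\<^esub> dv p q u) = \<one>\<^bsub>G (Suc p) (Suc q)\<^esub>"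
    using x uv by simp
  then have w: "x \<otimes>\<^bsub>G p (Suc q)\<^esub> inv\<^bsub>G p (Suc q)\<^esub> dv p q u \<in> hcob p (Suc q)"
    using x uv by (intro row_ker) auto
  have "x = (x \<otimes>\<^bsub>G p (Suc q)\<^esub> inv\<^bsub>G p (Suc q)\<^esub> dv p q u) \<otimes>\<^bsub>G p (Suc q)\<^esub> dv p q u"
    using x uv by (simp add: G.m_assoc)
  moreover have "dv p q u \<in> vcob p (Suc q)" using uv by (auto simp: vcob_def)
  ultimately show "x \<in> donor_B p (Suc q)" using w unfolding donor_B_def by blast
qed

lemma zigzag_closed: "zz p q x y \<Longrightarrow> x \<in> carrier (G 0 (p + q)) \<and> y \<in> carrier (G p q)"
  by (induction rule: zigzag.induct) auto

lemma zigzag_mult: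
  "zz p q x y \<Longrightarrow> zz p q x' y' \<Longrightarrow> zz p q (x \<otimes>\<^bsub>G 0 (p + q)\<^esub> x') (y \<otimes>\<^bsub>G p q\<^esub> y')"
proof (induction p arbitrary: q y y')
  case 0
  then show ?case by (auto elim!: zigzag_0E intro!: zigzag_0)
next
  case (Suc p)
  from Suc.prems obtain w w' where
    w: "zz p (Suc q) x w" "dh p (Suc q) w = dv (Suc p) q y" "y \<in> carrier (G (Suc p) q)" and
    w': "zz p (Suc q) x' w'" "dh p (Suc q) w' = dv (Suc p) q y'" "y' \<in> carrier (G (Suc p) q)"
    by (metis zigzag_SucE)
  show ?case
  proof (rule zigzag_Suc)
    show "zz p (Suc q) (x \<otimes>\<^bsub>G 0 (Suc p + q)\<^esub> x') (w \<otimes>\<^bsub>G p (Suc q)\<^esub> w')"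
      using Suc.IH[OF w(1) w'(1)] by simp
  qed (use w w' zigzag_closed[OF w(1)] zigzag_closed[OF w'(1)] in auto)
qed

lemma zigzag_inv: "zz p q x y \<Longrightarrow> zz p q (inv\<^bsub>G 0 (p + q)\<^esub> x) (inv\<^bsub>G p q\<^esub> y)"
proof (induction rule: zigzag.induct)
  case (zigzag_Suc p q x w y)
  then show ?case using zigzag_closed[OF zigzag_Suc(1)]
    by (intro zigzag.zigzag_Suc[where w = "inv\<^bsub>G p (Suc q)\<^esub> w"]) auto
qed (auto intro: zigzag.intros)

lemma zigzag_total: "x \<in> donor_Z 0 (p + q) \<Longrightarrow> \<exists>y\<in>donor_Z p q. zz p q x y"
proof (induction p arbitrary: q)
  case 0 then show ?case by (auto simp: donor_Z_def intro: zigzag_0)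
next
  case (Suc p)
  then obtain w where w: "w \<in> donor_Z p (Suc q)" "zz p (Suc q) x w" by (metis add_Suc_shift)
  from step_total[OF w(1)] w(2) show ?case by (auto intro: zigzag_Suc simp: donor_Z_def)
qed

lemma zigzag_onto: "y \<in> donor_Z p q \<Longrightarrow> \<exists>x\<in>donor_Z 0 (p + q). zz p q x y"
proof (induction p arbitrary: q y)
  case 0 then show ?case by (auto simp: donor_Z_def intro: zigzag_0)
next
  case (Suc p)
  obtain w where w: "w \<in> donor_Z p (Suc q)" "dh p (Suc q) w = dv (Suc p) q y"
    using step_onto[OF Suc.prems] by auto
  with Suc.IH[OF w(1)] Suc.prems show ?case by (auto intro: zigzag_Suc simp: donor_Z_def)
qed

lemma zigzag_trivial: "zz p q x y \<Longrightarrow> x \<in> donor_B 0 (p + q) \<longleftrightarrow> y \<in> donor_B p q"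
proof (induction rule: zigzag.induct)
  case (zigzag_Suc p q x w y)
  then show ?case using zigzag_closed[OF zigzag_Suc(1)] step_trivial[of w p q y] by auto
qed auto

lemma donor_Z_column: "donor_Z 0 q = {x \<in> carrier (G 0 q). dv 0 q x = \<one>\<^bsub>G 0 (Suc q)\<^esub>}"
  using row_mono by (auto simp: donor_Z_def)

lemma donor_B_column: "donor_B 0 q = vcob 0 q"
proof -
  have "\<one>\<^bsub>G 0 q\<^esub> \<otimes>\<^bsub>G 0 q\<^esub> v = v" if "v \<in> vcob 0 q" for v
    using that vcob_subset by (intro G.l_one) auto
  then show ?thesis unfolding donor_B_def hcob_def by auto metis
qed

lemma donor_Z_row: "donor_Z (Suc p) 0 = {x \<in> carrier (G (Suc p) 0). dh (Suc p) 0 x = \<one>\<^bsub>G (Suc (Suc p)) 0\<^esub>}"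
  using col_mono by (auto simp: donor_Z_def dh_dv)

lemma donor_B_row: "donor_B (Suc p) 0 = hcob (Suc p) 0"
proof -
  have "u \<otimes>\<^bsub>G (Suc p) 0\<^esub> \<one>\<^bsub>G (Suc p) 0\<^esub> = u" if "u \<in> hcob (Suc p) 0" for u
    using that hcob_subset by (intro G.r_one) auto
  then show ?thesis unfolding donor_B_def vcob_def by auto metis
qed

end

lemma zigzag_mono:
  assumes "zigzag G dh dv p q x y" and "\<And>p q. carrier (G p q) \<subseteq> carrier (G' p q)"
  shows "zigzag G' dh dv p q x y"
  using assms(1)
proof induction
  case (zigzag_0 x q)
  then show ?case using assms(2) by (intro zigzag.zigzag_0) auto
next
  case (zigzag_Suc p q x w y)
  then show ?case using assms(2) by (intro zigzag.zigzag_Suc[of _ _ _ _ _ _ w]) auto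
qed


section \<open>Alternating sums over the faces of a tuple\<close>

text \<open>A tuple of length \<open>n\<close> is an extensional function on \<open>{..<n}\<close>. In contrast to
  \<^const>\<open>face\<close>, the index of the deletion is the length of the result; this admits the empty tuple.\<close>

definition del :: "nat \<Rightarrow> nat \<Rightarrow> (nat \<Rightarrow> 'x) \<Rightarrow> nat \<Rightarrow> 'x" where
  "del n k u = (\<lambda>j\<in>{..<n}. u (if j < k then j else Suc j))"

definition cons :: "nat \<Rightarrow> 'x \<Rightarrow> (nat \<Rightarrow> 'x) \<Rightarrow> nat \<Rightarrow> 'x" where
  "cons n x u = (\<lambda>j\<in>{..<Suc n}. case j of 0 \<Rightarrow> x | Suc j' \<Rightarrow> u j')"

lemma del_extensional [simp]: "del n k u \<in> extensional {..<n}"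
  by (simp add: del_def)

lemma cons_extensional [simp]: "cons n x u \<in> extensional {..<Suc n}"
  by (simp add: cons_def)

lemma cons_0 [simp]: "cons n x u 0 = x"
  by (simp add: cons_def)

lemma cons_Suc: "j < n \<Longrightarrow> cons n x u (Suc j) = u j"
  by (simp add: cons_def)

lemma del_apply: "j < n \<Longrightarrow> del n k u j = u (if j < k then j else Suc j)"
  by (simp add: del_def)

lemma del_0_cons: "u \<in> extensional {..<n} \<Longrightarrow> del n 0 (cons n x u) = u"
  by (rule extensionalityI[of _ "{..<n}"]) (auto simp: del_apply cons_Suc)

lemma del_Suc_cons: "del (Suc n) (Suc k) (cons (Suc n) x u) = cons n x (del n k u)"
proof (rule extensionalityI[of _ "{..<Suc n}"])
  fix j assume "j \<in> {..<Suc n}"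
  then show "del (Suc n) (Suc k) (cons (Suc n) x u) j = cons n x (del n k u) j"
    by (cases j) (auto simp: del_apply cons_Suc)
qed auto

lemma cons_del_0: "u \<in> extensional {..<Suc n} \<Longrightarrow> u = cons n (u 0) (del n 0 u)"
proof (rule extensionalityI[of _ "{..<Suc n}"])
  fix j assume "j \<in> {..<Suc n}"
  then show "u j = cons n (u 0) (del n 0 u) j"
    by (cases j) (auto simp: del_apply cons_Suc)
qed auto

abbreviation adj :: "nat \<Rightarrow> nat \<Rightarrow> nat" where
  "adj k \<equiv> Transposition.transpose k (Suc k)"

lemma transpose_extensional:
  "u \<in> extensional {..<n} \<Longrightarrow> Suc k < n \<Longrightarrow> u \<circ> adj k \<in> extensional {..<n}"
  by (auto simp: extensional_def Transposition.transpose_def)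

lemma cons_transpose:
  "Suc k < n \<Longrightarrow> cons n x (u \<circ> adj k) = cons n x u \<circ> adj (Suc k)"
  by (rule ext, rename_tac j, case_tac j) (auto simp: cons_def Transposition.transpose_def)

lemma del_transpose_less:
  "l < k \<Longrightarrow> k < n \<Longrightarrow> del n l (u \<circ> adj k) = del n l u \<circ> adj (k - 1)"
  by (rule ext) (auto simp: del_def Transposition.transpose_def)

lemma del_transpose_greater:
  "Suc k < l \<Longrightarrow> l \<le> n \<Longrightarrow> del n l (u \<circ> adj k) = del n l u \<circ> adj k"
  by (rule ext) (auto simp: del_def Transposition.transpose_def)

lemma del_transpose_eq: "del n k (u \<circ> adj k) = del n (Suc k) u"
  by (rule ext) (auto simp: del_def Transposition.transpose_def less_Suc_eq)

lemma del_transpose_eq_Suc: "del n (Suc k) (u \<circ> adj k) = del n k u"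
  by (rule ext) (auto simp: del_def Transposition.transpose_def)

text \<open>\<open>asum V n f u\<close> is the alternating sum over the \<open>n + 1\<close> faces of a tuple of length \<open>n + 1\<close>, in
  multiplicative notation.\<close>

definition asum :: "('v, 'b) monoid_scheme \<Rightarrow> nat \<Rightarrow> ((nat \<Rightarrow> 'x) \<Rightarrow> 'v) \<Rightarrow> (nat \<Rightarrow> 'x) \<Rightarrow> 'v" where
  "asum V n f u = (\<Otimes>\<^bsub>V\<^esub>k\<in>{..n}. f (del n k u) [^]\<^bsub>V\<^esub> ((-1) ^ k :: int))"

context comm_group
begin

lemma sign_pow_cases: "x \<in> carrier G \<Longrightarrow> x [^] ((-1) ^ k :: int) = (if even k then x else inv x)"
  by (auto simp: int_pow_neg)

lemma asum_closed: "(\<And>u. f u \<in> carrier G) \<Longrightarrow> asum G n f u \<in> carrier G"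
  unfolding asum_def by (intro finprod_closed) auto

lemma asum_cong:
  assumes "\<And>k. k \<le> n \<Longrightarrow> f (del n k u) = g (del n k u)" and "\<And>u. g u \<in> carrier G"
  shows "asum G n f u = asum G n g u"
  unfolding asum_def using assms by (intro finprod_cong') auto

lemma asum_mult:
  assumes "\<And>u. f u \<in> carrier G" "\<And>u. g u \<in> carrier G"
  shows "asum G n (\<lambda>u. f u \<otimes> g u) u = asum G n f u \<otimes> asum G n g u"
proof -
  have "asum G n (\<lambda>u. f u \<otimes> g u) u =
      (\<Otimes>k\<in>{..n}. (f (del n k u) [^] ((-1) ^ k :: int)) \<otimes> (g (del n k u) [^] ((-1) ^ k :: int)))"
    unfolding asum_def using assms by (intro finprod_cong') (auto simp: sign_pow_cases inv_mult)
  also have "\<dots> = asum G n f u \<otimes> asum G n g u"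
    unfolding asum_def using assms by (intro finprod_multf) auto
  finally show ?thesis .
qed

lemma asum_one: "asum G n (\<lambda>u. \<one>) u = \<one>"
  unfolding asum_def by (rule finprod_one_eqI) (simp add: sign_pow_cases)

lemma asum_inv:
  assumes "\<And>u. f u \<in> carrier G"
  shows "asum G n (\<lambda>u. inv (f u)) u = inv asum G n f u"
proof -
  have "asum G n (\<lambda>u. inv (f u)) u \<otimes> asum G n f u = asum G n (\<lambda>u. inv (f u) \<otimes> f u) u"
    using assms by (intro asum_mult[symmetric]) auto
  also have "\<dots> = \<one>" using assms asum_one by simp
  finally show ?thesis
    using assms by (intro inv_equality[symmetric] asum_closed) auto
qed

lemma finprod_inv:
  assumes "f \<in> A \<rightarrow> carrier G"
  shows "(\<Otimes>a\<in>A. inv (f a)) = inv (\<Otimes>a\<in>A. f a)"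
proof -
  have "(\<Otimes>a\<in>A. inv (f a)) \<otimes> (\<Otimes>a\<in>A. f a) = (\<Otimes>a\<in>A. inv (f a) \<otimes> f a)"
    using assms by (intro finprod_multf[symmetric]) auto
  also have "\<dots> = \<one>" using assms by (intro finprod_one_eqI) (auto intro!: l_inv)
  finally show ?thesis
    using assms by (intro inv_equality[symmetric] finprod_closed) auto
qed

text \<open>The cone formula: every tuple of positive length is of the form \<open>x # u\<close>, so that
  identities of alternating sums follow from it by induction on the length.\<close>

lemma asum_cons:
  assumes f: "\<And>u. f u \<in> carrier G" and u: "u \<in> extensional {..<Suc n}"
  shows "asum G (Suc n) f (cons (Suc n) x u) = f u \<otimes> inv asum G n (\<lambda>u. f (cons n x u)) u"
proof -
  have "asum G (Suc n) f (cons (Suc n) x u) =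
     (\<Otimes>k\<in>{..n}. f (del (Suc n) (Suc k) (cons (Suc n) x u)) [^] ((-1) ^ Suc k :: int)) \<otimes>
       f (del (Suc n) 0 (cons (Suc n) x u)) [^] ((-1) ^ 0 :: int)"
    unfolding asum_def by (rule finprod_Suc2) (use f in auto)
  also have "\<dots> = (\<Otimes>k\<in>{..n}. inv (f (cons n x (del n k u)) [^] ((-1) ^ k :: int))) \<otimes> f u"
    using f u by (intro arg_cong2[where f = "(\<otimes>)"] finprod_cong')
      (auto simp: del_0_cons del_Suc_cons int_pow_neg)
  also have "\<dots> = inv asum G n (\<lambda>u. f (cons n x u)) u \<otimes> f u"
    unfolding asum_def using f by (subst finprod_inv) auto
  also have "\<dots> = f u \<otimes> inv asum G n (\<lambda>u. f (cons n x u)) u"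
    using f by (intro m_comm inv_closed asum_closed) auto
  finally show ?thesis .
qed

lemma asum_0: "(\<And>u. f u \<in> carrier G) \<Longrightarrow> asum G 0 f u = f (\<lambda>_. undefined)"
  by (simp add: asum_def del_def restrict_def)

lemma asum_asum:
  assumes "\<And>u. f u \<in> carrier G" and "u \<in> extensional {..<Suc (Suc n)}"
  shows "asum G (Suc n) (asum G n f) u = \<one>"
  using assms
proof (induction n arbitrary: f u)
  case 0
  obtain x v where u: "u = cons (Suc 0) x v" "v \<in> extensional {..<Suc 0}"
    using cons_del_0[OF 0(2)] by force
  show ?case
    unfolding u(1) using 0(1) u(2) by (simp add: asum_cons asum_closed asum_0)
next
  case (Suc n)
  obtain x v where u: "u = cons (Suc (Suc n)) x v" "v \<in> extensional {..<Suc (Suc n)}"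
    using cons_del_0[OF Suc.prems(2)] by force
  let ?fx = "\<lambda>w. f (cons (Suc n) x w)"
  have cl: "asum G m f w \<in> carrier G" "asum G m ?fx w \<in> carrier G" for m w
    by (rule asum_closed, rule Suc.prems(1))+
  have "asum G (Suc (Suc n)) (asum G (Suc n) f) u =
      asum G (Suc n) f v \<otimes> inv asum G (Suc n) (\<lambda>w. asum G (Suc n) f (cons (Suc n) x w)) v"
    unfolding u(1) by (rule asum_cons) (use cl u in auto)
  also have "asum G (Suc n) (\<lambda>w. asum G (Suc n) f (cons (Suc n) x w)) v =
      asum G (Suc n) (\<lambda>w. f w \<otimes> inv asum G n (\<lambda>u. f (cons n x u)) w) v"
    using Suc.prems(1) by (intro asum_cong asum_cons) (auto intro!: m_closed inv_closed asum_closed)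
  also have "\<dots> = asum G (Suc n) f v \<otimes> inv asum G (Suc n) (asum G n (\<lambda>u. f (cons n x u))) v"
    using Suc.prems(1) by (subst asum_mult) (simp_all add: asum_inv asum_closed)
  also have "asum G (Suc n) (asum G n (\<lambda>u. f (cons n x u))) v = \<one>"
    using Suc.prems(1) u(2) by (intro Suc.IH) auto
  finally show ?case using cl by simp
qed

lemma asum_swap:
  assumes "\<And>i u. F i u \<in> carrier G" and "i \<in> extensional {..<Suc p}"
  shows "asum G p (\<lambda>i. asum G q (F i) u) i = asum G q (\<lambda>u. asum G p (\<lambda>i. F i u) i) u"
  using assms
proof (induction p arbitrary: F i)
  case 0
  then show ?case by (simp add: asum_closed asum_0)
next
  case (Suc p)
  obtain x j where i: "i = cons (Suc p) x j" "j \<in> extensional {..<Suc p}"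
    using cons_del_0[OF Suc.prems(2)] by force
  have "asum G (Suc p) (\<lambda>i. asum G q (F i) u) i =
      asum G q (F j) u \<otimes> inv asum G p (\<lambda>j. asum G q (F (cons p x j)) u) j"
    unfolding i(1) using Suc.prems(1) i(2) by (intro asum_cons asum_closed) auto
  also have "asum G p (\<lambda>j. asum G q (F (cons p x j)) u) j = asum G q (\<lambda>u. asum G p (\<lambda>j. F (cons p x j) u) j) u"
    using Suc.prems(1) i(2) by (intro Suc.IH) auto
  also have "asum G q (F j) u \<otimes> inv \<dots> = asum G q (\<lambda>u. F j u \<otimes> inv asum G p (\<lambda>j. F (cons p x j) u) j) u"
    using Suc.prems(1) by (subst asum_mult) (simp_all add: asum_inv asum_closed)
  also have "\<dots> = asum G q (\<lambda>u. asum G (Suc p) (\<lambda>i. F i u) i) u"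
    unfolding i(1) using Suc.prems(1) i(2)
    by (intro asum_cong asum_cons[symmetric] asum_closed) auto
  finally show ?case .
qed

text \<open>A transposition of neighbours exchanges two faces, which occur with opposite signs; on the other faces
  it acts as a transposition of neighbours.\<close>

lemma asum_transpose:
  assumes f: "\<And>u. f u \<in> carrier G"
    and alt: "\<And>u l. Suc l < n \<Longrightarrow> f (u \<circ> adj l) = inv f u"
    and k: "k < n"
  shows "asum G n f (u \<circ> adj k) = inv asum G n f u"
proof -
  let ?t = "adj k"
  let ?T = "\<lambda>l. f (del n l u) [^] ((-1) ^ l :: int)"
  have T: "?T \<in> {..n} \<rightarrow> carrier G" using f by auto
  have T_adj: "f (del n l (u \<circ> ?t)) [^] ((-1) ^ l :: int) = inv ?T (?t l)" if "l \<le> n" for l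
  proof -
    consider "l < k" | "l = k" | "l = Suc k" | "Suc k < l" by linarith
    then show ?thesis
    proof cases
      case 1
      then have "f (del n l (u \<circ> ?t)) = inv f (del n l u)"
        using alt[of "k - 1" "del n l u"] k by (simp add: del_transpose_less)
      then show ?thesis using 1 f by (simp add: sign_pow_cases Transposition.transpose_def)
    next
      case 4
      then have "f (del n l (u \<circ> ?t)) = inv f (del n l u)"
        using alt[of k "del n l u"] that by (simp add: del_transpose_greater)
      then show ?thesis using 4 f by (simp add: sign_pow_cases Transposition.transpose_def)
    next
      case 2
      then show ?thesis
        using f by (simp add: del_transpose_eq sign_pow_cases del: power_Suc)
    next
      case 3
      then show ?thesis
        using f by (simp add: del_transpose_eq_Suc sign_pow_cases del: power_Suc)
    qed
  qed
  have img: "?t ` {..n} = {..n}" using k by (auto simp: Transposition.transpose_def image_def)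
  have "asum G n f (u \<circ> ?t) = (\<Otimes>l\<in>{..n}. inv ?T (?t l))"
    unfolding asum_def using T_adj f by (intro finprod_cong') auto
  also have "\<dots> = (\<Otimes>l\<in>?t ` {..n}. inv ?T l)"
    using f by (intro finprod_reindex[symmetric] inj_on_subset[OF inj_transpose]) auto
  also have "\<dots> = inv asum G n f u"
    unfolding img asum_def using T by (rule finprod_inv)
  finally show ?thesis .
qed

lemma finprod_hom:
  assumes "h \<in> hom G G" "f \<in> A \<rightarrow> carrier G"
  shows "h (\<Otimes>a\<in>A. f a) = (\<Otimes>a\<in>A. h (f a))"
proof -
  interpret h: group_hom G G h by unfold_locales fact
  show ?thesis using assms(2)
  proof (induction A rule: infinite_finite_induct)
    case (insert a A)
    then have "h (\<Otimes>a\<in>insert a A. f a) = h (f a) \<otimes> (\<Otimes>a\<in>A. h (f a))" by (subst finprod_insert) (auto simp: Pi_iff)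
    also have "\<dots> = (\<Otimes>a\<in>insert a A. h (f a))" using insert by (intro finprod_insert[symmetric]) (auto simp: Pi_iff)
    finally show ?case .
  qed auto
qed

lemma asum_hom:
  assumes "h \<in> hom G G" "\<And>u. f u \<in> carrier G"
  shows "h (asum G n f u) = asum G n (\<lambda>u. h (f u)) u"
proof -
  interpret h: group_hom G G h by unfold_locales fact
  show ?thesis
    unfolding asum_def using assms
    by (subst finprod_hom[OF assms(1)]) (auto intro!: finprod_cong' simp: h.hom_int_pow)
qed

lemma asum_finprod:
  assumes "finite J" "\<And>j u. f j u \<in> carrier G"
  shows "asum G n (\<lambda>u. \<Otimes>j\<in>J. f j u) u = (\<Otimes>j\<in>J. asum G n (f j) u)"
  using assms(1)
proof induction
  case empty
  then show ?case by (simp add: asum_one)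
next
  case (insert j J)
  then have "asum G n (\<lambda>u. \<Otimes>j\<in>insert j J. f j u) u = asum G n (\<lambda>u. f j u \<otimes> (\<Otimes>j\<in>J. f j u)) u"
    using assms(2) by (intro asum_cong) auto
  also have "\<dots> = (\<Otimes>j\<in>insert j J. asum G n (f j) u)"
    using insert assms(2) by (subst asum_mult) (simp_all add: asum_closed Pi_iff)
  finally show ?case .
qed

lemma comm_group_product_group: "comm_group (product_group S (\<lambda>_. G))"
  by (intro group.group_comm_groupI) (auto simp: fun_eq_iff restrict_def PiE_iff m_comm)

end


section \<open>The double complex of the incidence relation between points and sets\<close>

locale dowker = comm_group V for V :: "('v, 'b) monoid_scheme" (structure) +
  fixes X :: "'m set" and I :: "'i set" and U :: "'i \<Rightarrow> 'm set"
  assumes U_subset: "i \<in> I \<Longrightarrow> U i \<subseteq> X"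
begin

text \<open>Both complexes to be compared are edges of one double complex, whose cochains of bidegree
  \<open>(p, q)\<close> depend on \<open>p\<close> indices and \<open>q\<close> points such that all the points lie in all the sets. The last
  two conditions below follow from the first one if \<open>p\<close> and \<open>q\<close> are positive; for \<open>p = 0\<close> they
  define the neighbourhood of the diagonal, for \<open>q = 0\<close> the nerve.\<close>

definition inc :: "nat \<Rightarrow> nat \<Rightarrow> ((nat \<Rightarrow> 'i) \<times> (nat \<Rightarrow> 'm)) set" where
  "inc p q = {(i, u). i \<in> {..<p} \<rightarrow>\<^sub>E I \<and> u \<in> {..<q} \<rightarrow>\<^sub>E X \<and> (\<forall>k<p. \<forall>l<q. u l \<in> U (i k)) \<and>
     (\<exists>j\<in>I. \<forall>l<q. u l \<in> U j) \<and> (\<exists>m\<in>X. \<forall>k<p. m \<in> U (i k))}"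

text \<open>The extension of a cochain by the neutral element. It makes the alternating sums well-defined without
  keeping track of the domain, which contains all faces of its elements.\<close>

definition tot :: "nat \<Rightarrow> nat \<Rightarrow> ((nat \<Rightarrow> 'i) \<times> (nat \<Rightarrow> 'm) \<Rightarrow> 'v) \<Rightarrow> (nat \<Rightarrow> 'i) \<Rightarrow> (nat \<Rightarrow> 'm) \<Rightarrow> 'v" where
  "tot p q f i u = (if (i, u) \<in> inc p q then f (i, u) else \<one>)"

definition dh :: "nat \<Rightarrow> nat \<Rightarrow> ((nat \<Rightarrow> 'i) \<times> (nat \<Rightarrow> 'm) \<Rightarrow> 'v) \<Rightarrow> ((nat \<Rightarrow> 'i) \<times> (nat \<Rightarrow> 'm) \<Rightarrow> 'v)" where
  "dh p q f = (\<lambda>(i, u)\<in>inc (Suc p) q. asum V p (\<lambda>i. tot p q f i u) i)"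

definition dv :: "nat \<Rightarrow> nat \<Rightarrow> ((nat \<Rightarrow> 'i) \<times> (nat \<Rightarrow> 'm) \<Rightarrow> 'v) \<Rightarrow> ((nat \<Rightarrow> 'i) \<times> (nat \<Rightarrow> 'm) \<Rightarrow> 'v)" where
  "dv p q f = (\<lambda>(i, u)\<in>inc p (Suc q). asum V q (\<lambda>u. tot p q f i u) u)"

definition alternating :: "nat \<Rightarrow> nat \<Rightarrow> ((nat \<Rightarrow> 'i) \<times> (nat \<Rightarrow> 'm) \<Rightarrow> 'v) \<Rightarrow> bool" where
  "alternating p q f \<longleftrightarrow> (\<forall>i u k. (i, u) \<in> inc p q \<longrightarrow> Suc k < p \<longrightarrow> f (i \<circ> adj k, u) = inv f (i, u))"

definition cov :: "nat \<Rightarrow> (nat \<Rightarrow> 'm) set" where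
  "cov q = (\<Union>j\<in>I. {..<q} \<rightarrow>\<^sub>E U j)"

lemma inc_extensional: "(i, u) \<in> inc p q \<Longrightarrow> i \<in> extensional {..<p} \<and> u \<in> extensional {..<q}"
  by (auto simp: inc_def PiE_def)

lemma del_PiE: "u \<in> {..<Suc n} \<rightarrow>\<^sub>E A \<Longrightarrow> k \<le> n \<Longrightarrow> del n k u \<in> {..<n} \<rightarrow>\<^sub>E A"
  by (auto simp: del_def PiE_iff)

lemma cons_PiE: "u \<in> {..<n} \<rightarrow>\<^sub>E A \<Longrightarrow> x \<in> A \<Longrightarrow> cons n x u \<in> {..<Suc n} \<rightarrow>\<^sub>E A"
  by (auto simp: cons_def PiE_iff split: nat.split)

lemma all_del: "\<forall>l<Suc n. Q (u l) \<Longrightarrow> k \<le> n \<Longrightarrow> \<forall>l<n. Q (del n k u l)"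
  by (simp add: del_apply)

lemma all_cons: "Q x \<Longrightarrow> \<forall>l<n. Q (u l) \<Longrightarrow> \<forall>l<Suc n. Q (cons n x u l)"
  by (auto simp: cons_def split: nat.split)

lemma inc_del_left:
  assumes "(i, u) \<in> inc (Suc p) q" "k \<le> p" shows "(del p k i, u) \<in> inc p q"
proof -
  from assms obtain j m where *: "i \<in> {..<Suc p} \<rightarrow>\<^sub>E I" "u \<in> {..<q} \<rightarrow>\<^sub>E X"
    "\<forall>k<Suc p. \<forall>l<q. u l \<in> U (i k)" "j \<in> I" "\<forall>l<q. u l \<in> U j" "m \<in> X" "\<forall>k<Suc p. m \<in> U (i k)"
    unfolding inc_def by blast
  have "\<forall>k'<p. \<forall>l<q. u l \<in> U (del p k i k')" "\<forall>k'<p. m \<in> U (del p k i k')"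
    using all_del[where u = i, OF *(3) assms(2)] all_del[where u = i, OF *(7) assms(2)] by auto
  then show ?thesis unfolding inc_def using del_PiE[OF *(1) assms(2)] * by blast
qed

lemma inc_del_right:
  assumes "(i, u) \<in> inc p (Suc q)" "k \<le> q" shows "(i, del q k u) \<in> inc p q"
proof -
  from assms obtain j m where *: "i \<in> {..<p} \<rightarrow>\<^sub>E I" "u \<in> {..<Suc q} \<rightarrow>\<^sub>E X"
    "\<And>k. k < p \<Longrightarrow> \<forall>l<Suc q. u l \<in> U (i k)" "j \<in> I" "\<forall>l<Suc q. u l \<in> U j" "m \<in> X" "\<forall>k<p. m \<in> U (i k)"
    unfolding inc_def by blast
  have "\<forall>k'<p. \<forall>l<q. del q k u l \<in> U (i k')" "\<forall>l<q. del q k u l \<in> U j"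
    using all_del[where u = u, OF *(3) assms(2)] all_del[where u = u, OF *(5) assms(2)] by auto
  then show ?thesis unfolding inc_def using del_PiE[OF *(2) assms(2)] * by blast
qed

lemma inc_adj:
  assumes "(i, u) \<in> inc p q" "Suc k < p" shows "(i \<circ> adj k, u) \<in> inc p q"
proof -
  from assms obtain j m where *: "i \<in> {..<p} \<rightarrow>\<^sub>E I" "u \<in> {..<q} \<rightarrow>\<^sub>E X"
    "\<forall>k<p. \<forall>l<q. u l \<in> U (i k)" "j \<in> I" "\<forall>l<q. u l \<in> U j" "m \<in> X" "\<forall>k<p. m \<in> U (i k)"
    unfolding inc_def by blast
  have adj: "adj k l < p" if "l < p" for l using that assms(2) by (auto simp: Transposition.transpose_def)
  moreover have "i \<circ> adj k \<in> extensional {..<p}"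
    using assms inc_extensional by (intro transpose_extensional) auto
  ultimately have "i \<circ> adj k \<in> {..<p} \<rightarrow>\<^sub>E I" using *(1) by (auto simp: PiE_iff)
  moreover have "\<forall>k'<p. \<forall>l<q. u l \<in> U ((i \<circ> adj k) k')" "\<forall>k'<p. m \<in> U ((i \<circ> adj k) k')"
    using adj *(3,7) by auto
  ultimately show ?thesis unfolding inc_def using * by blast
qed

lemma inc_adj_iff: "Suc k < p \<Longrightarrow> (i \<circ> adj k, u) \<in> inc p q \<longleftrightarrow> (i, u) \<in> inc p q"
  using inc_adj[of i u p q k] inc_adj[of "i \<circ> adj k" u p q k] by (auto simp: comp_assoc)

lemma inc_cons_left:
  assumes "(i, u) \<in> inc p (Suc q)" "j \<in> I" "\<forall>l<Suc q. u l \<in> U j"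
  shows "(cons p j i, u) \<in> inc (Suc p) (Suc q)"
proof -
  from assms have *: "i \<in> {..<p} \<rightarrow>\<^sub>E I" "u \<in> {..<Suc q} \<rightarrow>\<^sub>E X" "\<forall>k<p. \<forall>l<Suc q. u l \<in> U (i k)"
    unfolding inc_def by blast+
  have cl: "\<forall>k<Suc p. \<forall>l<Suc q. u l \<in> U (cons p j i k)"
    by (rule all_cons) (use assms * in auto)
  moreover have "u 0 \<in> X" using * by auto
  moreover have "\<forall>k<Suc p. u 0 \<in> U (cons p j i k)" using cl by blast
  ultimately show ?thesis
    unfolding inc_def using assms(2,3) * cons_PiE[OF *(1) assms(2)] by blast
qed

lemma inc_cons_right:
  assumes "(i, u) \<in> inc (Suc p) q" "c \<in> X" "\<forall>k<Suc p. c \<in> U (i k)"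
  shows "(i, cons q c u) \<in> inc (Suc p) (Suc q)"
proof -
  from assms have *: "i \<in> {..<Suc p} \<rightarrow>\<^sub>E I" "u \<in> {..<q} \<rightarrow>\<^sub>E X" "\<forall>k<Suc p. \<forall>l<q. u l \<in> U (i k)"
    unfolding inc_def by blast+
  have cl: "\<forall>l<Suc q. cons q c u l \<in> U (i k)" if "k < Suc p" for k
    by (rule all_cons) (use assms * that in auto)
  moreover have "i 0 \<in> I" using * by auto
  moreover have "\<forall>l<Suc q. cons q c u l \<in> U (i 0)" using cl by blast
  ultimately show ?thesis
    unfolding inc_def using assms(2,3) * cons_PiE[OF *(2) assms(2)] by blast
qed

lemma inc_cov: "(i, u) \<in> inc p q \<Longrightarrow> u \<in> cov q"
  by (auto simp: inc_def cov_def PiE_iff)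

lemma tot_closed: "f \<in> inc p q \<rightarrow>\<^sub>E carrier V \<Longrightarrow> tot p q f i u \<in> carrier V"
  by (auto simp: tot_def)

lemma tot_inc: "(i, u) \<in> inc p q \<Longrightarrow> tot p q f i u = f (i, u)"
  by (simp add: tot_def)

lemma dh_apply: "(i, u) \<in> inc (Suc p) q \<Longrightarrow> dh p q f (i, u) = asum V p (\<lambda>i. tot p q f i u) i"
  by (simp add: dh_def)

lemma dv_apply: "(i, u) \<in> inc p (Suc q) \<Longrightarrow> dv p q f (i, u) = asum V q (\<lambda>u. tot p q f i u) u"
  by (simp add: dv_def)

lemma dh_carrier: "f \<in> inc p q \<rightarrow>\<^sub>E carrier V \<Longrightarrow> dh p q f \<in> inc (Suc p) q \<rightarrow>\<^sub>E carrier V"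
  by (auto simp: dh_def intro!: asum_closed tot_closed)

lemma dv_carrier: "f \<in> inc p q \<rightarrow>\<^sub>E carrier V \<Longrightarrow> dv p q f \<in> inc p (Suc q) \<rightarrow>\<^sub>E carrier V"
  by (auto simp: dv_def intro!: asum_closed tot_closed)

lemma tot_adj:
  assumes "alternating p q f" "Suc k < p"
  shows "tot p q f (i \<circ> adj k) u = inv (tot p q f i u)"
  using assms by (simp add: tot_def inc_adj_iff alternating_def)

lemma dh_alternating:
  assumes f: "f \<in> inc p q \<rightarrow>\<^sub>E carrier V" "alternating p q f"
  shows "alternating (Suc p) q (dh p q f)"
  unfolding alternating_def
proof (intro allI impI)
  fix i u k assume *: "(i, u) \<in> inc (Suc p) q" "Suc k < Suc p"
  have "dh p q f (i \<circ> adj k, u) = asum V p (\<lambda>i. tot p q f i u) (i \<circ> adj k)"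
    using * by (simp add: dh_apply inc_adj)
  also have "\<dots> = inv asum V p (\<lambda>i. tot p q f i u) i"
    using * f by (intro asum_transpose tot_adj tot_closed) auto
  finally show "dh p q f (i \<circ> adj k, u) = inv dh p q f (i, u)"
    using * by (simp add: dh_apply)
qed

lemma dv_alternating:
  assumes f: "f \<in> inc p q \<rightarrow>\<^sub>E carrier V" "alternating p q f"
  shows "alternating p (Suc q) (dv p q f)"
  unfolding alternating_def
proof (intro allI impI)
  fix i u k assume *: "(i, u) \<in> inc p (Suc q)" "Suc k < p"
  have "dv p q f (i \<circ> adj k, u) = asum V q (\<lambda>u. inv tot p q f i u) u"
    using * tot_adj[OF f(2) *(2)] by (simp add: dv_apply inc_adj)
  also have "\<dots> = inv asum V q (\<lambda>u. tot p q f i u) u"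
    using f by (intro asum_inv tot_closed) auto
  finally show "dv p q f (i \<circ> adj k, u) = inv dv p q f (i, u)"
    using * by (simp add: dv_apply)
qed

lemma dh_mult:
  assumes "f \<in> inc p q \<rightarrow>\<^sub>E carrier V" "g \<in> inc p q \<rightarrow>\<^sub>E carrier V" "(i, u) \<in> inc (Suc p) q"
  shows "dh p q (\<lambda>x\<in>inc p q. f x \<otimes> g x) (i, u) = dh p q f (i, u) \<otimes> dh p q g (i, u)"
proof -
  have "tot p q (\<lambda>x\<in>inc p q. f x \<otimes> g x) i u = tot p q f i u \<otimes> tot p q g i u" for i
    by (auto simp: tot_def)
  then show ?thesis using assms by (simp add: dh_apply asum_mult tot_closed)
qed

lemma dv_mult:
  assumes "f \<in> inc p q \<rightarrow>\<^sub>E carrier V" "g \<in> inc p q \<rightarrow>\<^sub>E carrier V" "(i, u) \<in> inc p (Suc q)"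
  shows "dv p q (\<lambda>x\<in>inc p q. f x \<otimes> g x) (i, u) = dv p q f (i, u) \<otimes> dv p q g (i, u)"
proof -
  have "tot p q (\<lambda>x\<in>inc p q. f x \<otimes> g x) i u = tot p q f i u \<otimes> tot p q g i u" for u
    by (auto simp: tot_def)
  then show ?thesis using assms by (simp add: dv_apply asum_mult tot_closed)
qed

lemma tot_dh_face:
  "(i, u) \<in> inc (Suc (Suc p)) q \<Longrightarrow> k \<le> Suc p \<Longrightarrow>
     tot (Suc p) q (dh p q f) (del (Suc p) k i) u = asum V p (\<lambda>i. tot p q f i u) (del (Suc p) k i)"
  by (simp add: tot_inc dh_apply inc_del_left)

lemma tot_dv_face:
  "(i, u) \<in> inc p (Suc (Suc q)) \<Longrightarrow> k \<le> Suc q \<Longrightarrow>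
     tot p (Suc q) (dv p q f) i (del (Suc q) k u) = asum V q (\<lambda>u. tot p q f i u) (del (Suc q) k u)"
  by (simp add: tot_inc dv_apply inc_del_right)

lemma dh_dh:
  assumes f: "f \<in> inc p q \<rightarrow>\<^sub>E carrier V"
  shows "dh (Suc p) q (dh p q f) = (\<lambda>x\<in>inc (Suc (Suc p)) q. \<one>)"
proof (rule extensionalityI[of _ "inc (Suc (Suc p)) q"])
  fix x assume x: "x \<in> inc (Suc (Suc p)) q"
  obtain i u where iu: "x = (i, u)" by force
  have "dh (Suc p) q (dh p q f) x = asum V (Suc p) (asum V p (\<lambda>i. tot p q f i u)) i"
    using x unfolding iu by (subst dh_apply) (auto intro!: asum_cong asum_closed tot_closed[OF f] simp: tot_dh_face)
  also have "\<dots> = \<one>" using x inc_extensional unfolding iu by (intro asum_asum tot_closed[OF f]) auto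
  finally show "dh (Suc p) q (dh p q f) x = (\<lambda>x\<in>inc (Suc (Suc p)) q. \<one>) x" using x by simp
qed (auto simp: dh_def)

lemma dv_dv:
  assumes f: "f \<in> inc p q \<rightarrow>\<^sub>E carrier V"
  shows "dv p (Suc q) (dv p q f) = (\<lambda>x\<in>inc p (Suc (Suc q)). \<one>)"
proof (rule extensionalityI[of _ "inc p (Suc (Suc q))"])
  fix x assume x: "x \<in> inc p (Suc (Suc q))"
  obtain i u where iu: "x = (i, u)" by force
  have "dv p (Suc q) (dv p q f) x = asum V (Suc q) (asum V q (\<lambda>u. tot p q f i u)) u"
    using x unfolding iu by (subst dv_apply) (auto intro!: asum_cong asum_closed tot_closed[OF f] simp: tot_dv_face)
  also have "\<dots> = \<one>" using x inc_extensional unfolding iu by (intro asum_asum tot_closed[OF f]) auto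
  finally show "dv p (Suc q) (dv p q f) x = (\<lambda>x\<in>inc p (Suc (Suc q)). \<one>) x" using x by simp
qed (auto simp: dv_def)

lemma dh_dv:
  assumes f: "f \<in> inc p q \<rightarrow>\<^sub>E carrier V"
  shows "dh p (Suc q) (dv p q f) = dv (Suc p) q (dh p q f)"
proof (rule extensionalityI[of _ "inc (Suc p) (Suc q)"])
  fix x assume x: "x \<in> inc (Suc p) (Suc q)"
  obtain i u where iu: "x = (i, u)" by force
  have "dh p (Suc q) (dv p q f) x = asum V p (\<lambda>i. asum V q (\<lambda>u. tot p q f i u) u) i"
    using x unfolding iu
    by (subst dh_apply)
      (auto intro!: asum_cong asum_closed tot_closed[OF f] simp: tot_inc dv_apply inc_del_left)
  also have "\<dots> = asum V q (\<lambda>u. asum V p (\<lambda>i. tot p q f i u) i) u"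
    using x inc_extensional unfolding iu by (intro asum_swap tot_closed[OF f]) auto
  also have "\<dots> = dv (Suc p) q (dh p q f) x"
    using x unfolding iu
    by (subst dv_apply)
      (auto intro!: asum_cong asum_closed tot_closed[OF f] tot_closed[OF dh_carrier[OF f]]
        simp: tot_inc dh_apply inc_del_right)
  finally show "dh p (Suc q) (dv p q f) x = dv (Suc p) q (dh p q f) x" .
qed (auto simp: dv_def dh_def)

end


text \<open>A class \<open>P\<close> of regular functions on open sets of tuples, together with a substitute
  \<open>mu q j u\<close> for the multiplication by the \<open>j\<close>-th function of a partition of unity: these are
  endomorphisms of \<open>V\<close> whose sum is the identity.\<close>

locale regular_dowker = dowker V X I U
  for V :: "('v, 'b) monoid_scheme" (structure)
    and X :: "'m set" and I :: "'i set" and U :: "'i \<Rightarrow> 'm set" +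
  fixes opn :: "nat \<Rightarrow> (nat \<Rightarrow> 'm) set \<Rightarrow> bool"
    and P :: "nat \<Rightarrow> (nat \<Rightarrow> 'm) set \<Rightarrow> ((nat \<Rightarrow> 'm) \<Rightarrow> 'v) \<Rightarrow> bool"
    and J :: "nat \<Rightarrow> (nat \<Rightarrow> 'm) \<Rightarrow> 'i set" and mu :: "nat \<Rightarrow> 'i \<Rightarrow> (nat \<Rightarrow> 'm) \<Rightarrow> 'v \<Rightarrow> 'v"
  assumes opn_slice: "i \<in> {..<p} \<rightarrow>\<^sub>E I \<Longrightarrow> opn (Suc q) {u. (i, u) \<in> inc p (Suc q)}"
    and reg_subset: "P (Suc q) W f \<Longrightarrow> opn (Suc q) W' \<Longrightarrow> W' \<subseteq> W \<Longrightarrow> P (Suc q) W' f"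
    and reg_cong: "P (Suc q) W f \<Longrightarrow> (\<And>u. u \<in> W \<Longrightarrow> f u = g u) \<Longrightarrow> P (Suc q) W g"
    and reg_const: "v \<in> carrier V \<Longrightarrow> opn (Suc q) W \<Longrightarrow> P (Suc q) W (\<lambda>_. v)"
    and reg_mult: "opn (Suc q) W \<Longrightarrow> P (Suc q) W f \<Longrightarrow> P (Suc q) W g \<Longrightarrow> P (Suc q) W (\<lambda>u. f u \<otimes> g u)"
    and reg_inv: "opn (Suc q) W \<Longrightarrow> P (Suc q) W f \<Longrightarrow> P (Suc q) W (\<lambda>u. inv f u)"
    and reg_del: "P (Suc q) W f \<Longrightarrow> opn (Suc q) W \<Longrightarrow> opn (Suc (Suc q)) W' \<Longrightarrow> k \<le> Suc q \<Longrightarrow>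
          (\<And>u. u \<in> W' \<Longrightarrow> del (Suc q) k u \<in> W) \<Longrightarrow> P (Suc (Suc q)) W' (\<lambda>u. f (del (Suc q) k u))"
    and reg_cons: "P (Suc (Suc q)) W f \<Longrightarrow> opn (Suc (Suc q)) W \<Longrightarrow> opn (Suc q) W' \<Longrightarrow> c \<in> X \<Longrightarrow>
          (\<And>u. u \<in> W' \<Longrightarrow> cons (Suc q) c u \<in> W) \<Longrightarrow> P (Suc q) W' (\<lambda>u. f (cons (Suc q) c u))"
    and reg_partition: "opn (Suc q) W \<Longrightarrow> W \<subseteq> cov (Suc q) \<Longrightarrow>
          (\<And>j. j \<in> I \<Longrightarrow> P (Suc q) (W \<inter> ({..<Suc q} \<rightarrow>\<^sub>E U j)) (h j)) \<Longrightarrow>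
          (\<And>j u. j \<in> I \<Longrightarrow> u \<in> W \<inter> ({..<Suc q} \<rightarrow>\<^sub>E U j) \<Longrightarrow> h j u \<in> carrier V) \<Longrightarrow>
          P (Suc q) W (\<lambda>u. \<Otimes>j\<in>J (Suc q) u. mu (Suc q) j u (h j u))"
    and J_finite: "u \<in> cov (Suc q) \<Longrightarrow> finite (J (Suc q) u)"
    and J_cov: "u \<in> cov (Suc q) \<Longrightarrow> j \<in> J (Suc q) u \<Longrightarrow> j \<in> I \<and> u \<in> {..<Suc q} \<rightarrow>\<^sub>E U j"
    and mu_hom: "u \<in> cov (Suc q) \<Longrightarrow> j \<in> J (Suc q) u \<Longrightarrow> mu (Suc q) j u \<in> hom V V"
    and mu_sum: "u \<in> cov (Suc q) \<Longrightarrow> v \<in> carrier V \<Longrightarrow> (\<Otimes>j\<in>J (Suc q) u. mu (Suc q) j u v) = v"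
begin

text \<open>In the corner, where the incidence relation would leave a copy of \<open>V\<close>, the double complex
  is made trivial, since the edges are not augmented.\<close>

definition cochains :: "nat \<Rightarrow> nat \<Rightarrow> ((nat \<Rightarrow> 'i) \<times> (nat \<Rightarrow> 'm) \<Rightarrow> 'v) set" where
  "cochains p q = {f \<in> inc p q \<rightarrow>\<^sub>E carrier V. alternating p q f \<and>
     (0 < q \<longrightarrow> (\<forall>i\<in>{..<p} \<rightarrow>\<^sub>E I. P q {u. (i, u) \<in> inc p q} (\<lambda>u. f (i, u)))) \<and>
     (p = 0 \<and> q = 0 \<longrightarrow> f = (\<lambda>x\<in>inc p q. \<one>))}"

definition Gr :: "nat \<Rightarrow> nat \<Rightarrow> ((nat \<Rightarrow> 'i) \<times> (nat \<Rightarrow> 'm) \<Rightarrow> 'v) monoid" where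
  "Gr p q = (product_group (inc p q) (\<lambda>_. V))\<lparr>carrier := cochains p q\<rparr>"

lemma carrier_Gr [simp]: "carrier (Gr p q) = cochains p q"
  and mult_Gr [simp]: "f \<otimes>\<^bsub>Gr p q\<^esub> g = (\<lambda>x\<in>inc p q. f x \<otimes> g x)"
  and one_Gr [simp]: "\<one>\<^bsub>Gr p q\<^esub> = (\<lambda>x\<in>inc p q. \<one>)"
  by (simp_all add: Gr_def)

lemma cochains_carrier: "f \<in> cochains p q \<Longrightarrow> f \<in> inc p q \<rightarrow>\<^sub>E carrier V"
  by (simp add: cochains_def)

lemma cochains_closed: "f \<in> cochains p q \<Longrightarrow> x \<in> inc p q \<Longrightarrow> f x \<in> carrier V"
  by (auto simp: cochains_def)

lemma cochains_subgroup: "subgroup (cochains p q) (product_group (inc p q) (\<lambda>_. V))"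
proof -
  interpret Pr: comm_group "product_group (inc p q) (\<lambda>_. V)" by (rule comm_group_product_group)
  have V: "group V" by (rule is_group)
  show ?thesis
  proof (rule Pr.subgroupI)
    show "cochains p q \<subseteq> carrier (product_group (inc p q) (\<lambda>_. V))" by (auto simp: cochains_def)
    have "(\<lambda>x\<in>inc p q. \<one>) \<in> cochains p q"
    proof -
      have "P q {u. (i, u) \<in> inc p q} (\<lambda>u. (\<lambda>x\<in>inc p q. \<one>) (i, u))" if "0 < q" "i \<in> {..<p} \<rightarrow>\<^sub>E I" for i
      proof -
        obtain q' where q: "q = Suc q'" using \<open>0 < q\<close> by (cases q) auto
        show ?thesis unfolding q
          by (rule reg_cong[OF reg_const[OF one_closed]]) (use that opn_slice q in auto)
      qed
      then show ?thesis by (auto simp: cochains_def alternating_def inc_adj_iff)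
    qed
    then show "cochains p q \<noteq> {}" by blast
  next
    fix f assume f: "f \<in> cochains p q"
    have "P q {u. (i, u) \<in> inc p q} (\<lambda>u. (\<lambda>x\<in>inc p q. inv f x) (i, u))" if "0 < q" "i \<in> {..<p} \<rightarrow>\<^sub>E I" for i
    proof -
      obtain q' where q: "q = Suc q'" using \<open>0 < q\<close> by (cases q) auto
      show ?thesis unfolding q
        by (rule reg_cong[OF reg_inv]) (use that opn_slice f q in \<open>auto simp: cochains_def\<close>)
    qed
    moreover have "inv\<^bsub>product_group (inc p q) (\<lambda>_. V)\<^esub> f = (\<lambda>x\<in>inc p q. inv f x)"
      using f V by (intro inv_product_group) (auto simp: cochains_def)
    moreover have "(\<lambda>x\<in>inc p q. inv f x) = (\<lambda>x\<in>inc p q. \<one>)" if "f = (\<lambda>x\<in>inc p q. \<one>)"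
      using that by auto
    moreover have "alternating p q (\<lambda>x\<in>inc p q. inv f x)"
      using f by (auto simp: cochains_def alternating_def inc_adj_iff)
    ultimately show "inv\<^bsub>product_group (inc p q) (\<lambda>_. V)\<^esub> f \<in> cochains p q"
      using f by (auto simp: cochains_def PiE_iff)
  next
    fix f g assume fg: "f \<in> cochains p q" "g \<in> cochains p q"
    have "P q {u. (i, u) \<in> inc p q} (\<lambda>u. (\<lambda>x\<in>inc p q. f x \<otimes> g x) (i, u))" if "0 < q" "i \<in> {..<p} \<rightarrow>\<^sub>E I" for i
    proof -
      obtain q' where q: "q = Suc q'" using \<open>0 < q\<close> by (cases q) auto
      have "P (Suc q') {u. (i, u) \<in> inc p (Suc q')} (\<lambda>u. f (i, u) \<otimes> g (i, u))"
        by (rule reg_mult) (use that opn_slice fg q in \<open>auto simp: cochains_def\<close>)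
      then show ?thesis unfolding q by (rule reg_cong) auto
    qed
    moreover have "alternating p q (\<lambda>x\<in>inc p q. f x \<otimes> g x)"
      using fg by (auto simp: cochains_def alternating_def inc_adj_iff inv_mult PiE_iff)
    moreover have "(\<lambda>x\<in>inc p q. f x \<otimes> g x) = (\<lambda>x\<in>inc p q. \<one>)"
      if "f = (\<lambda>x\<in>inc p q. \<one>)" "g = (\<lambda>x\<in>inc p q. \<one>)"
      using that by auto
    ultimately show "f \<otimes>\<^bsub>product_group (inc p q) (\<lambda>_. V)\<^esub> g \<in> cochains p q"
      using fg by (auto simp: cochains_def PiE_iff)
  qed
qed

lemma comm_group_Gr: "comm_group (Gr p q)"
  unfolding Gr_def by (intro comm_group.subgroup_comm_group comm_group_product_group cochains_subgroup)

lemma reg_finprod: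
  assumes "finite K" "opn (Suc q) W"
    and "\<And>k. k \<in> K \<Longrightarrow> P (Suc q) W (f k)" "\<And>k u. k \<in> K \<Longrightarrow> u \<in> W \<Longrightarrow> f k u \<in> carrier V"
  shows "P (Suc q) W (\<lambda>u. \<Otimes>k\<in>K. f k u)"
  using assms(1,3,4)
proof (induction K rule: finite_induct)
  case empty
  then show ?case using assms(2) reg_const[OF one_closed] by simp
next
  case (insert k K)
  have "P (Suc q) W (\<lambda>u. f k u \<otimes> (\<Otimes>k\<in>K. f k u))"
    using insert assms(2) by (intro reg_mult) auto
  then show ?case
    by (rule reg_cong) (use insert in \<open>auto intro!: finprod_insert[symmetric]\<close>)
qed

lemma reg_sign:
  assumes "opn (Suc q) W" "P (Suc q) W f" "\<And>u. u \<in> W \<Longrightarrow> f u \<in> carrier V"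
  shows "P (Suc q) W (\<lambda>u. f u [^] ((-1) ^ k :: int))"
proof (cases "even k")
  case True
  from assms(2) show ?thesis by (rule reg_cong) (use True assms(3) in \<open>simp only: sign_pow_cases if_True\<close>)
next
  case False
  from reg_inv[OF assms(1,2)] show ?thesis
    by (rule reg_cong) (use False assms(3) in \<open>simp only: sign_pow_cases if_False\<close>)
qed

lemma dh_cochains:
  assumes f: "f \<in> cochains p q" shows "dh p q f \<in> cochains (Suc p) q"
proof -
  have "P q {u. (i, u) \<in> inc (Suc p) q} (\<lambda>u. dh p q f (i, u))" if "0 < q" and i: "i \<in> {..<Suc p} \<rightarrow>\<^sub>E I" for i
  proof -
    obtain q' where q: "q = Suc q'" using \<open>0 < q\<close> by (cases q) auto
    have face: "P (Suc q') {u. (i, u) \<in> inc (Suc p) (Suc q')} (\<lambda>u. f (del p k i, u))" if "k \<le> p" for k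
    proof -
      have "del p k i \<in> {..<p} \<rightarrow>\<^sub>E I" using i that by (auto simp: del_def PiE_iff)
      then have "P (Suc q') {u. (del p k i, u) \<in> inc p (Suc q')} (\<lambda>u. f (del p k i, u))"
        using f q by (auto simp: cochains_def)
      then show ?thesis by (rule reg_subset[OF _ opn_slice[OF i]]) (use inc_del_left that in auto)
    qed
    have "P (Suc q') {u. (i, u) \<in> inc (Suc p) (Suc q')}
            (\<lambda>u. \<Otimes>k\<in>{..p}. f (del p k i, u) [^] ((-1) ^ k :: int))"
      using f i face inc_del_left q opn_slice
      by (intro reg_finprod reg_sign) (auto simp: cochains_closed)
    then show ?thesis unfolding q
    proof (rule reg_cong)
      fix u assume u: "u \<in> {u. (i, u) \<in> inc (Suc p) (Suc q')}"
      have "asum V p (\<lambda>i. tot p q f i u) i = (\<Otimes>k\<in>{..p}. f (del p k i, u) [^] ((-1) ^ k :: int))"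
        unfolding asum_def using u q inc_del_left f
        by (intro finprod_cong') (auto simp: tot_inc cochains_closed)
      then show "(\<Otimes>k\<in>{..p}. f (del p k i, u) [^] ((-1) ^ k :: int)) = dh p (Suc q') f (i, u)"
        using u q by (simp add: dh_apply)
    qed
  qed
  then show ?thesis
    using dh_carrier[of f p q] dh_alternating[of f p q] f by (auto simp: cochains_def)
qed

lemma dv_cochains:
  assumes f: "f \<in> cochains p q" shows "dv p q f \<in> cochains p (Suc q)"
proof -
  have "P (Suc q) {u. (i, u) \<in> inc p (Suc q)} (\<lambda>u. dv p q f (i, u))" if i: "i \<in> {..<p} \<rightarrow>\<^sub>E I" for i
  proof -
    let ?W = "{u. (i, u) \<in> inc p (Suc q)}"
    have W: "opn (Suc q) ?W" using i by (rule opn_slice)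
    have face: "P (Suc q) ?W (\<lambda>u. f (i, del q k u))" if "k \<le> q" for k
    proof (cases q)
      case 0
      \<comment> \<open>The only tuple of length 0 is the face of every tuple of length 1, hence the function is constant.\<close>
      show ?thesis
      proof (cases "?W = {}")
        case True
        show ?thesis by (rule reg_cong[OF reg_const[OF one_closed W]]) (use True in auto)
      next
        case False
        then obtain u where u: "(i, u) \<in> inc p (Suc q)" by auto
        have [simp]: "del 0 k = (\<lambda>u _. undefined)" by (auto simp: del_def fun_eq_iff)
        have "f (i, del q k u) \<in> carrier V" using u f inc_del_right that cochains_closed by blast
        from reg_const[OF this W] show ?thesis by (rule reg_cong) (simp add: 0)
      qed
    next
      case (Suc q')
      have "P (Suc q') {u. (i, u) \<in> inc p (Suc q')} (\<lambda>u. f (i, u))"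
        using f i Suc by (auto simp: cochains_def)
      from this opn_slice[OF i] show ?thesis
        unfolding Suc by (rule reg_del) (use W that inc_del_right Suc in auto)
    qed
    have "P (Suc q) ?W (\<lambda>u. \<Otimes>k\<in>{..q}. f (i, del q k u) [^] ((-1) ^ k :: int))"
      using f i face inc_del_right W
      by (intro reg_finprod reg_sign) (auto simp: cochains_closed)
    then show ?thesis
    proof (rule reg_cong)
      fix u assume u: "u \<in> ?W"
      have "asum V q (\<lambda>u. tot p q f i u) u = (\<Otimes>k\<in>{..q}. f (i, del q k u) [^] ((-1) ^ k :: int))"
        unfolding asum_def using u inc_del_right f
        by (intro finprod_cong') (auto simp: tot_inc cochains_closed)
      then show "(\<Otimes>k\<in>{..q}. f (i, del q k u) [^] ((-1) ^ k :: int)) = dv p q f (i, u)"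
        using u by (simp add: dv_apply)
    qed
  qed
  then show ?thesis
    using dv_carrier[of f p q] dv_alternating[of f p q] f by (auto simp: cochains_def)
qed

text \<open>The contraction of the rows: insert the index \<open>j\<close> in front, multiply by the \<open>j\<close>-th function of the
  partition of unity, and sum over \<open>j\<close>. It preserves alternating cochains because the inserted index is
  summed over.\<close>

lemma rows_exact:
  assumes f: "f \<in> cochains (Suc p) (Suc q)" and df: "dh (Suc p) (Suc q) f = (\<lambda>x\<in>inc (Suc (Suc p)) (Suc q). \<one>)"
  shows "\<exists>g\<in>cochains p (Suc q). dh p (Suc q) g = f"
proof -
  let ?f = "tot (Suc p) (Suc q) f"
  define g where "g = (\<lambda>(i, u)\<in>inc p (Suc q). \<Otimes>j\<in>J (Suc q) u. mu (Suc q) j u (f (cons p j i, u)))"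
  have f_tot: "?f i u \<in> carrier V" for i u using f cochains_carrier tot_closed by blast
  have inc_cons: "(cons p j i, u) \<in> inc (Suc p) (Suc q)"
    if "(i, u) \<in> inc p (Suc q)" "j \<in> J (Suc q) u" for i j u
    using that J_cov[OF inc_cov[OF that(1)] that(2)] by (intro inc_cons_left) auto
  have mu_closed: "mu (Suc q) j u v \<in> carrier V" if "u \<in> cov (Suc q)" "j \<in> J (Suc q) u" "v \<in> carrier V" for j u v
    using mu_hom[OF that(1,2)] that(3) by (auto simp: hom_def)
  have g_apply: "g (i, u) = (\<Otimes>j\<in>J (Suc q) u. mu (Suc q) j u (?f (cons p j i) u))" if "(i, u) \<in> inc p (Suc q)" for i u
    unfolding g_def using that inc_cons inc_cov[OF that] f_tot
    by (simp, intro finprod_cong') (auto intro!: mu_closed simp: tot_inc cochains_closed[OF f])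
  have g_carrier: "g \<in> inc p (Suc q) \<rightarrow>\<^sub>E carrier V"
  proof (rule PiE_I)
    fix x assume x: "x \<in> inc p (Suc q)"
    then obtain i u where iu: "x = (i, u)" by force
    show "g x \<in> carrier V" using x unfolding iu
      by (subst g_apply) (auto intro!: finprod_closed mu_closed f_tot inc_cov)
  qed (auto simp: g_def)
  have g_alt: "alternating p (Suc q) g"
    unfolding alternating_def
  proof (intro allI impI)
    fix i u k assume *: "(i, u) \<in> inc p (Suc q)" "Suc k < p"
    have u: "u \<in> cov (Suc q)" using * inc_cov by blast
    have "g (i \<circ> adj k, u) = (\<Otimes>j\<in>J (Suc q) u. mu (Suc q) j u (inv ?f (cons p j i) u))"
      using * f by (subst g_apply) (auto simp: inc_adj cons_transpose tot_adj cochains_def)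
    also have "\<dots> = (\<Otimes>j\<in>J (Suc q) u. inv mu (Suc q) j u (?f (cons p j i) u))"
    proof (rule finprod_cong')
      fix j assume j: "j \<in> J (Suc q) u"
      interpret h: group_hom V V "mu (Suc q) j u" by unfold_locales (rule mu_hom[OF u j])
      show "mu (Suc q) j u (inv ?f (cons p j i) u) = inv mu (Suc q) j u (?f (cons p j i) u)"
        using f_tot by simp
    qed (use mu_closed u f_tot in auto)
    also have "\<dots> = inv g (i, u)"
      unfolding g_apply[OF *(1)] using mu_closed u f_tot by (intro finprod_inv) auto
    finally show "g (i \<circ> adj k, u) = inv g (i, u)" .
  qed
  have "P (Suc q) {u. (i, u) \<in> inc p (Suc q)} (\<lambda>u. g (i, u))" if i: "i \<in> {..<p} \<rightarrow>\<^sub>E I" for i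
  proof -
    let ?W = "{u. (i, u) \<in> inc p (Suc q)}"
    have slice: "?W \<inter> ({..<Suc q} \<rightarrow>\<^sub>E U j) = {u. (cons p j i, u) \<in> inc (Suc p) (Suc q)}" if "j \<in> I" for j
    proof (intro equalityI subsetI)
      fix u assume "u \<in> ?W \<inter> ({..<Suc q} \<rightarrow>\<^sub>E U j)"
      then show "u \<in> {u. (cons p j i, u) \<in> inc (Suc p) (Suc q)}"
        using that by (auto intro!: inc_cons_left)
    next
      fix u assume "u \<in> {u. (cons p j i, u) \<in> inc (Suc p) (Suc q)}"
      then have u: "(cons p j i, u) \<in> inc (Suc p) (Suc q)" by simp
      have "del p 0 (cons p j i) = i" using i by (intro del_0_cons) (auto simp: PiE_def)
      then have "(i, u) \<in> inc p (Suc q)" using inc_del_left[OF u, of 0] by simp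
      moreover have "u \<in> {..<Suc q} \<rightarrow>\<^sub>E U j"
      proof (rule PiE_I)
        fix l assume "l \<in> {..<Suc q}"
        then have "u l \<in> U (cons p j i 0)" using u by (auto simp: inc_def)
        then show "u l \<in> U j" by simp
      qed (use inc_extensional[OF u] in \<open>auto simp: extensional_def\<close>)
      ultimately show "u \<in> ?W \<inter> ({..<Suc q} \<rightarrow>\<^sub>E U j)" by simp
    qed
    have "P (Suc q) ?W (\<lambda>u. \<Otimes>j\<in>J (Suc q) u. mu (Suc q) j u (f (cons p j i, u)))"
    proof (rule reg_partition)
      show "opn (Suc q) ?W" using i by (rule opn_slice)
      show "?W \<subseteq> cov (Suc q)" using inc_cov by auto
      fix j assume j: "j \<in> I"
      have "cons p j i \<in> {..<Suc p} \<rightarrow>\<^sub>E I" using i j by (auto simp: cons_def PiE_iff split: nat.split)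
      then show "P (Suc q) (?W \<inter> ({..<Suc q} \<rightarrow>\<^sub>E U j)) (\<lambda>u. f (cons p j i, u))"
        unfolding slice[OF j] using f by (auto simp: cochains_def)
      show "f (cons p j i, u) \<in> carrier V" if "u \<in> ?W \<inter> ({..<Suc q} \<rightarrow>\<^sub>E U j)" for u
        using that f unfolding slice[OF j] by (auto simp: cochains_closed)
    qed
    then show ?thesis by (rule reg_cong) (auto simp: g_def)
  qed
  then have g: "g \<in> cochains p (Suc q)" using g_carrier g_alt by (auto simp: cochains_def)
  have "dh p (Suc q) g = f"
  proof (rule extensionalityI[of _ "inc (Suc p) (Suc q)"])
    fix x assume x: "x \<in> inc (Suc p) (Suc q)"
    obtain i u where iu: "x = (i, u)" by force
    have u: "u \<in> cov (Suc q)" using x inc_cov unfolding iu by blast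
    \<comment> \<open>The cocycle condition at the tuple \<open>j # i\<close>, solved for its face without \<open>j\<close>.\<close>
    have fJ: "f (i, u) = asum V p (\<lambda>i. ?f (cons p j i) u) i" if j: "j \<in> J (Suc q) u" for j
    proof -
      have *: "(cons (Suc p) j i, u) \<in> inc (Suc (Suc p)) (Suc q)"
        using x J_cov[OF u j] unfolding iu by (intro inc_cons_left) auto
      then have "\<one> = asum V (Suc p) (\<lambda>i. ?f i u) (cons (Suc p) j i)"
        using df by (simp add: dh_apply[symmetric])
      also have "\<dots> = f (i, u) \<otimes> inv asum V p (\<lambda>i. ?f (cons p j i) u) i"
        using f_tot x inc_extensional unfolding iu by (subst asum_cons) (auto simp: tot_inc)
      finally show ?thesis
        using f_tot f x cochains_closed unfolding iu
        by (metis asum_closed inv_equality inv_closed inv_inv)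
    qed
    have "dh p (Suc q) g x = asum V p (\<lambda>i. tot p (Suc q) g i u) i" using x iu by (simp add: dh_apply)
    also have "\<dots> = asum V p (\<lambda>i. \<Otimes>j\<in>J (Suc q) u. mu (Suc q) j u (?f (cons p j i) u)) i"
      using x inc_del_left u f_tot unfolding iu
      by (intro asum_cong) (auto simp: tot_inc g_apply intro!: finprod_closed mu_closed)
    \<comment> \<open>The case distinction yields a value in the carrier for every \<open>j\<close>.\<close>
    also have "\<dots> = asum V p (\<lambda>i. \<Otimes>j\<in>J (Suc q) u. if j \<in> J (Suc q) u then mu (Suc q) j u (?f (cons p j i) u) else \<one>) i"
      using u f_tot by (intro asum_cong finprod_cong') (auto intro!: finprod_closed mu_closed)
    also have "\<dots> = (\<Otimes>j\<in>J (Suc q) u. asum V p (\<lambda>i. if j \<in> J (Suc q) u then mu (Suc q) j u (?f (cons p j i) u) else \<one>) i)"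
      using u f_tot by (intro asum_finprod J_finite) (auto intro!: mu_closed)
    also have "\<dots> = (\<Otimes>j\<in>J (Suc q) u. mu (Suc q) j u (f (i, u)))"
    proof (rule finprod_cong')
      fix j assume j: "j \<in> J (Suc q) u"
      show "asum V p (\<lambda>i. if j \<in> J (Suc q) u then mu (Suc q) j u (?f (cons p j i) u) else \<one>) i = mu (Suc q) j u (f (i, u))"
        unfolding fJ[OF j] using j f_tot mu_hom[OF u j] by (simp add: asum_hom)
    qed (use u x iu cochains_closed[OF f] in \<open>auto intro!: mu_closed\<close>)
    also have "\<dots> = f x" using u f x unfolding iu by (intro mu_sum) (auto simp: cochains_closed)
    finally show "dh p (Suc q) g x = f x" .
  qed (use cochains_carrier[OF f] in \<open>auto simp: dh_def PiE_def\<close>)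
  with g show ?thesis by blast
qed

lemma rows_mono:
  assumes f: "f \<in> cochains 0 (Suc q)" and df: "dh 0 (Suc q) f = (\<lambda>x\<in>inc (Suc 0) (Suc q). \<one>)"
  shows "f = (\<lambda>x\<in>inc 0 (Suc q). \<one>)"
proof (rule extensionalityI[of _ "inc 0 (Suc q)"])
  fix x assume x: "x \<in> inc 0 (Suc q)"
  obtain i u where iu: "x = (i, u)" by force
  obtain j where j: "j \<in> I" "\<forall>l<Suc q. u l \<in> U j" using x unfolding iu inc_def by blast
  have i: "i = (\<lambda>_. undefined)" using x unfolding iu by (auto simp: inc_def)
  have *: "(cons 0 j i, u) \<in> inc (Suc 0) (Suc q)" using x j unfolding iu by (intro inc_cons_left) auto
  have "\<one> = dh 0 (Suc q) f (cons 0 j i, u)" using df * by simp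
  also have "\<dots> = f x" using * x tot_closed[OF cochains_carrier[OF f]] unfolding iu i
    by (simp add: dh_apply asum_0 tot_inc)
  finally show "f x = (\<lambda>x\<in>inc 0 (Suc q). \<one>) x" using x by simp
qed (use cochains_carrier[OF f] in \<open>auto simp: PiE_def\<close>)

text \<open>The base point of a non-empty intersection depends only on the set of indices, so that the cone
  construction preserves alternating cochains.\<close>

definition base :: "nat \<Rightarrow> (nat \<Rightarrow> 'i) \<Rightarrow> 'm" where
  "base p i = (SOME m. m \<in> X \<and> (\<forall>j\<in>i ` {..<p}. m \<in> U j))"

lemma base:
  assumes "(i, u) \<in> inc p q" shows "base p i \<in> X" "\<forall>k<p. base p i \<in> U (i k)"
proof -
  obtain m where "m \<in> X \<and> (\<forall>j\<in>i ` {..<p}. m \<in> U j)" using assms by (force simp: inc_def)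
  then have "base p i \<in> X \<and> (\<forall>j\<in>i ` {..<p}. base p i \<in> U j)" unfolding base_def by (rule someI)
  then show "base p i \<in> X" "\<forall>k<p. base p i \<in> U (i k)" by auto
qed

lemma base_adj: assumes "Suc k < p" shows "base p (i \<circ> adj k) = base p i"
proof -
  have "adj k ` {..<p} = {..<p}" using assms by (auto simp: Transposition.transpose_def image_def)
  then have "(i \<circ> adj k) ` {..<p} = i ` {..<p}" by (metis image_comp)
  then show ?thesis by (simp add: base_def)
qed

text \<open>The contraction of the columns inserts the base point of the intersection in front of the points. It
  preserves regular functions since the inserted point depends on the indices only.\<close>

lemma columns_exact:
  assumes f: "f \<in> cochains (Suc p) (Suc q)" and df: "dv (Suc p) (Suc q) f = (\<lambda>x\<in>inc (Suc p) (Suc (Suc q)). \<one>)"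
  shows "\<exists>g\<in>cochains (Suc p) q. dv (Suc p) q g = f"
proof -
  let ?f = "tot (Suc p) (Suc q) f"
  define g where "g = (\<lambda>(i, u)\<in>inc (Suc p) q. f (i, cons q (base (Suc p) i) u))"
  have f_tot: "?f i u \<in> carrier V" for i u using f cochains_carrier tot_closed by blast
  have inc_cons: "(i, cons n (base (Suc p) i) u) \<in> inc (Suc p) (Suc n)" if "(i, u) \<in> inc (Suc p) n" for i u n
    using base[OF that] that by (intro inc_cons_right) auto
  have g_carrier: "g \<in> inc (Suc p) q \<rightarrow>\<^sub>E carrier V"
    using f inc_cons by (auto simp: g_def cochains_closed)
  have g_alt: "alternating (Suc p) q g"
    unfolding alternating_def
  proof (intro allI impI)
    fix i u k assume "(i, u) \<in> inc (Suc p) q" "Suc k < Suc p"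
    then show "g (i \<circ> adj k, u) = inv g (i, u)"
      using f inc_cons by (simp add: g_def inc_adj base_adj cochains_def alternating_def)
  qed
  have "P q {u. (i, u) \<in> inc (Suc p) q} (\<lambda>u. g (i, u))" if i: "i \<in> {..<Suc p} \<rightarrow>\<^sub>E I" and "0 < q" for i
  proof -
    obtain q' where q: "q = Suc q'" using \<open>0 < q\<close> by (cases q) auto
    show ?thesis
    proof (cases "{u. (i, u) \<in> inc (Suc p) q} = {}")
      case True
      show ?thesis unfolding q
        by (rule reg_cong[OF reg_const[OF one_closed opn_slice[OF i]]]) (use True q in auto)
    next
      case False
      then have b: "base (Suc p) i \<in> X" using base by blast
      have "P (Suc (Suc q')) {u. (i, u) \<in> inc (Suc p) (Suc q)} (\<lambda>u. f (i, u))"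
        using f i q by (auto simp: cochains_def)
      then have "P (Suc q') {u. (i, u) \<in> inc (Suc p) q} (\<lambda>u. f (i, cons (Suc q') (base (Suc p) i) u))"
        using b i q opn_slice[OF i] inc_cons by (intro reg_cons) auto
      then show ?thesis unfolding q by (rule reg_cong) (simp add: g_def q)
    qed
  qed
  then have g: "g \<in> cochains (Suc p) q" using g_carrier g_alt by (auto simp: cochains_def)
  have "dv (Suc p) q g = f"
  proof (rule extensionalityI[of _ "inc (Suc p) (Suc q)"])
    fix x assume x: "x \<in> inc (Suc p) (Suc q)"
    obtain i u where iu: "x = (i, u)" by force
    \<comment> \<open>The cocycle condition at the tuple \<open>base # u\<close>, solved for its face without the base point.\<close>
    have "\<one> = asum V (Suc q) (?f i) (cons (Suc q) (base (Suc p) i) u)"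
      using df inc_cons[of i u "Suc q"] x unfolding iu by (simp add: dv_apply[symmetric])
    also have "\<dots> = f (i, u) \<otimes> inv asum V q (\<lambda>u. ?f i (cons q (base (Suc p) i) u)) u"
      using f_tot x inc_extensional unfolding iu by (subst asum_cons) (auto simp: tot_inc)
    finally have "f (i, u) = asum V q (\<lambda>u. ?f i (cons q (base (Suc p) i) u)) u"
      using f_tot f x cochains_closed unfolding iu
      by (metis asum_closed inv_equality inv_closed inv_inv)
    also have "\<dots> = asum V q (\<lambda>u. tot (Suc p) q g i u) u"
      using x inc_del_right inc_cons tot_closed[OF g_carrier] unfolding iu
      by (intro asum_cong) (auto simp: tot_inc g_def)
    finally show "dv (Suc p) q g x = f x" using x unfolding iu by (simp add: dv_apply)
  qed (use cochains_carrier[OF f] in \<open>auto simp: dv_def PiE_def\<close>)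
  with g show ?thesis by blast
qed

lemma columns_mono:
  assumes f: "f \<in> cochains (Suc p) 0" and df: "dv (Suc p) 0 f = (\<lambda>x\<in>inc (Suc p) (Suc 0). \<one>)"
  shows "f = (\<lambda>x\<in>inc (Suc p) 0. \<one>)"
proof (rule extensionalityI[of _ "inc (Suc p) 0"])
  fix x assume x: "x \<in> inc (Suc p) 0"
  obtain i u where iu: "x = (i, u)" by force
  have u: "u = (\<lambda>_. undefined)" using x unfolding iu by (auto simp: inc_def)
  have *: "(i, cons 0 (base (Suc p) i) u) \<in> inc (Suc p) (Suc 0)"
    using x base[of i u] unfolding iu by (intro inc_cons_right) auto
  have "\<one> = dv (Suc p) 0 f (i, cons 0 (base (Suc p) i) u)" using df * by simp
  also have "\<dots> = f x" using * x tot_closed[OF cochains_carrier[OF f]] unfolding iu u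
    by (simp add: dv_apply asum_0 tot_inc)
  finally show "f x = (\<lambda>x\<in>inc (Suc p) 0. \<one>) x" using x by simp
qed (use cochains_carrier[OF f] in \<open>auto simp: PiE_def\<close>)

lemma double_complex_Gr: "double_complex Gr dh dv"
proof (rule double_complex.intro)
  show "comm_group (Gr p q)" for p q by (rule comm_group_Gr)
  show "dh p q \<in> hom (Gr p q) (Gr (Suc p) q)" for p q
  proof (rule homI)
    fix f g assume "f \<in> carrier (Gr p q)" "g \<in> carrier (Gr p q)"
    then have fg: "f \<in> inc p q \<rightarrow>\<^sub>E carrier V" "g \<in> inc p q \<rightarrow>\<^sub>E carrier V"
      using cochains_carrier by auto
    have "dh p q (\<lambda>x\<in>inc p q. f x \<otimes> g x) = (\<lambda>x\<in>inc (Suc p) q. dh p q f x \<otimes> dh p q g x)"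
      by (rule extensionalityI[of _ "inc (Suc p) q"]) (use dh_mult[OF fg] in \<open>auto simp: dh_def\<close>)
    then show "dh p q (f \<otimes>\<^bsub>Gr p q\<^esub> g) = dh p q f \<otimes>\<^bsub>Gr (Suc p) q\<^esub> dh p q g" by simp
  qed (simp add: dh_cochains)
  show "dv p q \<in> hom (Gr p q) (Gr p (Suc q))" for p q
  proof (rule homI)
    fix f g assume "f \<in> carrier (Gr p q)" "g \<in> carrier (Gr p q)"
    then have fg: "f \<in> inc p q \<rightarrow>\<^sub>E carrier V" "g \<in> inc p q \<rightarrow>\<^sub>E carrier V"
      using cochains_carrier by auto
    have "dv p q (\<lambda>x\<in>inc p q. f x \<otimes> g x) = (\<lambda>x\<in>inc p (Suc q). dv p q f x \<otimes> dv p q g x)"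
      by (rule extensionalityI[of _ "inc p (Suc q)"]) (use dv_mult[OF fg] in \<open>auto simp: dv_def\<close>)
    then show "dv p q (f \<otimes>\<^bsub>Gr p q\<^esub> g) = dv p q f \<otimes>\<^bsub>Gr p (Suc q)\<^esub> dv p q g" by simp
  qed (simp add: dv_cochains)
  fix x p q
  show "dh (Suc p) q (dh p q x) = \<one>\<^bsub>Gr (Suc (Suc p)) q\<^esub>" if "x \<in> carrier (Gr p q)"
    using dh_dh[OF cochains_carrier] that by simp
  show "dv p (Suc q) (dv p q x) = \<one>\<^bsub>Gr p (Suc (Suc q))\<^esub>" if "x \<in> carrier (Gr p q)"
    using dv_dv[OF cochains_carrier] that by simp
  show "dh p (Suc q) (dv p q x) = dv (Suc p) q (dh p q x)" if "x \<in> carrier (Gr p q)"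
    using dh_dv[OF cochains_carrier] that by simp
  show "x = \<one>\<^bsub>Gr 0 (Suc q)\<^esub>"
    if "x \<in> carrier (Gr 0 (Suc q))" "dh 0 (Suc q) x = \<one>\<^bsub>Gr (Suc 0) (Suc q)\<^esub>"
    using rows_mono[of x q] that by simp
  show "\<exists>y\<in>carrier (Gr p (Suc q)). dh p (Suc q) y = x"
    if "x \<in> carrier (Gr (Suc p) (Suc q))" "dh (Suc p) (Suc q) x = \<one>\<^bsub>Gr (Suc (Suc p)) (Suc q)\<^esub>"
    using rows_exact[of x p q] that by simp
  show "x = \<one>\<^bsub>Gr (Suc p) 0\<^esub>"
    if "x \<in> carrier (Gr (Suc p) 0)" "dv (Suc p) 0 x = \<one>\<^bsub>Gr (Suc p) (Suc 0)\<^esub>"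
    using columns_mono[of x p] that by simp
  show "\<exists>y\<in>carrier (Gr (Suc p) q). dv (Suc p) q y = x"
    if "x \<in> carrier (Gr (Suc p) (Suc q))" "dv (Suc p) (Suc q) x = \<one>\<^bsub>Gr (Suc p) (Suc (Suc q))\<^esub>"
    using columns_exact[of x p q] that by simp
qed

end


section \<open>Topological vector spaces\<close>

lemma real_ring_simps [simp]:
  "carrier real_ring = UNIV" "a \<otimes>\<^bsub>real_ring\<^esub> b = a * b" "\<one>\<^bsub>real_ring\<^esub> = 1"
  "\<zero>\<^bsub>real_ring\<^esub> = 0" "a \<oplus>\<^bsub>real_ring\<^esub> b = a + b"
  by (simp_all add: real_ring_def)

lemma cring_real_ring: "cring real_ring"
proof (rule cringI)
  show "abelian_group real_ring"
  proof (rule abelian_groupI)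
    fix x :: real
    show "\<exists>y\<in>carrier real_ring. y \<oplus>\<^bsub>real_ring\<^esub> x = \<zero>\<^bsub>real_ring\<^esub>"
      by (rule bexI[of _ "- x"]) auto
  qed auto
  show "comm_monoid real_ring" by (rule comm_monoidI) auto
qed (auto simp: algebra_simps)

lemma tvsI:
  assumes "\<And>x y. x \<in> carrier E \<Longrightarrow> y \<in> carrier E \<Longrightarrow> x \<oplus>\<^bsub>E\<^esub> y \<in> carrier E"
    and "\<zero>\<^bsub>E\<^esub> \<in> carrier E"
    and "\<And>x y z. x \<in> carrier E \<Longrightarrow> y \<in> carrier E \<Longrightarrow> z \<in> carrier E \<Longrightarrow>
           (x \<oplus>\<^bsub>E\<^esub> y) \<oplus>\<^bsub>E\<^esub> z = x \<oplus>\<^bsub>E\<^esub> (y \<oplus>\<^bsub>E\<^esub> z)"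
    and "\<And>x y. x \<in> carrier E \<Longrightarrow> y \<in> carrier E \<Longrightarrow> x \<oplus>\<^bsub>E\<^esub> y = y \<oplus>\<^bsub>E\<^esub> x"
    and "\<And>x. x \<in> carrier E \<Longrightarrow> \<zero>\<^bsub>E\<^esub> \<oplus>\<^bsub>E\<^esub> x = x"
    and smult_closed: "\<And>a x. x \<in> carrier E \<Longrightarrow> a \<odot>\<^bsub>E\<^esub> x \<in> carrier E"
    and distr: "\<And>a b x. x \<in> carrier E \<Longrightarrow> (a + b) \<odot>\<^bsub>E\<^esub> x = a \<odot>\<^bsub>E\<^esub> x \<oplus>\<^bsub>E\<^esub> b \<odot>\<^bsub>E\<^esub> x"
    and "\<And>a x y. x \<in> carrier E \<Longrightarrow> y \<in> carrier E \<Longrightarrow> a \<odot>\<^bsub>E\<^esub> (x \<oplus>\<^bsub>E\<^esub> y) = a \<odot>\<^bsub>E\<^esub> x \<oplus>\<^bsub>E\<^esub> a \<odot>\<^bsub>E\<^esub> y"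
    and "\<And>a b x. x \<in> carrier E \<Longrightarrow> (a * b) \<odot>\<^bsub>E\<^esub> x = a \<odot>\<^bsub>E\<^esub> (b \<odot>\<^bsub>E\<^esub> x)"
    and one: "\<And>x. x \<in> carrier E \<Longrightarrow> 1 \<odot>\<^bsub>E\<^esub> x = x"
    and zero: "\<And>x. x \<in> carrier E \<Longrightarrow> 0 \<odot>\<^bsub>E\<^esub> x = \<zero>\<^bsub>E\<^esub>"
    and "topspace (tvs_topology E) = carrier E" "Hausdorff_space (tvs_topology E)"
    and "continuous_map (prod_topology (tvs_topology E) (tvs_topology E)) (tvs_topology E)
           (\<lambda>(x, y). x \<oplus>\<^bsub>E\<^esub> y)"
    and "continuous_map (prod_topology euclideanreal (tvs_topology E)) (tvs_topology E)
           (\<lambda>(a, x). a \<odot>\<^bsub>E\<^esub> x)"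
  shows "tvs E"
proof (rule tvs.intro)
  show "Module.module real_ring E"
  proof (rule moduleI[OF cring_real_ring])
    show "abelian_group E"
    proof (rule abelian_groupI)
      fix x assume x: "x \<in> carrier E"
      have "(-1) \<odot>\<^bsub>E\<^esub> x \<oplus>\<^bsub>E\<^esub> x = (-1 + 1) \<odot>\<^bsub>E\<^esub> x" using distr[OF x, of "-1" 1] one[OF x] by simp
      then show "\<exists>y\<in>carrier E. y \<oplus>\<^bsub>E\<^esub> x = \<zero>\<^bsub>E\<^esub>" using zero smult_closed x by auto
    qed (use assms in auto)
  qed (use assms in auto)
  show "tvs_axioms E" by (rule tvs_axioms.intro) (use assms in auto)
qed

context tvs
begin

lemma add_closed: "x \<in> carrier E \<Longrightarrow> y \<in> carrier E \<Longrightarrow> x \<oplus> y \<in> carrier E"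
  and zero_closed: "\<zero> \<in> carrier E"
  and scale_closed: "x \<in> carrier E \<Longrightarrow> a \<odot> x \<in> carrier E"
  and scale_add_left: "x \<in> carrier E \<Longrightarrow> (a + b) \<odot> x = a \<odot> x \<oplus> b \<odot> x"
  and scale_add_right: "x \<in> carrier E \<Longrightarrow> y \<in> carrier E \<Longrightarrow> a \<odot> (x \<oplus> y) = a \<odot> x \<oplus> a \<odot> y"
  and scale_assoc: "x \<in> carrier E \<Longrightarrow> (a * b) \<odot> x = a \<odot> (b \<odot> x)"
  and scale_one: "x \<in> carrier E \<Longrightarrow> 1 \<odot> x = x"
  and scale_zero: "x \<in> carrier E \<Longrightarrow> 0 \<odot> x = \<zero>"
  and scale_zero_right: "a \<odot> \<zero> = \<zero>"
  using module.smult_l_distr[of a b x] module.smult_r_distr[of a x y] module.smult_assoc1[of a b x]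
    module.smult_one[of x] module.smult_closed[of a x] module.smult_l_null[of x] module.smult_r_null[of a]
  by auto

lemma add_eq_iff_minus:
  "x \<in> carrier E \<Longrightarrow> y \<in> carrier E \<Longrightarrow> z \<in> carrier E \<Longrightarrow> y \<ominus> x = z \<longleftrightarrow> y = x \<oplus> z"
  by (metis a_minus_def module.add.inv_closed module.add.m_assoc module.add.m_comm
      module.add.inv_solve_right module.add.m_closed)

lemma scale_inverse_cancel:
  "a \<noteq> 0 \<Longrightarrow> x \<in> carrier E \<Longrightarrow> y \<in> carrier E \<Longrightarrow> a \<odot> x = a \<odot> y \<Longrightarrow> x = y"
  by (metis scale_assoc scale_one left_inverse)

lemma continuous_map_plus:
  assumes "continuous_map T (tvs_topology E) f" "continuous_map T (tvs_topology E) g"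
  shows "continuous_map T (tvs_topology E) (\<lambda>x. f x \<oplus> g x)"
  using continuous_map_compose[OF _ continuous_add, of T "\<lambda>x. (f x, g x)"] assms
  by (simp add: continuous_map_paired o_def)

lemma continuous_map_scale:
  assumes "continuous_map T euclideanreal f" "continuous_map T (tvs_topology E) g"
  shows "continuous_map T (tvs_topology E) (\<lambda>x. f x \<odot> g x)"
  using continuous_map_compose[OF _ continuous_smult, of T "\<lambda>x. (f x, g x)"] assms
  by (simp add: continuous_map_paired o_def)

lemma continuous_map_carrier:
  "continuous_map T (tvs_topology E) f \<Longrightarrow> x \<in> topspace T \<Longrightarrow> f x \<in> carrier E"
  using topspace_tvs by (auto simp: continuous_map_def)

end

lemma tvs_real: "tvs real_tvs"
proof (rule tvsI)
  show "continuous_map (prod_topology (tvs_topology real_tvs) (tvs_topology real_tvs)) (tvs_topology real_tvs)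
     (\<lambda>(x, y). x \<oplus>\<^bsub>real_tvs\<^esub> y)"
    by (simp add: real_tvs_def case_prod_beta) (intro continuous_intros)
  show "continuous_map (prod_topology euclideanreal (tvs_topology real_tvs)) (tvs_topology real_tvs)
     (\<lambda>(a, x). a \<odot>\<^bsub>real_tvs\<^esub> x)"
    by (simp add: real_tvs_def case_prod_beta) (intro continuous_intros)
qed (auto simp: real_tvs_def algebra_simps)

lemma real_tvs_simps [simp]:
  "carrier real_tvs = UNIV" "x \<oplus>\<^bsub>real_tvs\<^esub> y = x + y" "a \<odot>\<^bsub>real_tvs\<^esub> x = a * x"
  "\<zero>\<^bsub>real_tvs\<^esub> = 0" "tvs_topology real_tvs = euclideanreal"
  by (simp_all add: real_tvs_def)

lemma tvs_prod_simps [simp]: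
  "carrier (tvs_prod E F) = carrier E \<times> carrier F"
  "x \<oplus>\<^bsub>tvs_prod E F\<^esub> y = (fst x \<oplus>\<^bsub>E\<^esub> fst y, snd x \<oplus>\<^bsub>F\<^esub> snd y)"
  "a \<odot>\<^bsub>tvs_prod E F\<^esub> x = (a \<odot>\<^bsub>E\<^esub> fst x, a \<odot>\<^bsub>F\<^esub> snd x)"
  "\<zero>\<^bsub>tvs_prod E F\<^esub> = (\<zero>\<^bsub>E\<^esub>, \<zero>\<^bsub>F\<^esub>)"
  "tvs_topology (tvs_prod E F) = prod_topology (tvs_topology E) (tvs_topology F)"
  by (simp_all add: tvs_prod_def)

lemma tvs_prod:
  fixes E :: "'a tvs" and F :: "'b tvs"
  assumes "tvs E" "tvs F" shows "tvs (tvs_prod E F)"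
proof -
  interpret E: tvs E by fact
  interpret F: tvs F by fact
  show ?thesis
  proof (rule tvsI)
    show "Hausdorff_space (tvs_topology (tvs_prod E F))"
      using E.Hausdorff_tvs F.Hausdorff_tvs by (simp add: Hausdorff_space_prod_topology)
    show "continuous_map (prod_topology (tvs_topology (tvs_prod E F)) (tvs_topology (tvs_prod E F)))
       (tvs_topology (tvs_prod E F)) (\<lambda>(x, y). x \<oplus>\<^bsub>tvs_prod E F\<^esub> y)"
      by (simp add: case_prod_unfold continuous_map_paired)
        (intro conjI E.continuous_map_plus F.continuous_map_plus continuous_map_fst_of[unfolded o_def]
          continuous_map_snd_of[unfolded o_def] continuous_map_fst continuous_map_snd;
          rule continuous_map_id[unfolded id_def])
    show "continuous_map (prod_topology euclideanreal (tvs_topology (tvs_prod E F)))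
       (tvs_topology (tvs_prod E F)) (\<lambda>(a, x). a \<odot>\<^bsub>tvs_prod E F\<^esub> x)"
      by (simp add: case_prod_unfold continuous_map_paired)
        (intro conjI E.continuous_map_scale F.continuous_map_scale continuous_map_fst_of[unfolded o_def]
          continuous_map_snd_of[unfolded o_def] continuous_map_fst continuous_map_snd;
          rule continuous_map_id[unfolded id_def])
  qed (auto simp: E.topspace_tvs F.topspace_tvs E.module.a_ac F.module.a_ac
      E.scale_add_left F.scale_add_left E.scale_add_right F.scale_add_right
      E.scale_assoc F.scale_assoc E.scale_one F.scale_one E.scale_zero F.scale_zero E.scale_closed F.scale_closed)
qed

lemma tvs_power_simps [simp]:
  "carrier (tvs_power E q) = {..q} \<rightarrow>\<^sub>E carrier E"
  "x \<oplus>\<^bsub>tvs_power E q\<^esub> y = (\<lambda>i\<in>{..q}. x i \<oplus>\<^bsub>E\<^esub> y i)"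
  "a \<odot>\<^bsub>tvs_power E q\<^esub> x = (\<lambda>i\<in>{..q}. a \<odot>\<^bsub>E\<^esub> x i)"
  "\<zero>\<^bsub>tvs_power E q\<^esub> = (\<lambda>i\<in>{..q}. \<zero>\<^bsub>E\<^esub>)"
  "tvs_topology (tvs_power E q) = product_topology (\<lambda>_. tvs_topology E) {..q}"
  by (simp_all add: tvs_power_def)

lemma tvs_power:
  fixes E :: "'a tvs"
  assumes "tvs E" shows "tvs (tvs_power E q)"
proof -
  interpret E: tvs E by fact
  have proj: "continuous_map T (tvs_topology E) (\<lambda>x. f x i)"
    if "continuous_map T (product_topology (\<lambda>_. tvs_topology E) {..q}) f" "i \<le> q" for T :: "'z topology" and f i
    using that by (auto simp: continuous_map_componentwise)
  show ?thesis
  proof (rule tvsI)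
    show "Hausdorff_space (tvs_topology (tvs_power E q))"
      using E.Hausdorff_tvs by (simp add: Hausdorff_space_product_topology)
    show "continuous_map (prod_topology (tvs_topology (tvs_power E q)) (tvs_topology (tvs_power E q)))
       (tvs_topology (tvs_power E q)) (\<lambda>(x, y). x \<oplus>\<^bsub>tvs_power E q\<^esub> y)"
      by (simp add: case_prod_unfold continuous_map_componentwise)
        (intro conjI ballI image_subsetI E.continuous_map_plus proj continuous_map_fst continuous_map_snd; simp)
    show "continuous_map (prod_topology euclideanreal (tvs_topology (tvs_power E q)))
       (tvs_topology (tvs_power E q)) (\<lambda>(a, x). a \<odot>\<^bsub>tvs_power E q\<^esub> x)"
      by (simp add: case_prod_unfold continuous_map_componentwise)
        (intro conjI ballI image_subsetI E.continuous_map_scale proj continuous_map_fst continuous_map_snd; simp)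
  qed (auto simp: E.topspace_tvs E.module.a_ac E.scale_closed PiE_iff fun_eq_iff extensional_def
      E.scale_add_left E.scale_add_right E.scale_assoc E.scale_one E.scale_zero)
qed

text \<open>The spaces of binary trees inherit their structure from products along a bijection \<open>h\<close> with inverse \<open>g\<close>;
  the topology of the trees is a pullback, defined on all trees in the set \<open>A\<close>.\<close>

lemma tvs_transport:
  fixes E :: "'a tvs" and F :: "'b tvs"
  assumes "tvs E"
    and top: "tvs_topology F = pullback_topology A h (tvs_topology E)" "A \<inter> h -` carrier E = carrier F"
    and g: "\<And>y. y \<in> carrier E \<Longrightarrow> g y \<in> A \<and> h (g y) = y" "\<And>x. x \<in> carrier F \<Longrightarrow> g (h x) = x"
    and ops: "\<zero>\<^bsub>F\<^esub> = g \<zero>\<^bsub>E\<^esub>"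
      "\<And>x y. x \<in> carrier F \<Longrightarrow> y \<in> carrier F \<Longrightarrow> x \<oplus>\<^bsub>F\<^esub> y = g (h x \<oplus>\<^bsub>E\<^esub> h y)"
      "\<And>a x. x \<in> carrier F \<Longrightarrow> a \<odot>\<^bsub>F\<^esub> x = g (a \<odot>\<^bsub>E\<^esub> h x)"
  shows "tvs F"
proof -
  interpret E: tvs E by fact
  have gF: "g y \<in> carrier F" if "y \<in> carrier E" for y using g(1)[OF that] that top(2) by auto
  have hE: "h x \<in> carrier E" if "x \<in> carrier F" for x using top(2) that by auto
  have hg: "h (g y) = y" if "y \<in> carrier E" for y using g that by auto
  have topF: "topspace (tvs_topology F) = carrier F"
    using top by (auto simp: topspace_pullback_topology E.topspace_tvs)
  have h_cont: "continuous_map (tvs_topology F) (tvs_topology E) h"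
    unfolding top(1) using continuous_map_pullback[OF continuous_map_id, of A h] by simp
  have into: "continuous_map T (tvs_topology F) f"
    if "continuous_map T (tvs_topology E) (\<lambda>x. h (f x))" "\<And>x. x \<in> topspace T \<Longrightarrow> f x \<in> carrier F" for T :: "'z topology" and f
    unfolding top(1) using that top(2) by (intro continuous_map_pullback') (auto simp: o_def)
  show ?thesis
  proof (rule tvsI)
    show "Hausdorff_space (tvs_topology F)"
      using h_cont E.Hausdorff_tvs topF g(2)
      by (intro Hausdorff_space_injective_preimage[of "tvs_topology E" "tvs_topology F" h] inj_onI) metis+
    show "continuous_map (prod_topology (tvs_topology F) (tvs_topology F)) (tvs_topology F) (\<lambda>(x, y). x \<oplus>\<^bsub>F\<^esub> y)"
    proof (rule into)
      have "continuous_map (prod_topology (tvs_topology F) (tvs_topology F)) (tvs_topology E)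
          (\<lambda>x. h (fst x) \<oplus>\<^bsub>E\<^esub> h (snd x))"
        by (intro E.continuous_map_plus continuous_map_compose[OF continuous_map_fst h_cont, unfolded o_def]
            continuous_map_compose[OF continuous_map_snd h_cont, unfolded o_def])
      then show "continuous_map (prod_topology (tvs_topology F) (tvs_topology F)) (tvs_topology E)
          (\<lambda>x. h (case x of (x, y) \<Rightarrow> x \<oplus>\<^bsub>F\<^esub> y))"
        by (rule continuous_map_eq) (auto simp: ops topF hg hE E.add_closed)
    qed (auto simp: ops topF gF hE E.add_closed)
    show "continuous_map (prod_topology euclideanreal (tvs_topology F)) (tvs_topology F) (\<lambda>(a, x). a \<odot>\<^bsub>F\<^esub> x)"
    proof (rule into)
      have "continuous_map (prod_topology euclideanreal (tvs_topology F)) (tvs_topology E)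
          (\<lambda>x. fst x \<odot>\<^bsub>E\<^esub> h (snd x))"
        by (intro E.continuous_map_scale continuous_map_fst
            continuous_map_compose[OF continuous_map_snd h_cont, unfolded o_def])
      then show "continuous_map (prod_topology euclideanreal (tvs_topology F)) (tvs_topology E)
          (\<lambda>x. h (case x of (a, x) \<Rightarrow> a \<odot>\<^bsub>F\<^esub> x))"
        by (rule continuous_map_eq) (auto simp: ops topF hg hE E.scale_closed)
    qed (auto simp: ops topF gF hE E.scale_closed)
  qed (auto simp: ops gF hE hg g topF E.add_closed E.scale_closed E.module.a_ac
      E.scale_add_left E.scale_add_right E.scale_assoc E.scale_one E.scale_zero)
qed


section \<open>The iterated spaces\<close>

text \<open>The iterated spaces are topological vector spaces themselves, so that linear maps between them make sense
  and one iterate may take the place of the model space.\<close>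

primrec bgn_zero :: "'a tvs \<Rightarrow> nat \<Rightarrow> 'a bgn" where
  "bgn_zero E 0 = Pt \<zero>\<^bsub>E\<^esub>"
| "bgn_zero E (Suc k) = Nd (bgn_zero E k) (bgn_zero E k) 0"

definition bgn_tvs :: "'a tvs \<Rightarrow> nat \<Rightarrow> 'a bgn tvs" where
  "bgn_tvs E k = \<lparr>carrier = topspace (bgn_topology E k), monoid.mult = undefined, one = undefined,
     zero = bgn_zero E k, add = bgn_add E, smult = bgn_smult E, tvs_topology = bgn_topology E k\<rparr>"

lemma bgn_tvs_simps [simp]:
  "carrier (bgn_tvs E k) = topspace (bgn_topology E k)"
  "x \<oplus>\<^bsub>bgn_tvs E k\<^esub> y = bgn_add E x y" "a \<odot>\<^bsub>bgn_tvs E k\<^esub> x = bgn_smult E a x"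
  "\<zero>\<^bsub>bgn_tvs E k\<^esub> = bgn_zero E k" "tvs_topology (bgn_tvs E k) = bgn_topology E k"
  by (simp_all add: bgn_tvs_def)

lemma topspace_bgn_0: "tvs E \<Longrightarrow> topspace (bgn_topology E 0) = Pt ` carrier E"
  using tvs.topspace_tvs[of E] by (auto simp: topspace_pullback_topology)

lemma topspace_bgn_Suc:
  "topspace (bgn_topology E (Suc k)) =
     {Nd x v t |x v t. x \<in> topspace (bgn_topology E k) \<and> v \<in> topspace (bgn_topology E k)}"
  by (auto simp: topspace_pullback_topology)

lemma Nd_in_topspace [simp]:
  "Nd x v t \<in> topspace (bgn_topology E (Suc k)) \<longleftrightarrow>
     x \<in> topspace (bgn_topology E k) \<and> v \<in> topspace (bgn_topology E k)"
  unfolding topspace_bgn_Suc by blast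

declare bgn_topology.simps [simp del]

lemma tvs_bgn:
  fixes E :: "'a tvs"
  assumes "tvs E" shows "tvs (bgn_tvs E k)"
proof (induction k)
  case 0
  interpret E: tvs E by fact
  show ?case
    by (rule tvs_transport[OF assms, of _ "range Pt" bgn_base Pt])
      (auto simp: bgn_topology.simps(1) topspace_pullback_topology E.topspace_tvs)
next
  case (Suc k)
  interpret K: tvs "bgn_tvs E k" by fact
  let ?P = "tvs_prod (bgn_tvs E k) (tvs_prod (bgn_tvs E k) real_tvs)"
  have "tvs ?P" by (intro tvs_prod Suc tvs_real)
  then show ?case
    by (rule tvs_transport[where A = "{Nd x v t |x v t. True}" and h = "\<lambda>p. (bgn_pos p, bgn_dir p, bgn_par p)"
          and g = "\<lambda>(x, v, t). Nd x v t"])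
      (auto simp: bgn_topology.simps(2) topspace_pullback_topology)
qed

lemma continuous_map_Nd:
  "continuous_map T (bgn_topology E (Suc k)) (\<lambda>x. Nd (a x) (b x) (c x)) \<longleftrightarrow>
     continuous_map T (bgn_topology E k) a \<and> continuous_map T (bgn_topology E k) b \<and>
     continuous_map T euclideanreal c" (is "?L \<longleftrightarrow> ?R")
proof
  let ?h = "\<lambda>p. (bgn_pos p, bgn_dir p, bgn_par p)"
  assume L: ?L
  have "continuous_map (bgn_topology E (Suc k))
      (prod_topology (bgn_topology E k) (prod_topology (bgn_topology E k) euclideanreal)) (id \<circ> ?h)"
    unfolding bgn_topology.simps by (intro continuous_map_pullback continuous_map_id)
  from continuous_map_compose[OF L this]
  show ?R by (simp add: o_def continuous_map_paired)
next
  assume ?R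
  then show ?L
    unfolding bgn_topology.simps by (intro continuous_map_pullback') (auto simp: o_def continuous_map_paired)
qed

lemma bgn_Suc_cases:
  assumes "p \<in> topspace (bgn_topology E (Suc k))" obtains x v t where "p = Nd x v t"
  using assms unfolding topspace_bgn_Suc by blast

lemma continuous_map_pos: "continuous_map (bgn_topology E (Suc k)) (bgn_topology E k) bgn_pos"
  and continuous_map_dir: "continuous_map (bgn_topology E (Suc k)) (bgn_topology E k) bgn_dir"
  and continuous_map_par: "continuous_map (bgn_topology E (Suc k)) euclideanreal bgn_par"
proof -
  have "continuous_map (bgn_topology E (Suc k)) (bgn_topology E (Suc k)) (\<lambda>p. Nd (bgn_pos p) (bgn_dir p) (bgn_par p))"
    by (rule continuous_map_eq[OF continuous_map_id]) (auto simp: topspace_bgn_Suc)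
  then show "continuous_map (bgn_topology E (Suc k)) (bgn_topology E k) bgn_pos"
    "continuous_map (bgn_topology E (Suc k)) (bgn_topology E k) bgn_dir"
    "continuous_map (bgn_topology E (Suc k)) euclideanreal bgn_par"
    by (simp_all add: continuous_map_Nd)
qed

lemma continuous_map_Pt:
  "continuous_map T (bgn_topology E 0) (\<lambda>x. Pt (f x)) \<longleftrightarrow> continuous_map T (tvs_topology E) f"
proof
  assume L: "continuous_map T (bgn_topology E 0) (\<lambda>x. Pt (f x))"
  have "continuous_map (bgn_topology E 0) (tvs_topology E) (id \<circ> bgn_base)"
    unfolding bgn_topology.simps by (intro continuous_map_pullback continuous_map_id)
  from continuous_map_compose[OF L this] show "continuous_map T (tvs_topology E) f" by (simp add: o_def)
next
  assume "continuous_map T (tvs_topology E) f"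
  then show "continuous_map T (bgn_topology E 0) (\<lambda>x. Pt (f x))"
    unfolding bgn_topology.simps by (intro continuous_map_pullback') (auto simp: o_def)
qed

lemma continuous_map_base: "continuous_map (bgn_topology E 0) (tvs_topology E) bgn_base"
proof -
  have "continuous_map (bgn_topology E 0) (tvs_topology E) (id \<circ> bgn_base)"
    unfolding bgn_topology.simps by (intro continuous_map_pullback continuous_map_id)
  then show ?thesis by simp
qed


section \<open>Differential calculus on subsets of the iterated spaces\<close>

text \<open>For locality one needs open sets that are not iterates \<open>bgn_dom E U j\<close>; therefore
  \<open>Ck E F k j A g\<close> says that \<open>g\<close> is \<open>C\<^sup>k\<close> on an arbitrary subset \<open>A\<close> of the \<open>j\<close>-th iterated space. The
  point \<open>x + t v\<close> belonging to \<open>p = (x, v, t)\<close> is \<open>bgn_shift E p\<close>, and \<open>bgn_ext E j A\<close> is \<open>A\<^sup>[\<^sup>1\<^sup>]\<close>.\<close>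

definition bgn_shift :: "'a tvs \<Rightarrow> 'a bgn \<Rightarrow> 'a bgn" where
  "bgn_shift E p = bgn_add E (bgn_pos p) (bgn_smult E (bgn_par p) (bgn_dir p))"

definition bgn_ext :: "'a tvs \<Rightarrow> nat \<Rightarrow> 'a bgn set \<Rightarrow> 'a bgn set" where
  "bgn_ext E j A = {p \<in> topspace (bgn_topology E (Suc j)). bgn_pos p \<in> A \<and> bgn_shift E p \<in> A}"

primrec Ck :: "'a tvs \<Rightarrow> 'b tvs \<Rightarrow> nat \<Rightarrow> nat \<Rightarrow> 'a bgn set \<Rightarrow> ('a bgn \<Rightarrow> 'b) \<Rightarrow> bool" where
  "Ck E F 0 j A g \<longleftrightarrow> continuous_map (subtopology (bgn_topology E j) A) (tvs_topology F) g"
| "Ck E F (Suc k) j A g \<longleftrightarrow> continuous_map (subtopology (bgn_topology E j) A) (tvs_topology F) g \<and>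
     (\<exists>g1. (\<forall>p\<in>bgn_ext E j A. g (bgn_shift E p) = g (bgn_pos p) \<oplus>\<^bsub>F\<^esub> bgn_par p \<odot>\<^bsub>F\<^esub> g1 p) \<and>
           Ck E F k (Suc j) (bgn_ext E j A) g1)"

abbreviation bgn_space :: "'a tvs \<Rightarrow> nat \<Rightarrow> 'a bgn set" where
  "bgn_space E j \<equiv> topspace (bgn_topology E j)"

lemma bgn_ext_subset: "bgn_ext E j A \<subseteq> bgn_space E (Suc j)"
  by (auto simp: bgn_ext_def)

lemma bgn_ext_D: "p \<in> bgn_ext E j A \<Longrightarrow> bgn_pos p \<in> A \<and> bgn_shift E p \<in> A \<and> bgn_dir p \<in> bgn_space E j"
  unfolding bgn_ext_def by (auto simp: topspace_bgn_Suc)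

lemma bgn_ext_mono: "A \<subseteq> B \<Longrightarrow> bgn_ext E j A \<subseteq> bgn_ext E j B"
  by (auto simp: bgn_ext_def)

lemma bgn_dom_subset:
  assumes "tvs E" "U \<subseteq> carrier E" shows "bgn_dom E U j \<subseteq> bgn_space E j"
  by (induction j) (use assms in \<open>auto simp: topspace_bgn_0\<close>)

lemma bgn_dom_Suc_ext:
  assumes "tvs E" "U \<subseteq> carrier E" shows "bgn_dom E U (Suc j) = bgn_ext E j (bgn_dom E U j)"
proof (intro equalityI subsetI)
  fix p assume "p \<in> bgn_dom E U (Suc j)"
  then show "p \<in> bgn_ext E j (bgn_dom E U j)"
    using bgn_dom_subset[OF assms, of j] by (auto simp: bgn_ext_def bgn_shift_def)
next
  fix p assume p: "p \<in> bgn_ext E j (bgn_dom E U j)"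
  then obtain x v t where xvt: "p = Nd x v t" using bgn_ext_subset by (metis bgn_Suc_cases subsetD)
  show "p \<in> bgn_dom E U (Suc j)" using p unfolding xvt bgn_ext_def bgn_shift_def by simp
qed

lemma Ck_continuous: "Ck E F k j A g \<Longrightarrow> continuous_map (subtopology (bgn_topology E j) A) (tvs_topology F) g"
  by (cases k) auto

lemma Ck_carrier: "tvs F \<Longrightarrow> Ck E F k j A g \<Longrightarrow> A \<subseteq> bgn_space E j \<Longrightarrow> x \<in> A \<Longrightarrow> g x \<in> carrier F"
  by (rule tvs.continuous_map_carrier[OF _ Ck_continuous]) auto

text \<open>Apart from the larger choice of domains the definitions differ only in the position of the subtracted
  term.\<close>

lemma bgn_C_iff_Ck:
  assumes "tvs E" "tvs F" "U \<subseteq> carrier E"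
  shows "bgn_C E F U k j g \<longleftrightarrow> Ck E F k j (bgn_dom E U j) g"
proof (induction k arbitrary: j g)
  case (Suc k)
  interpret F: tvs F by fact
  have iff: "(\<forall>x v t. Nd x v t \<in> bgn_dom E U (Suc j) \<longrightarrow>
           g (bgn_add E x (bgn_smult E t v)) \<ominus>\<^bsub>F\<^esub> g x = t \<odot>\<^bsub>F\<^esub> g1 (Nd x v t)) \<longleftrightarrow>
        (\<forall>p\<in>bgn_ext E j (bgn_dom E U j). g (bgn_shift E p) = g (bgn_pos p) \<oplus>\<^bsub>F\<^esub> bgn_par p \<odot>\<^bsub>F\<^esub> g1 p)"
    if g: "continuous_map (subtopology (bgn_topology E j) (bgn_dom E U j)) (tvs_topology F) g"
      and g1: "Ck E F k (Suc j) (bgn_ext E j (bgn_dom E U j)) g1" for g1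
  proof -
    have gC: "g x \<in> carrier F" if "x \<in> bgn_dom E U j" for x
      using F.continuous_map_carrier[OF g] that bgn_dom_subset[OF assms(1,3)] by auto
    have g1C: "g1 p \<in> carrier F" if "p \<in> bgn_ext E j (bgn_dom E U j)" for p
      using Ck_carrier[OF assms(2) g1 bgn_ext_subset that] .
    have eq: "g (bgn_add E x (bgn_smult E t v)) \<ominus>\<^bsub>F\<^esub> g x = t \<odot>\<^bsub>F\<^esub> g1 (Nd x v t) \<longleftrightarrow>
      g (bgn_shift E (Nd x v t)) = g x \<oplus>\<^bsub>F\<^esub> t \<odot>\<^bsub>F\<^esub> g1 (Nd x v t)"
      if "Nd x v t \<in> bgn_ext E j (bgn_dom E U j)" for x v t
    proof -
      have "x \<in> bgn_dom E U j" "bgn_add E x (bgn_smult E t v) \<in> bgn_dom E U j"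
        using bgn_ext_D[OF that] by (auto simp: bgn_shift_def)
      then show ?thesis
        using gC g1C[OF that] F.scale_closed by (simp add: bgn_shift_def F.add_eq_iff_minus)
    qed
    show ?thesis (is "?L \<longleftrightarrow> ?R")
    proof
      assume L: ?L
      show ?R
      proof
        fix p assume p: "p \<in> bgn_ext E j (bgn_dom E U j)"
        then obtain x v t where xvt: "p = Nd x v t"
          using bgn_ext_subset by (metis bgn_Suc_cases subsetD)
        show "g (bgn_shift E p) = g (bgn_pos p) \<oplus>\<^bsub>F\<^esub> bgn_par p \<odot>\<^bsub>F\<^esub> g1 p"
          using L p eq unfolding xvt bgn_dom_Suc_ext[OF assms(1,3)] by auto
      qed
    next
      assume ?R
      then show ?L using eq unfolding bgn_dom_Suc_ext[OF assms(1,3)] by fastforce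
    qed
  qed
  note ext = bgn_dom_Suc_ext[OF assms(1,3)]
  show ?case
  proof
    assume "bgn_C E F U (Suc k) j g"
    then obtain g1 where c: "continuous_map (subtopology (bgn_topology E j) (bgn_dom E U j)) (tvs_topology F) g"
      and e: "\<forall>x v t. Nd x v t \<in> bgn_dom E U (Suc j) \<longrightarrow>
           g (bgn_add E x (bgn_smult E t v)) \<ominus>\<^bsub>F\<^esub> g x = t \<odot>\<^bsub>F\<^esub> g1 (Nd x v t)"
      and "bgn_C E F U k (Suc j) g1"
      unfolding bgn_C.simps by (elim conjE exE)
    then have d: "Ck E F k (Suc j) (bgn_ext E j (bgn_dom E U j)) g1" unfolding Suc.IH ext by simp
    show "Ck E F (Suc k) j (bgn_dom E U j) g"
      unfolding Ck.simps using e unfolding iff[OF c d] by (intro conjI exI[of _ g1] c d)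
  next
    assume "Ck E F (Suc k) j (bgn_dom E U j) g"
    then obtain g1 where c: "continuous_map (subtopology (bgn_topology E j) (bgn_dom E U j)) (tvs_topology F) g"
      and e: "\<forall>p\<in>bgn_ext E j (bgn_dom E U j). g (bgn_shift E p) = g (bgn_pos p) \<oplus>\<^bsub>F\<^esub> bgn_par p \<odot>\<^bsub>F\<^esub> g1 p"
      and d: "Ck E F k (Suc j) (bgn_ext E j (bgn_dom E U j)) g1"
      unfolding Ck.simps by (elim conjE exE)
    from d have d': "bgn_C E F U k (Suc j) g1" unfolding Suc.IH ext .
    show "bgn_C E F U (Suc k) j g"
      unfolding bgn_C.simps using e unfolding iff[OF c d, symmetric] by (intro conjI exI[of _ g1] c d')
  qed
qed simp

lemma Ck_subset: "Ck E F k j A g \<Longrightarrow> B \<subseteq> A \<Longrightarrow> Ck E F k j B g"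
proof (induction k arbitrary: j A B g)
  case 0
  then show ?case by (auto intro: continuous_map_from_subtopology_mono)
next
  case (Suc k)
  then obtain g1 where g1: "\<forall>p\<in>bgn_ext E j A. g (bgn_shift E p) = g (bgn_pos p) \<oplus>\<^bsub>F\<^esub> bgn_par p \<odot>\<^bsub>F\<^esub> g1 p"
    "Ck E F k (Suc j) (bgn_ext E j A) g1" by auto
  have "Ck E F k (Suc j) (bgn_ext E j B) g1"
    using Suc.IH[OF g1(2)] bgn_ext_mono[OF Suc.prems(2)] by auto
  then show ?case
    using Suc.prems g1(1) bgn_ext_mono[OF Suc.prems(2), of E j]
    by (auto intro!: exI[of _ g1] intro: continuous_map_from_subtopology_mono)
qed

lemma Ck_cong: "Ck E F k j A g \<Longrightarrow> (\<And>x. x \<in> A \<Longrightarrow> g x = h x) \<Longrightarrow> Ck E F k j A h"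
proof (induction k arbitrary: j A g h)
  case 0
  then show ?case by (auto elim!: continuous_map_eq)
next
  case (Suc k)
  then obtain g1 where g1: "\<forall>p\<in>bgn_ext E j A. g (bgn_shift E p) = g (bgn_pos p) \<oplus>\<^bsub>F\<^esub> bgn_par p \<odot>\<^bsub>F\<^esub> g1 p"
    "Ck E F k (Suc j) (bgn_ext E j A) g1" by auto
  have "continuous_map (subtopology (bgn_topology E j) A) (tvs_topology F) h"
    using Ck_continuous[OF Suc.prems(1)] by (rule continuous_map_eq) (use Suc.prems(2) in auto)
  moreover have "\<forall>p\<in>bgn_ext E j A. h (bgn_shift E p) = h (bgn_pos p) \<oplus>\<^bsub>F\<^esub> bgn_par p \<odot>\<^bsub>F\<^esub> g1 p"
    using g1(1) Suc.prems(2) bgn_ext_D by metis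
  ultimately show ?case using g1(2) by auto
qed

lemma CkI:
  assumes "continuous_map (subtopology (bgn_topology E j) A) (tvs_topology F) g"
    and "\<And>p. p \<in> bgn_ext E j A \<Longrightarrow> g (bgn_shift E p) = g (bgn_pos p) \<oplus>\<^bsub>F\<^esub> bgn_par p \<odot>\<^bsub>F\<^esub> g1 p"
    and "Ck E F k (Suc j) (bgn_ext E j A) g1"
  shows "Ck E F (Suc k) j A g"
  using assms by auto

lemma CkE:
  assumes "Ck E F (Suc k) j A g"
  obtains g1 where "\<And>p. p \<in> bgn_ext E j A \<Longrightarrow> g (bgn_shift E p) = g (bgn_pos p) \<oplus>\<^bsub>F\<^esub> bgn_par p \<odot>\<^bsub>F\<^esub> g1 p"
    and "Ck E F k (Suc j) (bgn_ext E j A) g1"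
  using assms by auto


lemma Ck_Suc_imp: "Ck E F (Suc k) j A g \<Longrightarrow> Ck E F k j A g"
proof (induction k arbitrary: j A g)
  case 0
  then show ?case using Ck_continuous by simp
next
  case (Suc k)
  obtain g1 where g1: "\<And>p. p \<in> bgn_ext E j A \<Longrightarrow> g (bgn_shift E p) = g (bgn_pos p) \<oplus>\<^bsub>F\<^esub> bgn_par p \<odot>\<^bsub>F\<^esub> g1 p"
    "Ck E F (Suc k) (Suc j) (bgn_ext E j A) g1" using Suc.prems by (rule CkE) blast
  show ?case using Ck_continuous[OF Suc.prems] g1(1) Suc.IH[OF g1(2)] by (rule CkI)
qed


subsection \<open>Linear maps\<close>

definition clin :: "'a tvs \<Rightarrow> 'b tvs \<Rightarrow> ('a \<Rightarrow> 'b) \<Rightarrow> bool" where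
  "clin E F L \<longleftrightarrow> continuous_map (tvs_topology E) (tvs_topology F) L \<and>
     (\<forall>x\<in>carrier E. \<forall>y\<in>carrier E. L (x \<oplus>\<^bsub>E\<^esub> y) = L x \<oplus>\<^bsub>F\<^esub> L y) \<and>
     (\<forall>a. \<forall>x\<in>carrier E. L (a \<odot>\<^bsub>E\<^esub> x) = a \<odot>\<^bsub>F\<^esub> L x)"

lemma clin_pos: "clin (bgn_tvs E (Suc j)) (bgn_tvs E j) bgn_pos"
  and clin_dir: "clin (bgn_tvs E (Suc j)) (bgn_tvs E j) bgn_dir"
  and clin_par: "clin (bgn_tvs E (Suc j)) real_tvs bgn_par"
  by (auto simp: clin_def continuous_map_pos continuous_map_dir continuous_map_par topspace_bgn_Suc)

lemma clin_shift:
  assumes "tvs E" "clin (bgn_tvs E j) F L" "p \<in> bgn_space E (Suc j)"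
  shows "L (bgn_shift E p) = L (bgn_pos p) \<oplus>\<^bsub>F\<^esub> bgn_par p \<odot>\<^bsub>F\<^esub> L (bgn_dir p)"
proof -
  interpret J: tvs "bgn_tvs E j" using assms(1) by (rule tvs_bgn)
  obtain x v t where p: "p = Nd x v t" using assms(3) by (rule bgn_Suc_cases)
  show ?thesis
    using assms(2,3) J.scale_closed unfolding p by (auto simp: clin_def bgn_shift_def)
qed

lemma Ck_const:
  assumes "tvs F" "c \<in> carrier F" shows "Ck E F k j A (\<lambda>_. c)"
  using assms(2)
proof (induction k arbitrary: j A c)
  case 0
  then show ?case using tvs.topspace_tvs[OF assms(1)] by simp
next
  case (Suc k)
  interpret F: tvs F by fact
  show ?case
    by (rule CkI[where ?g1.0 = "\<lambda>_. \<zero>\<^bsub>F\<^esub>"])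
      (use Suc F.topspace_tvs F.zero_closed F.scale_zero_right in auto)
qed

lemma Ck_post_linear:
  assumes "clin F F' L" "tvs F" "A \<subseteq> bgn_space E j"
  shows "Ck E F k j A g \<Longrightarrow> Ck E F' k j A (\<lambda>x. L (g x))"
  using assms(3)
proof (induction k arbitrary: j A g)
  case 0
  then show ?case using assms(1) continuous_map_compose[of _ _ g _ L] by (auto simp: clin_def o_def)
next
  case (Suc k)
  interpret F: tvs F by fact
  obtain g1 where g1: "\<And>p. p \<in> bgn_ext E j A \<Longrightarrow> g (bgn_shift E p) = g (bgn_pos p) \<oplus>\<^bsub>F\<^esub> bgn_par p \<odot>\<^bsub>F\<^esub> g1 p"
    "Ck E F k (Suc j) (bgn_ext E j A) g1" using Suc.prems(1) by (rule CkE) blast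
  show ?case
  proof (rule CkI)
    show "continuous_map (subtopology (bgn_topology E j) A) (tvs_topology F') (\<lambda>x. L (g x))"
      using continuous_map_compose[OF Ck_continuous[OF Suc.prems(1)], of _ L] assms(1)
      by (auto simp: clin_def o_def)
    show "Ck E F' k (Suc j) (bgn_ext E j A) (\<lambda>x. L (g1 x))"
      using g1(2) bgn_ext_subset by (rule Suc.IH)
    fix p assume p: "p \<in> bgn_ext E j A"
    have "g (bgn_pos p) \<in> carrier F" "g1 p \<in> carrier F"
      using Ck_carrier[OF assms(2) Suc.prems] Ck_carrier[OF assms(2) g1(2) bgn_ext_subset p] bgn_ext_D[OF p]
      by auto
    then show "L (g (bgn_shift E p)) = L (g (bgn_pos p)) \<oplus>\<^bsub>F'\<^esub> bgn_par p \<odot>\<^bsub>F'\<^esub> L (g1 p)"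
      using assms(1) F.scale_closed unfolding g1(1)[OF p] by (auto simp: clin_def)
  qed
qed

text \<open>The difference quotient of a linear map \<open>L\<close> at \<open>(x, v, t)\<close> is \<open>L v\<close>, which is linear in the point
  \<open>(x, v, t)\<close> of the next iterated space.\<close>

lemma Ck_linear:
  assumes "tvs E" "clin (bgn_tvs E j) F L" "A \<subseteq> bgn_space E j"
  shows "Ck E F k j A L"
  using assms(2,3)
proof (induction k arbitrary: j A L)
  case 0
  then show ?case by (auto simp: clin_def continuous_map_from_subtopology)
next
  case (Suc k)
  show ?case
  proof (rule CkI)
    show "continuous_map (subtopology (bgn_topology E j) A) (tvs_topology F) L"
      using Suc.prems by (auto simp: clin_def continuous_map_from_subtopology)
    have "clin (bgn_tvs E (Suc j)) F (\<lambda>p. L (bgn_dir p))"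
      using Suc.prems(1) clin_dir[of E j] continuous_map_compose[of _ _ bgn_dir _ L]
      by (auto simp: clin_def o_def topspace_bgn_Suc)
    then show "Ck E F k (Suc j) (bgn_ext E j A) (\<lambda>p. L (bgn_dir p))"
      using bgn_ext_subset by (rule Suc.IH)
    show "L (bgn_shift E p) = L (bgn_pos p) \<oplus>\<^bsub>F\<^esub> bgn_par p \<odot>\<^bsub>F\<^esub> L (bgn_dir p)" if "p \<in> bgn_ext E j A" for p
      using that bgn_ext_subset clin_shift[OF assms(1) Suc.prems(1)] by blast
  qed
qed

text \<open>A linear substitution \<open>L\<close> induces the linear substitution \<open>(L x, L v, t)\<close> on the next iterated space. Being
  independent of the chain rule, this serves in its proof for the substitution \<open>(x, v, t) \<mapsto> x\<close>.\<close>

lemma Ck_pre_linear: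
  assumes "tvs E" "Ck E' F k i B g" "clin (bgn_tvs E j) (bgn_tvs E' i) L" "L ` A \<subseteq> B" "A \<subseteq> bgn_space E j"
  shows "Ck E F k j A (\<lambda>x. g (L x))"
  using assms(2-)
proof (induction k arbitrary: i j A B g L)
  case 0
  have "continuous_map (subtopology (bgn_topology E j) A) (subtopology (bgn_topology E' i) B) L"
    using 0 by (auto simp: clin_def continuous_map_in_subtopology continuous_map_from_subtopology)
  from continuous_map_compose[OF this] 0(1) show ?case by (simp add: o_def)
next
  case (Suc k)
  obtain g1 where g1: "\<And>p. p \<in> bgn_ext E' i B \<Longrightarrow> g (bgn_shift E' p) = g (bgn_pos p) \<oplus>\<^bsub>F\<^esub> bgn_par p \<odot>\<^bsub>F\<^esub> g1 p"
    "Ck E' F k (Suc i) (bgn_ext E' i B) g1" using Suc.prems(1) by (rule CkE) blast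
  let ?L = "\<lambda>p. Nd (L (bgn_pos p)) (L (bgn_dir p)) (bgn_par p)"
  have L_space: "L x \<in> bgn_space E' i" if "x \<in> bgn_space E j" for x
    using Suc.prems(2) that by (auto simp: clin_def continuous_map_def)
  have shift: "bgn_shift E' (?L p) = L (bgn_shift E p)" if "p \<in> bgn_space E (Suc j)" for p
    using clin_shift[OF assms(1) Suc.prems(2) that] by (simp add: bgn_shift_def)
  have ext: "?L ` bgn_ext E j A \<subseteq> bgn_ext E' i B"
  proof
    fix q assume "q \<in> ?L ` bgn_ext E j A"
    then obtain p where p: "p \<in> bgn_ext E j A" "q = ?L p" by blast
    then have "p \<in> bgn_space E (Suc j)" using bgn_ext_subset by blast
    then show "q \<in> bgn_ext E' i B"
      using bgn_ext_D[OF p(1)] Suc.prems(3,4) shift[of p] L_space unfolding p(2) bgn_ext_def by auto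
  qed
  have L_cont: "continuous_map (bgn_topology E j) (bgn_topology E' i) L"
    using Suc.prems(2) by (simp add: clin_def)
  have "continuous_map (bgn_topology E (Suc j)) (bgn_topology E' (Suc i)) ?L"
    unfolding continuous_map_Nd
    using continuous_map_compose[OF continuous_map_pos L_cont] continuous_map_compose[OF continuous_map_dir L_cont]
      continuous_map_par[of E j] by (simp add: o_def)
  then have lin: "clin (bgn_tvs E (Suc j)) (bgn_tvs E' (Suc i)) ?L"
    using Suc.prems(2) by (auto simp: clin_def topspace_bgn_Suc)
  show ?case
  proof (rule CkI)
    have "continuous_map (subtopology (bgn_topology E j) A) (subtopology (bgn_topology E' i) B) L"
      using Suc.prems by (auto simp: clin_def continuous_map_in_subtopology continuous_map_from_subtopology)
    from continuous_map_compose[OF this Ck_continuous[OF Suc.prems(1)]]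
    show "continuous_map (subtopology (bgn_topology E j) A) (tvs_topology F) (\<lambda>x. g (L x))" by (simp add: o_def)
    show "Ck E F k (Suc j) (bgn_ext E j A) (\<lambda>p. g1 (?L p))"
      using Suc.IH[OF g1(2) lin ext bgn_ext_subset] .
    fix p assume p: "p \<in> bgn_ext E j A"
    then have "?L p \<in> bgn_ext E' i B" using ext by blast
    from g1(1)[OF this] show "g (L (bgn_shift E p)) = g (L (bgn_pos p)) \<oplus>\<^bsub>F\<^esub> bgn_par p \<odot>\<^bsub>F\<^esub> g1 (?L p)"
      using shift[OF subsetD[OF bgn_ext_subset p]] by simp
  qed
qed

lemma Ck_pos:
  assumes "tvs E" "Ck E F k j A g" shows "Ck E F k (Suc j) (bgn_ext E j A) (\<lambda>p. g (bgn_pos p))"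
  using assms clin_pos bgn_ext_D by (intro Ck_pre_linear[OF assms(1,2)]) (auto simp: bgn_ext_def)


subsection \<open>Maps into products\<close>

lemma Ck_pair:
  assumes "Ck E F k j A f" "Ck E F' k j A g"
  shows "Ck E (tvs_prod F F') k j A (\<lambda>x. (f x, g x))"
  using assms
proof (induction k arbitrary: j A f g)
  case 0
  then show ?case by (simp add: continuous_map_paired)
next
  case (Suc k)
  obtain f1 where f1: "\<And>p. p \<in> bgn_ext E j A \<Longrightarrow> f (bgn_shift E p) = f (bgn_pos p) \<oplus>\<^bsub>F\<^esub> bgn_par p \<odot>\<^bsub>F\<^esub> f1 p"
    "Ck E F k (Suc j) (bgn_ext E j A) f1" using Suc.prems(1) by (rule CkE) blast
  obtain g1 where g1: "\<And>p. p \<in> bgn_ext E j A \<Longrightarrow> g (bgn_shift E p) = g (bgn_pos p) \<oplus>\<^bsub>F'\<^esub> bgn_par p \<odot>\<^bsub>F'\<^esub> g1 p"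
    "Ck E F' k (Suc j) (bgn_ext E j A) g1" using Suc.prems(2) by (rule CkE) blast
  show ?case
    by (rule CkI[where ?g1.0 = "\<lambda>p. (f1 p, g1 p)"])
      (use f1 g1 Suc in \<open>auto simp: continuous_map_paired\<close>)
qed

lemma Ck_Nd:
  assumes "tvs E" "tvs F" "A \<subseteq> bgn_space E j"
    and "Ck E (bgn_tvs F i) k j A a" "Ck E (bgn_tvs F i) k j A b" "Ck E real_tvs k j A c"
  shows "Ck E (bgn_tvs F (Suc i)) k j A (\<lambda>x. Nd (a x) (b x) (c x))"
proof -
  let ?P = "tvs_prod (bgn_tvs F i) (tvs_prod (bgn_tvs F i) real_tvs)"
  let ?L = "\<lambda>p. Nd (fst p) (fst (snd p)) (snd (snd p))"
  have P: "tvs ?P" by (intro tvs_prod tvs_bgn tvs_real assms)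
  have "continuous_map (tvs_topology ?P) (tvs_topology (bgn_tvs F (Suc i))) ?L"
    unfolding bgn_tvs_simps tvs_prod_simps real_tvs_simps continuous_map_Nd
    by (intro conjI continuous_map_fst continuous_map_compose[OF continuous_map_snd continuous_map_fst, unfolded o_def]
        continuous_map_compose[OF continuous_map_snd continuous_map_snd, unfolded o_def])
  then have L: "clin ?P (bgn_tvs F (Suc i)) ?L" by (simp add: clin_def)
  have "Ck E ?P k j A (\<lambda>x. (a x, b x, c x))" by (intro Ck_pair assms)
  from Ck_post_linear[OF L P assms(3) this] show ?thesis by simp
qed

lemma Ck_tuple:
  assumes "tvs F" "A \<subseteq> bgn_space E j" "\<And>l. l \<le> q \<Longrightarrow> Ck E F k j A (f l)"
  shows "Ck E (tvs_power F q) k j A (\<lambda>x. \<lambda>l\<in>{..q}. f l x)"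
  using assms(2,3)
proof (induction k arbitrary: j A f)
  case 0
  then show ?case by (auto simp: continuous_map_componentwise extensional_def)
next
  case (Suc k)
  interpret F: tvs F by fact
  have "\<exists>f1. (\<forall>p\<in>bgn_ext E j A. f l (bgn_shift E p) = f l (bgn_pos p) \<oplus>\<^bsub>F\<^esub> bgn_par p \<odot>\<^bsub>F\<^esub> f1 p) \<and>
    Ck E F k (Suc j) (bgn_ext E j A) f1" if "l \<le> q" for l
    using Suc.prems(2)[OF that] by simp
  then obtain f1 where f1: "\<And>l p. l \<le> q \<Longrightarrow> p \<in> bgn_ext E j A \<Longrightarrow>
      f l (bgn_shift E p) = f l (bgn_pos p) \<oplus>\<^bsub>F\<^esub> bgn_par p \<odot>\<^bsub>F\<^esub> f1 l p"
    "\<And>l. l \<le> q \<Longrightarrow> Ck E F k (Suc j) (bgn_ext E j A) (f1 l)" by metis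
  show ?case
  proof (rule CkI[where ?g1.0 = "\<lambda>p. \<lambda>l\<in>{..q}. f1 l p"])
    show "continuous_map (subtopology (bgn_topology E j) A) (tvs_topology (tvs_power F q)) (\<lambda>x. \<lambda>l\<in>{..q}. f l x)"
      using Ck_continuous[OF Suc.prems(2)] by (auto simp: continuous_map_componentwise extensional_def)
    show "Ck E (tvs_power F q) k (Suc j) (bgn_ext E j A) (\<lambda>p. \<lambda>l\<in>{..q}. f1 l p)"
      using f1(2) by (intro Suc.IH[OF bgn_ext_subset]) auto
  qed (use f1(1) in \<open>auto simp: fun_eq_iff restrict_def\<close>)
qed


subsection \<open>The chain rule\<close>

text \<open>If \<open>f(x + t v) = f(x) + t f\<^sup>[\<^sup>1\<^sup>](p)\<close> for \<open>p = (x, v, t)\<close>, then \<open>(f(x), f\<^sup>[\<^sup>1\<^sup>](p), t)\<close> lies in the domain of \<open>g\<^sup>[\<^sup>1\<^sup>]\<close>,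
  and the difference quotient of the composition is \<open>g\<^sup>[\<^sup>1\<^sup>]\<close> at this point. This new inner map has its
  values in the next iterated space; the induction therefore admits any of these spaces as the target of \<open>f\<close>.\<close>

lemma Ck_compose:
  assumes "tvs E" "tvs F"
    and "Ck E (bgn_tvs F i) k j A f" "Ck F G k i B g" "f ` A \<subseteq> B" "A \<subseteq> bgn_space E j"
  shows "Ck E G k j A (\<lambda>x. g (f x))"
  using assms(3-)
proof (induction k arbitrary: i j A B f g)
  case 0
  have "continuous_map (subtopology (bgn_topology E j) A) (subtopology (bgn_topology F i) B) f"
    using 0 by (auto simp: continuous_map_in_subtopology)
  from continuous_map_compose[OF this] 0(2) show ?case by (simp add: o_def)
next
  case (Suc k)
  interpret Fi: tvs "bgn_tvs F i" using assms(2) by (rule tvs_bgn)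
  obtain f1 where f1: "\<And>p. p \<in> bgn_ext E j A \<Longrightarrow>
      f (bgn_shift E p) = bgn_add F (f (bgn_pos p)) (bgn_smult F (bgn_par p) (f1 p))"
    "Ck E (bgn_tvs F i) k (Suc j) (bgn_ext E j A) f1" using CkE[OF Suc.prems(1), unfolded bgn_tvs_simps] by blast
  obtain g1 where g1: "\<And>p. p \<in> bgn_ext F i B \<Longrightarrow> g (bgn_shift F p) = g (bgn_pos p) \<oplus>\<^bsub>G\<^esub> bgn_par p \<odot>\<^bsub>G\<^esub> g1 p"
    "Ck F G k (Suc i) (bgn_ext F i B) g1" using Suc.prems(2) by (rule CkE) blast
  let ?T = "\<lambda>p. Nd (f (bgn_pos p)) (f1 p) (bgn_par p)"
  have ext: "?T ` bgn_ext E j A \<subseteq> bgn_ext F i B"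
  proof
    fix q assume "q \<in> ?T ` bgn_ext E j A"
    then obtain p where p: "p \<in> bgn_ext E j A" "q = ?T p" by blast
    have "f (bgn_pos p) \<in> bgn_space F i" "f1 p \<in> bgn_space F i"
      using Ck_carrier[OF Fi.tvs_axioms Suc.prems(1,4), of "bgn_pos p"]
        Ck_carrier[OF Fi.tvs_axioms f1(2) bgn_ext_subset p(1)] bgn_ext_D[OF p(1)]
      by auto
    then show "q \<in> bgn_ext F i B"
      using bgn_ext_D[OF p(1)] f1(1)[OF p(1)] Suc.prems(3) unfolding p(2) bgn_ext_def bgn_shift_def by force
  qed
  show ?case
  proof (rule CkI)
    have "continuous_map (subtopology (bgn_topology E j) A) (subtopology (bgn_topology F i) B) f"
      using Ck_continuous[OF Suc.prems(1)] Suc.prems by (auto simp: continuous_map_in_subtopology)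
    from continuous_map_compose[OF this Ck_continuous[OF Suc.prems(2)]]
    show "continuous_map (subtopology (bgn_topology E j) A) (tvs_topology G) (\<lambda>x. g (f x))" by (simp add: o_def)
    have "Ck E (bgn_tvs F (Suc i)) k (Suc j) (bgn_ext E j A) ?T"
      using f1(2) Ck_pos[OF assms(1) Ck_Suc_imp[OF Suc.prems(1)]]
        Ck_linear[OF assms(1) clin_par bgn_ext_subset]
      by (intro Ck_Nd[OF assms(1,2) bgn_ext_subset])
    then show "Ck E G k (Suc j) (bgn_ext E j A) (\<lambda>p. g1 (?T p))"
      using Suc.IH[OF _ g1(2) ext bgn_ext_subset] by simp
    fix p assume p: "p \<in> bgn_ext E j A"
    then have "?T p \<in> bgn_ext F i B" using ext by blast
    from g1(1)[OF this] show "g (f (bgn_shift E p)) = g (f (bgn_pos p)) \<oplus>\<^bsub>G\<^esub> bgn_par p \<odot>\<^bsub>G\<^esub> g1 (?T p)"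
      using f1(1)[OF p] by (simp add: bgn_shift_def)
  qed
qed


subsection \<open>Algebraic operations\<close>

lemma Ck_add:
  assumes "tvs F" "A \<subseteq> bgn_space E j" "Ck E F k j A f" "Ck E F k j A g"
  shows "Ck E F k j A (\<lambda>x. f x \<oplus>\<^bsub>F\<^esub> g x)"
proof -
  interpret F: tvs F by fact
  have "clin (tvs_prod F F) F (\<lambda>(x, y). x \<oplus>\<^bsub>F\<^esub> y)"
    using F.continuous_add by (auto simp: clin_def F.module.a_ac F.scale_add_right)
  from Ck_post_linear[OF this tvs_prod[OF assms(1,1)] assms(2) Ck_pair[OF assms(3,4)]]
  show ?thesis by simp
qed

lemma Ck_scale:
  assumes "tvs E" "tvs F"
  shows "A \<subseteq> bgn_space E j \<Longrightarrow> Ck E real_tvs k j A a \<Longrightarrow> Ck E F k j A g \<Longrightarrow> Ck E F k j A (\<lambda>x. a x \<odot>\<^bsub>F\<^esub> g x)"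
proof (induction k arbitrary: j A a g)
  case 0
  then show ?case by (auto intro: tvs.continuous_map_scale[OF assms(2)])
next
  case (Suc k)
  interpret F: tvs F by fact
  obtain a1 where a1: "\<And>p. p \<in> bgn_ext E j A \<Longrightarrow> a (bgn_shift E p) = a (bgn_pos p) + bgn_par p * a1 p"
    "Ck E real_tvs k (Suc j) (bgn_ext E j A) a1"
    using CkE[OF Suc.prems(2), unfolded real_tvs_simps] by blast
  obtain g1 where g1: "\<And>p. p \<in> bgn_ext E j A \<Longrightarrow> g (bgn_shift E p) = g (bgn_pos p) \<oplus>\<^bsub>F\<^esub> bgn_par p \<odot>\<^bsub>F\<^esub> g1 p"
    "Ck E F k (Suc j) (bgn_ext E j A) g1" using Suc.prems(3) by (rule CkE) blast
  note pos = Ck_pos[OF assms(1) Ck_Suc_imp[OF Suc.prems(2)]] Ck_pos[OF assms(1) Ck_Suc_imp[OF Suc.prems(3)]]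
  note par = Ck_linear[OF assms(1) clin_par bgn_ext_subset]
  show ?case
  proof (rule CkI)
    show "continuous_map (subtopology (bgn_topology E j) A) (tvs_topology F) (\<lambda>x. a x \<odot>\<^bsub>F\<^esub> g x)"
      using Ck_continuous[OF Suc.prems(2)] Ck_continuous[OF Suc.prems(3)] by (intro F.continuous_map_scale) auto
    \<comment> \<open>\<open>(a + t a\<^sub>1) (g + t g\<^sub>1) = a g + t (a g\<^sub>1 + a\<^sub>1 g + t a\<^sub>1 g\<^sub>1)\<close>\<close>
    let ?h = "\<lambda>p. (a (bgn_pos p) \<odot>\<^bsub>F\<^esub> g1 p \<oplus>\<^bsub>F\<^esub> a1 p \<odot>\<^bsub>F\<^esub> g (bgn_pos p)) \<oplus>\<^bsub>F\<^esub>
       bgn_par p \<odot>\<^bsub>F\<^esub> (a1 p \<odot>\<^bsub>F\<^esub> g1 p)"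
    show "Ck E F k (Suc j) (bgn_ext E j A) ?h"
      by (intro Ck_add[OF assms(2) bgn_ext_subset] Suc.IH bgn_ext_subset pos par a1(2) g1(2))
    fix p assume p: "p \<in> bgn_ext E j A"
    have "g (bgn_pos p) \<in> carrier F" "g1 p \<in> carrier F"
      using Ck_carrier[OF assms(2) Suc.prems(3,1)] Ck_carrier[OF assms(2) g1(2) bgn_ext_subset p] bgn_ext_D[OF p]
      by auto
    then show "a (bgn_shift E p) \<odot>\<^bsub>F\<^esub> g (bgn_shift E p) =
        a (bgn_pos p) \<odot>\<^bsub>F\<^esub> g (bgn_pos p) \<oplus>\<^bsub>F\<^esub> bgn_par p \<odot>\<^bsub>F\<^esub> ?h p"
      unfolding a1(1)[OF p] g1(1)[OF p]
      by (simp add: F.scale_add_left F.scale_add_right F.scale_closed F.add_closed F.scale_assoc[symmetric]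
          F.module.a_ac mult.commute mult.left_commute distrib_left)
  qed
qed

lemma Ck_shift_id:
  assumes "tvs E" "A \<subseteq> bgn_space E (Suc j)"
  shows "Ck E (bgn_tvs E j) k (Suc j) A (bgn_shift E)"
proof -
  have "Ck E (bgn_tvs E j) k (Suc j) A
      (\<lambda>p. bgn_pos p \<oplus>\<^bsub>bgn_tvs E j\<^esub> bgn_par p \<odot>\<^bsub>bgn_tvs E j\<^esub> bgn_dir p)"
    using assms tvs_bgn[OF assms(1)]
    by (intro Ck_add Ck_scale Ck_linear[OF assms(1) _ assms(2)] clin_pos clin_dir clin_par) auto
  then show ?thesis by (simp add: bgn_shift_def[abs_def])
qed

lemma Ck_shift:
  assumes "tvs E" "Ck E F k j B g" "A \<subseteq> bgn_space E (Suc j)" "bgn_shift E ` A \<subseteq> B"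
  shows "Ck E F k (Suc j) A (\<lambda>p. g (bgn_shift E p))"
  using Ck_compose[OF assms(1,1) Ck_shift_id[OF assms(1,3)] assms(2,4,3)] .

lemma Ck_inverse:
  assumes "tvs E"
  shows "A \<subseteq> bgn_space E j \<Longrightarrow> Ck E real_tvs k j A r \<Longrightarrow> (\<And>x. x \<in> A \<Longrightarrow> r x \<noteq> 0) \<Longrightarrow>
    Ck E real_tvs k j A (\<lambda>x. inverse (r x))"
proof (induction k arbitrary: j A r)
  case 0
  then show ?case by (auto intro!: continuous_map_real_inverse)
next
  case (Suc k)
  obtain r1 where r1: "\<And>p. p \<in> bgn_ext E j A \<Longrightarrow> r (bgn_shift E p) = r (bgn_pos p) + bgn_par p * r1 p"
    "Ck E real_tvs k (Suc j) (bgn_ext E j A) r1"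
    using CkE[OF Suc.prems(2), unfolded real_tvs_simps] by blast
  have "Ck E real_tvs k j A (\<lambda>x. inverse (r x))"
    using Suc.IH[OF Suc.prems(1) Ck_Suc_imp[OF Suc.prems(2)] Suc.prems(3)] .
  note inv_pos = Ck_pos[OF assms this]
  have "Ck E real_tvs k (Suc j) (bgn_ext E j A) (\<lambda>p. r (bgn_shift E p))"
    using bgn_ext_D by (intro Ck_shift[OF assms Ck_Suc_imp[OF Suc.prems(2)] bgn_ext_subset]) blast
  then have inv_shift: "Ck E real_tvs k (Suc j) (bgn_ext E j A) (\<lambda>p. inverse (r (bgn_shift E p)))"
    using Suc.prems(3) bgn_ext_D by (intro Suc.IH bgn_ext_subset) blast+
  show ?case
  proof (rule CkI)
    show "continuous_map (subtopology (bgn_topology E j) A) (tvs_topology real_tvs) (\<lambda>x. inverse (r x))"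
      using Ck_continuous[OF Suc.prems(2)] Suc.prems(3) by (auto intro!: continuous_map_real_inverse)
    \<comment> \<open>\<open>1 / r(y) - 1 / r(x) = - t r\<^sub>1 / (r(x) r(y))\<close> for \<open>y = x + t v\<close>\<close>
    let ?h = "\<lambda>p. (-1) \<odot>\<^bsub>real_tvs\<^esub> (r1 p \<odot>\<^bsub>real_tvs\<^esub> (inverse (r (bgn_pos p)) \<odot>\<^bsub>real_tvs\<^esub> inverse (r (bgn_shift E p))))"
    show "Ck E real_tvs k (Suc j) (bgn_ext E j A) ?h"
      by (intro Ck_scale[OF assms tvs_real] bgn_ext_subset inv_pos inv_shift r1(2) Ck_const[OF tvs_real]) simp
    fix p assume p: "p \<in> bgn_ext E j A"
    have nz: "r (bgn_pos p) \<noteq> 0" "r (bgn_shift E p) \<noteq> 0" using bgn_ext_D[OF p] Suc.prems(3) by auto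
    have diff: "r (bgn_pos p) - r (bgn_shift E p) = - (bgn_par p * r1 p)" using r1(1)[OF p] by linarith
    have "inverse (r (bgn_shift E p)) - inverse (r (bgn_pos p)) =
        inverse (r (bgn_shift E p)) * (- (bgn_par p * r1 p)) * inverse (r (bgn_pos p))"
      using division_ring_inverse_diff[OF nz(2,1)] unfolding diff .
    moreover have "\<dots> = bgn_par p * ((-1) * (r1 p * (inverse (r (bgn_pos p)) * inverse (r (bgn_shift E p)))))"
      by (simp only: mult_minus_left mult_minus_right mult_1_left mult_ac)
    ultimately show "inverse (r (bgn_shift E p)) = inverse (r (bgn_pos p)) \<oplus>\<^bsub>real_tvs\<^esub> bgn_par p \<odot>\<^bsub>real_tvs\<^esub> ?h p"
      unfolding real_tvs_simps by linarith
  qed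
qed


subsection \<open>Locality\<close>

lemma continuous_map_shift: "tvs E \<Longrightarrow> continuous_map (bgn_topology E (Suc j)) (bgn_topology E j) (bgn_shift E)"
  using Ck_continuous[OF Ck_shift_id[where A = "bgn_space E (Suc j)" and k = 0 and j = j and E = E]]
  by (simp del: Ck.simps)

lemma openin_bgn_ext:
  assumes "tvs E" "openin (bgn_topology E j) A"
  shows "openin (bgn_topology E (Suc j)) (bgn_ext E j A)"
proof -
  have "bgn_ext E j A = {p \<in> bgn_space E (Suc j). bgn_pos p \<in> A} \<inter> {p \<in> bgn_space E (Suc j). bgn_shift E p \<in> A}"
    by (auto simp: bgn_ext_def)
  then show ?thesis
    using openin_continuous_map_preimage[OF continuous_map_pos assms(2)]
      openin_continuous_map_preimage[OF continuous_map_shift[OF assms(1)] assms(2)] by auto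
qed

text \<open>At parameter \<open>0\<close> the value of a difference quotient map is the limit of its values at small
  parameters, which the function determines.\<close>

lemma difference_quotient_unique:
  assumes E: "tvs E" and F: "tvs F" and ab: "openin (bgn_topology E j) a" "openin (bgn_topology E j) b"
    and g: "\<And>x. x \<in> a \<Longrightarrow> g x \<in> carrier F"
    and g1: "\<And>p. p \<in> bgn_ext E j a \<Longrightarrow> g (bgn_shift E p) = g (bgn_pos p) \<oplus>\<^bsub>F\<^esub> bgn_par p \<odot>\<^bsub>F\<^esub> g1 p"
      "continuous_map (subtopology (bgn_topology E (Suc j)) (bgn_ext E j a)) (tvs_topology F) g1"
    and h1: "\<And>p. p \<in> bgn_ext E j b \<Longrightarrow> g (bgn_shift E p) = g (bgn_pos p) \<oplus>\<^bsub>F\<^esub> bgn_par p \<odot>\<^bsub>F\<^esub> h1 p"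
      "continuous_map (subtopology (bgn_topology E (Suc j)) (bgn_ext E j b)) (tvs_topology F) h1"
    and p: "p \<in> bgn_ext E j a" "p \<in> bgn_ext E j b"
  shows "g1 p = h1 p"
proof -
  interpret F: tvs F by fact
  have carr: "g1 p \<in> carrier F" if "p \<in> bgn_ext E j a" for p
    using F.continuous_map_carrier[OF g1(2)] that subsetD[OF bgn_ext_subset that] by simp
  have carr': "h1 p \<in> carrier F" if "p \<in> bgn_ext E j b" for p
    using F.continuous_map_carrier[OF h1(2)] that subsetD[OF bgn_ext_subset that] by simp
  have nonzero: "g1 p = h1 p" if p: "p \<in> bgn_ext E j a" "p \<in> bgn_ext E j b" "bgn_par p \<noteq> 0" for p
  proof -
    have "g (bgn_pos p) \<in> carrier F" using g bgn_ext_D[OF p(1)] by blast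
    moreover have "g (bgn_pos p) \<oplus>\<^bsub>F\<^esub> bgn_par p \<odot>\<^bsub>F\<^esub> g1 p = g (bgn_pos p) \<oplus>\<^bsub>F\<^esub> bgn_par p \<odot>\<^bsub>F\<^esub> h1 p"
      using g1(1)[OF p(1)] h1(1)[OF p(2)] by simp
    ultimately have "bgn_par p \<odot>\<^bsub>F\<^esub> g1 p = bgn_par p \<odot>\<^bsub>F\<^esub> h1 p"
      using carr[OF p(1)] carr'[OF p(2)] F.scale_closed by simp
    then show ?thesis using F.scale_inverse_cancel[OF p(3) carr[OF p(1)] carr'[OF p(2)]] by simp
  qed
  show ?thesis
  proof (cases "bgn_par p = 0")
    case False
    then show ?thesis using nonzero p by blast
  next
    case True
    have "p \<in> bgn_space E (Suc j)" using p bgn_ext_subset by blast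
    then obtain x v where xv: "p = Nd x v 0" "x \<in> bgn_space E j" "v \<in> bgn_space E j"
      using True by (auto simp: topspace_bgn_Suc)
    let ?c = "\<lambda>t. Nd x v t"
    have c: "continuous_map euclideanreal (bgn_topology E (Suc j)) ?c"
      using xv by (simp add: continuous_map_Nd)
    \<comment> \<open>Both quotients are defined along the line \<open>t \<mapsto> (x, v, t)\<close> near \<open>0\<close> and agree there for \<open>t \<noteq> 0\<close>.\<close>
    define N where "N = {t. ?c t \<in> bgn_ext E j a \<inter> bgn_ext E j b}"
    have "openin (bgn_topology E (Suc j)) (bgn_ext E j a \<inter> bgn_ext E j b)"
      using openin_bgn_ext[OF E] ab by auto
    from openin_continuous_map_preimage[OF c this] have N: "open N" by (simp add: N_def)
    have cN: "continuous_map (top_of_set N) (subtopology (bgn_topology E (Suc j)) D) ?c"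
      if "D = bgn_ext E j a \<or> D = bgn_ext E j b" for D
      using that continuous_map_from_subtopology[OF c, of N] by (auto simp: continuous_map_in_subtopology N_def)
    have "0 \<in> top_of_set N closure_of (N - {0})"
      unfolding in_closure_of
    proof (intro conjI allI impI)
      show "0 \<in> topspace (top_of_set N)" using p xv(1) by (simp add: N_def)
      fix T assume T: "0 \<in> T \<and> openin (top_of_set N) T"
      then have "open T" "T \<subseteq> N" using N by (simp_all add: openin_open_eq)
      then obtain e where e: "e > 0" "ball 0 e \<subseteq> T" using T open_contains_ball_eq[of T] by blast
      moreover have "e / 2 \<in> ball 0 e" using e(1) by (simp add: dist_real_def)
      ultimately have "e / 2 \<in> T" "e / 2 \<noteq> 0" by auto
      then show "\<exists>y. y \<in> N - {0} \<and> y \<in> T" using \<open>T \<subseteq> N\<close> by blast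
    qed
    moreover have "continuous_map (top_of_set N) (tvs_topology F) (\<lambda>t. g1 (?c t))"
      using continuous_map_compose[OF cN g1(2)] by (simp add: o_def)
    moreover have "continuous_map (top_of_set N) (tvs_topology F) (\<lambda>t. h1 (?c t))"
      using continuous_map_compose[OF cN h1(2)] by (simp add: o_def)
    ultimately have "g1 (?c 0) = h1 (?c 0)"
      by (rule forall_in_closure_of_eq[OF _ F.Hausdorff_tvs]) (auto simp: N_def intro: nonzero)
    then show ?thesis using xv(1) by simp
  qed
qed

lemma continuous_map_open_cover:
  assumes "\<And>a. a \<in> \<A> \<Longrightarrow> openin T a" "\<And>a. a \<in> \<A> \<Longrightarrow> continuous_map (subtopology T a) Y g"
  shows "continuous_map (subtopology T (\<Union>\<A>)) Y g"
proof (rule pasting_lemma[where I = \<A> and T = id and f = "\<lambda>_. g"])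
  fix a assume a: "a \<in> \<A>"
  then have sub: "\<Union>\<A> \<inter> a = a" by blast
  show "openin (subtopology T (\<Union>\<A>)) (id a)"
    using assms(1)[OF a] sub by (auto simp: openin_subtopology)
  show "continuous_map (subtopology (subtopology T (\<Union>\<A>)) (id a)) Y g"
    using assms(2)[OF a] by (simp add: subtopology_subtopology sub)
qed auto

text \<open>Being \<open>C\<^sup>k\<close> is a local property. The domain of the difference quotient of a function on a union of
  open sets is covered by those of its restrictions only near the parameter \<open>0\<close>; away from \<open>0\<close> the
  difference quotient is given by a formula and inherits its differentiability from the function at the two
  points involved, which lie in two possibly different members of the covering.\<close>

lemma Ck_locally:
  assumes E: "tvs E" and F: "tvs F"
  shows "(\<And>a. a \<in> \<A> \<Longrightarrow> openin (bgn_topology E j) a) \<Longrightarrow> (\<And>a. a \<in> \<A> \<Longrightarrow> Ck E F k j a g) \<Longrightarrow>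
    Ck E F k j (\<Union>\<A>) g"
proof (induction k arbitrary: j \<A> g)
  case 0
  show ?case unfolding Ck.simps
  proof (rule continuous_map_open_cover)
    fix a assume "a \<in> \<A>"
    then show "openin (bgn_topology E j) a" by (rule 0(1))
    show "continuous_map (subtopology (bgn_topology E j) a) (tvs_topology F) g"
      using 0(2)[OF \<open>a \<in> \<A>\<close>] unfolding Ck.simps .
  qed
next
  case (Suc k)
  interpret F: tvs F by fact
  let ?A = "\<Union>\<A>"
  have sub: "a \<subseteq> bgn_space E j" if "a \<in> \<A>" for a using openin_subset[OF Suc.prems(1)[OF that]] .
  have gC: "g x \<in> carrier F" if "x \<in> ?A" for x
  proof -
    from that obtain a where a: "a \<in> \<A>" "x \<in> a" by blast
    show ?thesis by (rule Ck_carrier[OF F Suc.prems(2)[OF a(1)] sub[OF a(1)] a(2)])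
  qed
  have "\<exists>g1. (\<forall>p\<in>bgn_ext E j a. g (bgn_shift E p) = g (bgn_pos p) \<oplus>\<^bsub>F\<^esub> bgn_par p \<odot>\<^bsub>F\<^esub> g1 p) \<and>
    Ck E F k (Suc j) (bgn_ext E j a) g1" if "a \<in> \<A>" for a
    using Suc.prems(2)[OF that] unfolding Ck.simps by (rule conjunct2)
  then have "\<forall>a\<in>\<A>. \<exists>g1. (\<forall>p\<in>bgn_ext E j a. g (bgn_shift E p) = g (bgn_pos p) \<oplus>\<^bsub>F\<^esub> bgn_par p \<odot>\<^bsub>F\<^esub> g1 p) \<and>
    Ck E F k (Suc j) (bgn_ext E j a) g1" by blast
  from bchoice[OF this] obtain g1 where g1: "\<And>a p. a \<in> \<A> \<Longrightarrow> p \<in> bgn_ext E j a \<Longrightarrow>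
      g (bgn_shift E p) = g (bgn_pos p) \<oplus>\<^bsub>F\<^esub> bgn_par p \<odot>\<^bsub>F\<^esub> g1 a p"
    "\<And>a. a \<in> \<A> \<Longrightarrow> Ck E F k (Suc j) (bgn_ext E j a) (g1 a)" by blast
  have g1C: "g1 a p \<in> carrier F" if "a \<in> \<A>" "p \<in> bgn_ext E j a" for a p
    using Ck_carrier[OF F g1(2)[OF that(1)] bgn_ext_subset that(2)] .
  \<comment> \<open>At parameter \<open>0\<close> the quotient of some restriction is taken; by uniqueness the choice is immaterial.\<close>
  define c where "c p = (SOME a. a \<in> \<A> \<and> bgn_pos p \<in> a)" for p
  define G where "G p = (if bgn_par p = 0 then g1 (c p) p
     else inverse (bgn_par p) \<odot>\<^bsub>F\<^esub> (g (bgn_shift E p) \<oplus>\<^bsub>F\<^esub> (-1) \<odot>\<^bsub>F\<^esub> g (bgn_pos p)))" for p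
  have shift_0: "bgn_shift E p = bgn_pos p" if "p \<in> bgn_space E (Suc j)" "bgn_par p = 0" for p
  proof -
    interpret J: tvs "bgn_tvs E j" using E by (rule tvs_bgn)
    show ?thesis using that J.scale_zero J.module.r_zero by (auto simp: topspace_bgn_Suc bgn_shift_def)
  qed
  have cA: "c p \<in> \<A> \<and> p \<in> bgn_ext E j (c p)" if "p \<in> bgn_ext E j ?A" "bgn_par p = 0" for p
  proof -
    have "\<exists>a. a \<in> \<A> \<and> bgn_pos p \<in> a" using bgn_ext_D[OF that(1)] by blast
    then have "c p \<in> \<A> \<and> bgn_pos p \<in> c p" unfolding c_def by (rule someI_ex)
    then show ?thesis using that shift_0 by (auto simp: bgn_ext_def)
  qed
  have solve: "G p = y" if "bgn_par p \<noteq> 0" "y \<in> carrier F" "bgn_pos p \<in> ?A"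
    "g (bgn_shift E p) = g (bgn_pos p) \<oplus>\<^bsub>F\<^esub> bgn_par p \<odot>\<^bsub>F\<^esub> y" for p y
  proof -
    have x: "g (bgn_pos p) \<in> carrier F" using gC that by blast
    have cancel: "g (bgn_pos p) \<oplus>\<^bsub>F\<^esub> (-1) \<odot>\<^bsub>F\<^esub> g (bgn_pos p) = \<zero>\<^bsub>F\<^esub>"
      using F.scale_add_left[OF x, of 1 "-1"] x by (simp add: F.scale_one F.scale_zero)
    have "g (bgn_shift E p) \<oplus>\<^bsub>F\<^esub> (-1) \<odot>\<^bsub>F\<^esub> g (bgn_pos p) = bgn_par p \<odot>\<^bsub>F\<^esub> y \<oplus>\<^bsub>F\<^esub> (g (bgn_pos p) \<oplus>\<^bsub>F\<^esub> (-1) \<odot>\<^bsub>F\<^esub> g (bgn_pos p))"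
      using x that(2) by (simp add: that(4) F.scale_closed F.module.a_ac)
    then have "g (bgn_shift E p) \<oplus>\<^bsub>F\<^esub> (-1) \<odot>\<^bsub>F\<^esub> g (bgn_pos p) = bgn_par p \<odot>\<^bsub>F\<^esub> y"
      using that(2) F.scale_closed by (simp add: cancel)
    then show ?thesis
      using that(1,2) by (simp add: G_def F.scale_assoc[symmetric] F.scale_one)
  qed
  have G_eq: "G p = g1 a p" if "a \<in> \<A>" "p \<in> bgn_ext E j a" for a p
  proof (cases "bgn_par p = 0")
    case False
    have "bgn_pos p \<in> ?A" using that(1) bgn_ext_D[OF that(2)] by blast
    then show ?thesis by (rule solve[OF False g1C[OF that] _ g1(1)[OF that]])
  next
    case True
    have "p \<in> bgn_ext E j ?A" using that bgn_ext_mono[of a ?A E j] by blast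
    then have c: "c p \<in> \<A>" "p \<in> bgn_ext E j (c p)" using cA[OF _ True] by simp_all
    have gc: "g x \<in> carrier F" if "x \<in> c p" for x using gC c(1) that by blast
    have "g1 (c p) p = g1 a p"
      by (rule difference_quotient_unique[OF E F Suc.prems(1)[OF c(1)] Suc.prems(1)[OF that(1)] gc
            g1(1)[OF c(1)] Ck_continuous[OF g1(2)[OF c(1)]] g1(1)[OF that(1)] Ck_continuous[OF g1(2)[OF that(1)]]
            c(2) that(2)])
    then show ?thesis using True by (simp add: G_def)
  qed
  have GC: "G p \<in> carrier F" if "p \<in> bgn_ext E j ?A" for p
  proof (cases "bgn_par p = 0")
    case True
    then show ?thesis using g1C[of "c p" p] G_eq[of "c p" p] cA[OF that True] by simp
  next
    case False
    then show ?thesis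
      using gC bgn_ext_D[OF that] by (simp add: G_def F.scale_closed F.add_closed)
  qed
  show ?case
  proof (rule CkI)
    show "continuous_map (subtopology (bgn_topology E j) ?A) (tvs_topology F) g"
      by (rule continuous_map_open_cover) (rule Suc.prems(1) Ck_continuous[OF Suc.prems(2)], assumption)+
    show "g (bgn_shift E p) = g (bgn_pos p) \<oplus>\<^bsub>F\<^esub> bgn_par p \<odot>\<^bsub>F\<^esub> G p" if p: "p \<in> bgn_ext E j ?A" for p
    proof (cases "bgn_par p = 0")
      case True
      then show ?thesis using cA[OF p True] G_eq[of "c p" p] g1(1)[of "c p" p] by simp
    next
      case False
      have xy: "g (bgn_pos p) \<in> carrier F" "g (bgn_shift E p) \<in> carrier F" using gC bgn_ext_D[OF p] by auto
      have cancel: "g (bgn_pos p) \<oplus>\<^bsub>F\<^esub> (-1) \<odot>\<^bsub>F\<^esub> g (bgn_pos p) = \<zero>\<^bsub>F\<^esub>"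
        using F.scale_add_left[OF xy(1), of 1 "-1"] xy by (simp add: F.scale_one F.scale_zero)
      have "bgn_par p \<odot>\<^bsub>F\<^esub> G p = g (bgn_shift E p) \<oplus>\<^bsub>F\<^esub> (-1) \<odot>\<^bsub>F\<^esub> g (bgn_pos p)"
        using False xy by (simp add: G_def F.scale_assoc[symmetric] F.scale_one F.scale_closed F.add_closed)
      then have "g (bgn_pos p) \<oplus>\<^bsub>F\<^esub> bgn_par p \<odot>\<^bsub>F\<^esub> G p =
          g (bgn_shift E p) \<oplus>\<^bsub>F\<^esub> (g (bgn_pos p) \<oplus>\<^bsub>F\<^esub> (-1) \<odot>\<^bsub>F\<^esub> g (bgn_pos p))"
        using xy by (simp add: F.scale_closed F.module.a_ac)
      then show ?thesis using xy by (simp add: cancel)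
    qed
    \<comment> \<open>Off the parameter \<open>0\<close> the two points may lie in different members \<open>a\<close> and \<open>b\<close> of the covering.\<close>
    define B where "B a b = {p \<in> bgn_space E (Suc j). bgn_par p \<noteq> 0 \<and> bgn_pos p \<in> a \<and> bgn_shift E p \<in> b}" for a b
    let ?C = "bgn_ext E j ` \<A> \<union> {B a b |a b. a \<in> \<A> \<and> b \<in> \<A>}"
    have cover: "bgn_ext E j ?A = \<Union>?C"
    proof (intro equalityI subsetI)
      fix p assume p: "p \<in> bgn_ext E j ?A"
      show "p \<in> \<Union>?C"
      proof (cases "bgn_par p = 0")
        case True
        then show ?thesis using cA[OF p True] by blast
      next
        case False
        obtain a b where "a \<in> \<A>" "bgn_pos p \<in> a" "b \<in> \<A>" "bgn_shift E p \<in> b"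
          using bgn_ext_D[OF p] by blast
        then have "p \<in> B a b" using p False by (auto simp: B_def bgn_ext_def)
        then show ?thesis using \<open>a \<in> \<A>\<close> \<open>b \<in> \<A>\<close> by blast
      qed
    next
      fix p assume "p \<in> \<Union>?C"
      then show "p \<in> bgn_ext E j ?A" by (auto simp: B_def bgn_ext_def)
    qed
    have B_sub: "B a b \<subseteq> bgn_space E (Suc j)" for a b by (auto simp: B_def)
    have "Ck E F k (Suc j) (\<Union>?C) G"
    proof (rule Suc.IH)
      fix a assume "a \<in> ?C"
      then consider a' where "a' \<in> \<A>" "a = bgn_ext E j a'" | a' b' where "a' \<in> \<A>" "b' \<in> \<A>" "a = B a' b'" by blast
      then show "openin (bgn_topology E (Suc j)) a"
      proof cases
        case 1
        then show ?thesis using openin_bgn_ext[OF E Suc.prems(1)] by simp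
      next
        case 2
        have "openin (bgn_topology E (Suc j)) {p \<in> bgn_space E (Suc j). bgn_par p \<in> - {0}}"
          by (rule openin_continuous_map_preimage[OF continuous_map_par]) auto
        moreover have "B a' b' = {p \<in> bgn_space E (Suc j). bgn_par p \<in> - {0}} \<inter>
          {p \<in> bgn_space E (Suc j). bgn_pos p \<in> a'} \<inter> {p \<in> bgn_space E (Suc j). bgn_shift E p \<in> b'}"
          by (auto simp: B_def)
        ultimately show ?thesis
          using openin_continuous_map_preimage[OF continuous_map_pos Suc.prems(1)[OF 2(1)]]
            openin_continuous_map_preimage[OF continuous_map_shift[OF E] Suc.prems(1)[OF 2(2)]] 2(3) by auto
      qed
    next
      fix a assume "a \<in> ?C"
      then consider a' where "a' \<in> \<A>" "a = bgn_ext E j a'" | a' b' where "a' \<in> \<A>" "b' \<in> \<A>" "a = B a' b'" by blast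
      then show "Ck E F k (Suc j) a G"
      proof cases
        case 1
        then show ?thesis using Ck_cong[OF g1(2)[OF 1(1)]] G_eq by simp
      next
        case 2
        have "Ck E F k (Suc j) (B a' b') (\<lambda>p. g (bgn_pos p))"
          by (rule Ck_pre_linear[OF E Ck_Suc_imp[OF Suc.prems(2)[OF 2(1)]] clin_pos _ B_sub]) (auto simp: B_def)
        moreover have "Ck E F k (Suc j) (B a' b') (\<lambda>p. g (bgn_shift E p))"
          by (rule Ck_shift[OF E Ck_Suc_imp[OF Suc.prems(2)[OF 2(2)]] B_sub]) (auto simp: B_def)
        moreover have "Ck E real_tvs k (Suc j) (B a' b') (\<lambda>p. inverse (bgn_par p))"
          by (rule Ck_inverse[OF E B_sub Ck_linear[OF E clin_par B_sub]]) (auto simp: B_def)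
        ultimately have "Ck E F k (Suc j) (B a' b')
            (\<lambda>p. inverse (bgn_par p) \<odot>\<^bsub>F\<^esub> (g (bgn_shift E p) \<oplus>\<^bsub>F\<^esub> (-1) \<odot>\<^bsub>F\<^esub> g (bgn_pos p)))"
          by (intro Ck_scale[OF E F B_sub] Ck_add[OF F B_sub] Ck_const[OF tvs_real]) auto
        then show ?thesis unfolding 2(3) by (rule Ck_cong) (simp add: B_def G_def)
      qed
    qed
    then show "Ck E F k (Suc j) (bgn_ext E j ?A) G" unfolding cover .
  qed
qed


subsection \<open>Smooth maps on subsets of the model space\<close>

lemma bgn_smooth_iff:
  assumes "tvs E" "tvs F" "U \<subseteq> carrier E"
  shows "bgn_smooth E F U f \<longleftrightarrow> (\<forall>k. Ck E F k 0 (Pt ` U) (\<lambda>p. f (bgn_base p)))"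
  using bgn_C_iff_Ck[OF assms] by (simp add: bgn_smooth_def)

lemma Pt_space: "tvs E \<Longrightarrow> U \<subseteq> carrier E \<Longrightarrow> Pt ` U \<subseteq> bgn_space E 0"
  by (auto simp: topspace_bgn_0)

lemma bgn_smooth_subset:
  assumes "tvs E" "tvs F" "U \<subseteq> carrier E" "bgn_smooth E F U f" "U' \<subseteq> U"
  shows "bgn_smooth E F U' f"
proof -
  have "Ck E F k 0 (Pt ` U') (\<lambda>p. f (bgn_base p))" for k
    using assms(4)[unfolded bgn_smooth_iff[OF assms(1-3)], rule_format] image_mono[OF assms(5)] by (rule Ck_subset)
  then show ?thesis unfolding bgn_smooth_iff[OF assms(1,2) subset_trans[OF assms(5,3)]] by blast
qed

lemma bgn_smooth_cong:
  assumes "tvs E" "tvs F" "U \<subseteq> carrier E" "bgn_smooth E F U f" "\<And>x. x \<in> U \<Longrightarrow> f x = g x"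
  shows "bgn_smooth E F U g"
proof -
  have "Ck E F k 0 (Pt ` U) (\<lambda>p. g (bgn_base p))" for k
    using assms(4)[unfolded bgn_smooth_iff[OF assms(1-3)], rule_format]
    by (rule Ck_cong) (use assms(5) in auto)
  then show ?thesis unfolding bgn_smooth_iff[OF assms(1-3)] by blast
qed

lemma clin_Pt: "clin E (bgn_tvs E 0) Pt"
  by (simp add: clin_def continuous_map_Pt[of _ _ "\<lambda>x. x", simplified] )

lemma clin_base: "tvs E \<Longrightarrow> clin (bgn_tvs E 0) E bgn_base"
  by (auto simp: clin_def continuous_map_base topspace_bgn_0)

lemma bgn_smooth_compose:
  assumes "tvs E" "tvs F" "tvs G" "U \<subseteq> carrier E" "W \<subseteq> carrier F"
    and "bgn_smooth E F U f" "bgn_smooth F G W g" "f ` U \<subseteq> W"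
  shows "bgn_smooth E G U (\<lambda>x. g (f x))"
  unfolding bgn_smooth_iff[OF assms(1,3,4)]
proof
  fix k
  have "Ck E (bgn_tvs F 0) k 0 (Pt ` U) (\<lambda>p. Pt (f (bgn_base p)))"
    using assms by (intro Ck_post_linear[OF clin_Pt assms(2) Pt_space[OF assms(1,4)]]) (simp add: bgn_smooth_iff)
  moreover have "Ck F G k 0 (Pt ` W) (\<lambda>p. g (bgn_base p))" using assms by (simp add: bgn_smooth_iff)
  moreover have "(\<lambda>p. Pt (f (bgn_base p))) ` Pt ` U \<subseteq> Pt ` W" using assms(8) by auto
  ultimately have "Ck E G k 0 (Pt ` U) (\<lambda>p. g (bgn_base (Pt (f (bgn_base p)))))"
    by (rule Ck_compose[OF assms(1,2) _ _ _ Pt_space[OF assms(1,4)]])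
  then show "Ck E G k 0 (Pt ` U) (\<lambda>p. g (f (bgn_base p)))" by simp
qed

lemma bgn_smooth_linear:
  assumes "tvs E" "tvs F" "U \<subseteq> carrier E" "clin E F L" shows "bgn_smooth E F U L"
  unfolding bgn_smooth_iff[OF assms(1-3)]
proof
  fix k
  have "Ck E E k 0 (Pt ` U) bgn_base"
    using assms by (intro Ck_linear clin_base Pt_space)
  then show "Ck E F k 0 (Pt ` U) (\<lambda>p. L (bgn_base p))"
    using Ck_post_linear[OF assms(4,1) Pt_space[OF assms(1,3)]] by blast
qed

lemma bgn_smooth_const:
  assumes "tvs E" "tvs F" "U \<subseteq> carrier E" "c \<in> carrier F" shows "bgn_smooth E F U (\<lambda>_. c)"
  using assms by (simp add: bgn_smooth_iff Ck_const)

lemma bgn_smooth_pair: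
  assumes "tvs E" "tvs F" "tvs F'" "U \<subseteq> carrier E" "bgn_smooth E F U f" "bgn_smooth E F' U g"
  shows "bgn_smooth E (tvs_prod F F') U (\<lambda>x. (f x, g x))"
  using assms by (simp add: bgn_smooth_iff tvs_prod Ck_pair)

lemma bgn_smooth_tuple:
  assumes "tvs E" "tvs F" "U \<subseteq> carrier E" "\<And>l. l \<le> q \<Longrightarrow> bgn_smooth E F U (f l)"
  shows "bgn_smooth E (tvs_power F q) U (\<lambda>x. \<lambda>l\<in>{..q}. f l x)"
proof -
  have "Ck E (tvs_power F q) k 0 (Pt ` U) (\<lambda>p. \<lambda>l\<in>{..q}. f l (bgn_base p))" for k
    by (rule Ck_tuple[OF assms(2) Pt_space[OF assms(1,3)]])
      (rule assms(4)[unfolded bgn_smooth_iff[OF assms(1-3)], rule_format])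
  then show ?thesis unfolding bgn_smooth_iff[OF assms(1) tvs_power[OF assms(2)] assms(3)] by blast
qed

lemma bgn_smooth_add:
  assumes "tvs E" "tvs F" "U \<subseteq> carrier E" "bgn_smooth E F U f" "bgn_smooth E F U g"
  shows "bgn_smooth E F U (\<lambda>x. f x \<oplus>\<^bsub>F\<^esub> g x)"
  using assms by (simp add: bgn_smooth_iff Ck_add Pt_space)

lemma bgn_smooth_scale:
  assumes "tvs E" "tvs F" "U \<subseteq> carrier E" "bgn_smooth E real_tvs U a" "bgn_smooth E F U g"
  shows "bgn_smooth E F U (\<lambda>x. a x \<odot>\<^bsub>F\<^esub> g x)"
  using assms by (simp add: bgn_smooth_iff Ck_scale Pt_space tvs_real)

lemma bgn_smooth_inverse:
  assumes "tvs E" "U \<subseteq> carrier E" "bgn_smooth E real_tvs U r" "\<And>x. x \<in> U \<Longrightarrow> r x \<noteq> 0"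
  shows "bgn_smooth E real_tvs U (\<lambda>x. inverse (r x))"
  unfolding bgn_smooth_iff[OF assms(1) tvs_real assms(2)]
proof
  fix k
  show "Ck E real_tvs k 0 (Pt ` U) (\<lambda>p. inverse (r (bgn_base p)))"
    using assms(4) by (intro Ck_inverse[OF assms(1) Pt_space[OF assms(1,2)]]
        assms(3)[unfolded bgn_smooth_iff[OF assms(1) tvs_real assms(2)], rule_format]) auto
qed

lemma bgn_smooth_continuous:
  assumes "tvs E" "tvs F" "U \<subseteq> carrier E" "bgn_smooth E F U f"
  shows "continuous_map (subtopology (tvs_topology E) U) (tvs_topology F) f"
proof -
  have "Ck E F 0 0 (Pt ` U) (\<lambda>p. f (bgn_base p))"
    using assms(4) unfolding bgn_smooth_iff[OF assms(1-3)] ..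
  then have f: "continuous_map (subtopology (bgn_topology E 0) (Pt ` U)) (tvs_topology F) (\<lambda>p. f (bgn_base p))" by simp
  have P: "continuous_map (subtopology (tvs_topology E) U) (subtopology (bgn_topology E 0) (Pt ` U)) Pt"
    using clin_Pt[of E] by (auto simp: clin_def continuous_map_in_subtopology continuous_map_from_subtopology)
  from continuous_map_compose[OF P f] show ?thesis by (simp add: o_def)
qed

lemma bgn_smooth_locally:
  assumes E: "tvs E" and F: "tvs F"
    and "\<And>x. x \<in> U \<Longrightarrow> \<exists>W. openin (tvs_topology E) W \<and> x \<in> W \<and> W \<subseteq> U \<and> bgn_smooth E F W f"
  shows "bgn_smooth E F U f"
proof -
  interpret E: tvs E by fact
  let ?W = "{W. openin (tvs_topology E) W \<and> W \<subseteq> U \<and> bgn_smooth E F W f}"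
  have W: "W \<subseteq> carrier E" if "openin (tvs_topology E) W" for W using openin_subset[OF that] E.topspace_tvs by simp
  have U: "U = \<Union>?W" using assms(3) by blast
  then have U_carrier: "U \<subseteq> carrier E" using W by blast
  have "Ck E F k 0 (\<Union>((`) Pt ` ?W)) (\<lambda>p. f (bgn_base p))" for k
  proof (rule Ck_locally[OF E F])
    fix a assume "a \<in> (`) Pt ` ?W"
    then obtain W where W: "openin (tvs_topology E) W" "a = Pt ` W" by blast
    have "openin (bgn_topology E 0) {p \<in> bgn_space E 0. bgn_base p \<in> W}"
      by (rule openin_continuous_map_preimage[OF continuous_map_base W(1)])
    moreover have "{p \<in> bgn_space E 0. bgn_base p \<in> W} = a"
      using openin_subset[OF W(1)] E.topspace_tvs by (auto simp: W(2) topspace_bgn_0[OF E])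
    ultimately show "openin (bgn_topology E 0) a" by simp
  next
    fix a assume "a \<in> (`) Pt ` ?W"
    then obtain W' where W': "openin (tvs_topology E) W'" "bgn_smooth E F W' f" "a = Pt ` W'" by blast
    show "Ck E F k 0 a (\<lambda>p. f (bgn_base p))"
      using W'(2) unfolding W'(3) bgn_smooth_iff[OF E F W[OF W'(1)]] by blast
  qed
  moreover have "\<Union>((`) Pt ` ?W) = Pt ` U" using U by blast
  ultimately show ?thesis using U_carrier by (simp add: bgn_smooth_iff[OF E F])
qed


section \<open>Smooth maps of manifolds\<close>

text \<open>The charts of a manifold with boundary like the unit interval do not have open images. In the rules below
  the targets of smooth maps are subject to the first of the two following conditions. The sources are subject
  to the second one wherever smoothness is established locally, since a neighbourhood in the source then has
  to be a neighbourhood in the model space.\<close>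

definition modelled :: "('m, 'e) manifold \<Rightarrow> bool" where
  "modelled X \<longleftrightarrow> tvs (model X) \<and>
     (\<forall>D \<phi>. (D, \<phi>) \<in> atlas X \<longrightarrow> openin (mtop X) D \<and> inj_on \<phi> D \<and> \<phi> ` D \<subseteq> carrier (model X)) \<and>
     \<Union>(fst ` atlas X) = topspace (mtop X)"

definition open_charts :: "('m, 'e) manifold \<Rightarrow> bool" where
  "open_charts X \<longleftrightarrow> modelled X \<and>
     (\<forall>D \<phi> W. (D, \<phi>) \<in> atlas X \<longrightarrow> openin (mtop X) W \<longrightarrow> W \<subseteq> D \<longrightarrow>
        openin (tvs_topology (model X)) (\<phi> ` W))"

lemma modelledD:
  assumes "modelled X"
  shows "tvs (model X)" "\<Union>(fst ` atlas X) = topspace (mtop X)"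
  using assms by (auto simp: modelled_def)

lemma modelled_chart:
  assumes "modelled X" "(D, \<phi>) \<in> atlas X"
  shows "openin (mtop X) D" "inj_on \<phi> D" "\<phi> ` D \<subseteq> carrier (model X)" "D \<subseteq> topspace (mtop X)"
proof -
  show "openin (mtop X) D" "inj_on \<phi> D" "\<phi> ` D \<subseteq> carrier (model X)"
    using assms unfolding modelled_def by blast+
  then show "D \<subseteq> topspace (mtop X)" using openin_subset by metis
qed

lemma modelled_chart_at:
  assumes "modelled X" "x \<in> topspace (mtop X)"
  obtains D \<phi> where "(D, \<phi>) \<in> atlas X" "x \<in> D"
proof -
  obtain c where "c \<in> atlas X" "x \<in> fst c" using assms(2) unfolding modelledD(2)[OF assms(1), symmetric] by blast
  then show thesis using that[of "fst c" "snd c"] by simp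
qed

lemma open_chartsD: "open_charts X \<Longrightarrow> modelled X"
  by (simp add: open_charts_def)

lemma open_charts_image:
  "open_charts X \<Longrightarrow> (D, \<phi>) \<in> atlas X \<Longrightarrow> openin (mtop X) W \<Longrightarrow> W \<subseteq> D \<Longrightarrow> openin (tvs_topology (model X)) (\<phi> ` W)"
  by (auto simp: open_charts_def)

lemma open_charts_manifold:
  assumes "manifold M" shows "open_charts M"
proof -
  interpret manifold M by fact
  have "inj_on \<phi> D" if "(D, \<phi>) \<in> atlas M" for D \<phi>
    using chart_homeomorphic[OF that] openin_subset[OF chart_domain_open[OF that]]
    by (simp add: homeomorphic_eq_everything_map Int_absorb1)
  moreover have "\<phi> ` D \<subseteq> carrier (model M)" if "(D, \<phi>) \<in> atlas M" for D \<phi>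
    using openin_subset[OF chart_image_open[OF that]] tvs.topspace_tvs[OF tvs_model] by simp
  moreover have "openin (tvs_topology (model M)) (\<phi> ` W)"
    if "(D, \<phi>) \<in> atlas M" "openin (mtop M) W" "W \<subseteq> D" for D \<phi> W
  proof -
    have "openin (subtopology (mtop M) D) W"
      using that by (auto simp: openin_subtopology)
    then have "openin (subtopology (tvs_topology (model M)) (\<phi> ` D)) (\<phi> ` W)"
      using chart_homeomorphic[OF that(1)] homeomorphic_imp_open_map open_map_def by blast
    then show ?thesis using chart_image_open[OF that(1)] openin_trans_full by blast
  qed
  ultimately show ?thesis
    using tvs_model chart_domain_open charts_cover unfolding open_charts_def modelled_def
    by (simp add: case_prod_unfold image_def)
qed

lemma topspace_submanifold: "topspace (mtop (open_submanifold X W)) = topspace (mtop X) \<inter> W"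
  by (simp add: open_submanifold_def)

lemma open_submanifold_simps [simp]:
  "mtop (open_submanifold X W) = subtopology (mtop X) W" "model (open_submanifold X W) = model X"
  "atlas (open_submanifold X W) = {(D \<inter> W, \<phi>) |D \<phi>. (D, \<phi>) \<in> atlas X}"
  by (simp_all add: open_submanifold_def)

lemma open_submanifold_twice:
  assumes "W' \<subseteq> W"
  shows "open_submanifold (open_submanifold X W) W' = open_submanifold X W'"
proof -
  have "D \<inter> W \<inter> W' = D \<inter> W'" for D using assms by blast
  moreover have "W \<inter> W' = W'" using assms by blast
  ultimately show ?thesis
    by (auto simp: open_submanifold_def subtopology_subtopology)
qed

lemma modelled_submanifold:
  assumes "modelled X" shows "modelled (open_submanifold X W)"
proof -
  have "openin (subtopology (mtop X) W) (D \<inter> W) \<and> inj_on \<phi> (D \<inter> W) \<and> \<phi> ` (D \<inter> W) \<subseteq> carrier (model X)"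
    if "(D, \<phi>) \<in> atlas X" for D \<phi>
    using modelled_chart[OF assms that] by (auto simp: openin_subtopology_Int intro: inj_on_subset)
  moreover have "\<Union>(fst ` atlas (open_submanifold X W)) = \<Union>(fst ` atlas X) \<inter> W" by force
  ultimately show ?thesis
    using modelledD[OF assms] by (auto simp: modelled_def[of "open_submanifold X W"])
qed

lemma open_charts_submanifold:
  assumes "open_charts X" "openin (mtop X) W" shows "open_charts (open_submanifold X W)"
  using modelled_submanifold[OF open_chartsD[OF assms(1)], of W] assms
  by (auto simp: open_charts_def[of "open_submanifold X W"] openin_open_subtopology intro: open_charts_image)

lemma modelled_prod:
  assumes "modelled X" "modelled Y" shows "modelled (manifold_prod X Y)"
proof -
  have "openin (prod_topology (mtop X) (mtop Y)) (D \<times> D') \<and> inj_on (map_prod \<phi> \<psi>) (D \<times> D') \<and>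
      map_prod \<phi> \<psi> ` (D \<times> D') \<subseteq> carrier (model X) \<times> carrier (model Y)"
    if "(D, \<phi>) \<in> atlas X" "(D', \<psi>) \<in> atlas Y" for D \<phi> D' \<psi>
    using modelled_chart[OF assms(1) that(1)] modelled_chart[OF assms(2) that(2)]
    by (auto simp: openin_prod_Times_iff map_prod_inj_on)
  moreover have "\<Union>(fst ` atlas (manifold_prod X Y)) = topspace (mtop X) \<times> topspace (mtop Y)"
    unfolding modelledD(2)[OF assms(1), symmetric] modelledD(2)[OF assms(2), symmetric]
  proof (intro equalityI subsetI)
    fix z assume "z \<in> \<Union>(fst ` atlas X) \<times> \<Union>(fst ` atlas Y)"
    then obtain c c' where c: "c \<in> atlas X" "c' \<in> atlas Y" "z \<in> fst c \<times> fst c'" by auto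
    then have "(fst c \<times> fst c', map_prod (snd c) (snd c')) \<in> atlas (manifold_prod X Y)"
      unfolding manifold_prod_def by (simp; metis prod.collapse)
    then show "z \<in> \<Union>(fst ` atlas (manifold_prod X Y))" using c(3) by (metis UnionI fst_conv image_eqI)
  qed (auto simp: manifold_prod_def intro: bexI[rotated])
  ultimately show ?thesis
    using tvs_prod[OF modelledD(1)[OF assms(1)] modelledD(1)[OF assms(2)]]
    unfolding modelled_def[of "manifold_prod X Y"]
    by (simp add: manifold_prod_def) blast
qed

lemma manifold_power_simps [simp]:
  "mtop (manifold_power M q) = product_topology (\<lambda>_. mtop M) {..q}"
  "model (manifold_power M q) = tvs_power (model M) q"
  by (simp_all add: manifold_power_def)

lemma atlas_power: "atlas (manifold_power M q) =
  {(\<Pi>\<^sub>E i\<in>{..q}. fst (c i), \<lambda>x. \<lambda>i\<in>{..q}. snd (c i) (x i)) |c. c \<in> {..q} \<rightarrow> atlas M}"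
  by (simp add: manifold_power_def)

lemma power_chartE:
  assumes "(D, \<phi>) \<in> atlas (manifold_power M q)"
  obtains c where "c \<in> {..q} \<rightarrow> atlas M" "D = (\<Pi>\<^sub>E i\<in>{..q}. fst (c i))"
    "\<phi> = (\<lambda>x. \<lambda>i\<in>{..q}. snd (c i) (x i))"
  using assms unfolding atlas_power mem_Collect_eq prod.inject by blast

text \<open>An open set in the domain of a product chart is a union of boxes, and the image of a box is a box.\<close>

lemma open_charts_power:
  fixes M :: "('m, 'e) manifold"
  assumes M: "open_charts M" shows "open_charts (manifold_power M q)"
proof -
  let ?\<phi> = "\<lambda>c x. \<lambda>i\<in>{..q}. snd (c i) (x i)" and ?D = "\<lambda>c. \<Pi>\<^sub>E i\<in>{..q}. fst (c i)"
  have mod: "modelled M" using M by (rule open_chartsD)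
  have chart: "openin (mtop M) (fst (c i))" "inj_on (snd (c i)) (fst (c i))" "snd (c i) ` fst (c i) \<subseteq> carrier (model M)"
    if "c \<in> {..q} \<rightarrow> atlas M" "i \<le> q" for c i
  proof -
    have "(fst (c i), snd (c i)) \<in> atlas M" using that by auto
    from modelled_chart[OF mod this] show "openin (mtop M) (fst (c i))" "inj_on (snd (c i)) (fst (c i))"
      "snd (c i) ` fst (c i) \<subseteq> carrier (model M)" by blast+
  qed
  have opn: "openin (mtop (manifold_power M q)) (?D c)" if "c \<in> {..q} \<rightarrow> atlas M" for c
    using chart(1)[OF that] by (simp add: openin_PiE)
  have inj: "inj_on (?\<phi> c) (?D c)" if c: "c \<in> {..q} \<rightarrow> atlas M" for c
  proof (rule inj_onI)
    fix x y assume xy: "x \<in> ?D c" "y \<in> ?D c" "?\<phi> c x = ?\<phi> c y"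
    show "x = y"
    proof (rule PiE_ext[OF xy(1,2)])
      fix i assume i: "i \<in> {..q}"
      then have "snd (c i) (x i) = snd (c i) (y i)" using fun_cong[OF xy(3), of i] by simp
      then show "x i = y i" using chart(2)[OF c] i xy(1,2) by (auto simp: inj_on_def PiE_iff)
    qed
  qed
  have carr: "?\<phi> c ` ?D c \<subseteq> {..q} \<rightarrow>\<^sub>E carrier (model M)" if "c \<in> {..q} \<rightarrow> atlas M" for c
  proof
    fix z assume "z \<in> ?\<phi> c ` ?D c"
    then obtain x where x: "x \<in> ?D c" "z = ?\<phi> c x" by blast
    have "snd (c i) (x i) \<in> carrier (model M)" if "i \<in> {..q}" for i
    proof -
      have "x i \<in> fst (c i)" using x(1) that by (rule PiE_mem)
      then show ?thesis using chart(3)[OF \<open>c \<in> {..q} \<rightarrow> atlas M\<close>, of i] that by auto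
    qed
    then show "z \<in> {..q} \<rightarrow>\<^sub>E carrier (model M)" unfolding x(2) by (simp add: restrict_PiE_iff)
  qed
  have cover: "\<Union>(fst ` atlas (manifold_power M q)) = {..q} \<rightarrow>\<^sub>E topspace (mtop M)"
  proof (intro equalityI subsetI)
    fix x assume "x \<in> \<Union>(fst ` atlas (manifold_power M q))"
    then obtain e where e: "e \<in> atlas (manifold_power M q)" "x \<in> fst e" by blast
    from e(1) obtain c where c: "c \<in> {..q} \<rightarrow> atlas M" "e = (?D c, ?\<phi> c)" unfolding atlas_power by blast
    have "?D c \<subseteq> {..q} \<rightarrow>\<^sub>E topspace (mtop M)"
      by (rule PiE_mono) (use openin_subset[OF chart(1)[OF c(1)]] in simp)
    then show "x \<in> {..q} \<rightarrow>\<^sub>E topspace (mtop M)" using e(2) unfolding c(2) fst_conv by blast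
  next
    fix x assume x: "x \<in> {..q} \<rightarrow>\<^sub>E topspace (mtop M)"
    have "\<exists>c. c \<in> atlas M \<and> x i \<in> fst c" if "i \<in> {..q}" for i
    proof -
      have "x i \<in> topspace (mtop M)" using x that by (rule PiE_mem)
      with mod obtain D \<phi> where "(D, \<phi>) \<in> atlas M" "x i \<in> D" by (rule modelled_chart_at)
      then show ?thesis by (intro exI[of _ "(D, \<phi>)"]) simp
    qed
    then have "\<forall>i\<in>{..q}. \<exists>c. c \<in> atlas M \<and> x i \<in> fst c" by blast
    from bchoice[OF this] obtain c where c: "\<forall>i\<in>{..q}. c i \<in> atlas M \<and> x i \<in> fst (c i)" by blast
    then have "(?D c, ?\<phi> c) \<in> atlas (manifold_power M q)" unfolding atlas_power by blast
    from imageI[OF this, of fst] have "?D c \<in> fst ` atlas (manifold_power M q)" by (simp only: fst_conv)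
    moreover have "x \<in> ?D c"
      by (rule PiE_I) (use c PiE_arb[OF x] in auto)
    ultimately show "x \<in> \<Union>(fst ` atlas (manifold_power M q))" by (rule UnionI)
  qed
  have modP: "modelled (manifold_power M q)"
    unfolding modelled_def
  proof (intro conjI allI impI)
    show "tvs (model (manifold_power M q))" using tvs_power[OF modelledD(1)[OF mod]] by simp
    show "\<Union>(fst ` atlas (manifold_power M q)) = topspace (mtop (manifold_power M q))"
      using cover by simp
    fix D \<phi> assume "(D, \<phi>) \<in> atlas (manifold_power M q)"
    then obtain c where c: "c \<in> {..q} \<rightarrow> atlas M" "D = ?D c" "\<phi> = ?\<phi> c" by (rule power_chartE)
    show "openin (mtop (manifold_power M q)) D" using opn[OF c(1)] c(2) by simp
    show "inj_on \<phi> D" unfolding c(2,3) by (rule inj[OF c(1)])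
    show "\<phi> ` D \<subseteq> carrier (model (manifold_power M q))"
      unfolding c(2,3) manifold_power_simps tvs_power_simps by (rule carr[OF c(1)])
  qed
  have image: "openin (tvs_topology (tvs_power (model M) q)) (?\<phi> c ` W)"
    if c: "c \<in> {..q} \<rightarrow> atlas M" and W: "openin (mtop (manifold_power M q)) W" "W \<subseteq> ?D c" for c W
  proof (subst openin_subopen, intro ballI)
    fix z assume "z \<in> ?\<phi> c ` W"
    then obtain x where x: "x \<in> W" "z = ?\<phi> c x" by blast
    obtain B where B: "finite {i \<in> {..q}. B i \<noteq> topspace (mtop M)}" "\<forall>i\<in>{..q}. openin (mtop M) (B i)"
      "x \<in> Pi\<^sub>E {..q} B" "Pi\<^sub>E {..q} B \<subseteq> W"
      using W(1)[unfolded manifold_power_simps openin_product_topology_alt, rule_format, OF x(1)] by blast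
    let ?B = "\<lambda>i. B i \<inter> fst (c i)"
    let ?T = "\<Pi>\<^sub>E i\<in>{..q}. snd (c i) ` ?B i"
    have "openin (tvs_topology (tvs_power (model M) q)) ?T"
    proof -
      have "openin (tvs_topology (model M)) (snd (c i) ` ?B i)" if i: "i \<in> {..q}" for i
      proof (rule open_charts_image[OF M, of "fst (c i)"])
        show "(fst (c i), snd (c i)) \<in> atlas M" using c i by auto
        show "openin (mtop M) (?B i)" using B(2) chart(1)[OF c] i by auto
      qed auto
      then show ?thesis by (simp add: openin_PiE)
    qed
    moreover have "z \<in> ?T"
    proof -
      have "x i \<in> ?B i" if "i \<in> {..q}" for i
        using PiE_mem[OF B(3) that] PiE_mem[OF subsetD[OF W(2) x(1)] that] by simp
      then show ?thesis unfolding x(2) by (auto simp: restrict_PiE_iff)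
    qed
    moreover have "?T \<subseteq> ?\<phi> c ` W"
    proof
      fix y assume y: "y \<in> ?T"
      have "\<forall>i\<in>{..q}. \<exists>b. b \<in> ?B i \<and> y i = snd (c i) b" using PiE_mem[OF y] by blast
      from bchoice[OF this] obtain b where b: "\<forall>i\<in>{..q}. b i \<in> ?B i \<and> y i = snd (c i) (b i)" by blast
      have "restrict b {..q} \<in> Pi\<^sub>E {..q} B" using b by (simp add: restrict_PiE_iff)
      then have "restrict b {..q} \<in> W" using B(4) by blast
      moreover have "y = ?\<phi> c (restrict b {..q})"
        by (rule extensionalityI[of _ "{..q}"]) (use y b in \<open>auto simp: PiE_def\<close>)
      ultimately show "y \<in> ?\<phi> c ` W" by blast
    qed
    ultimately show "\<exists>T. openin (tvs_topology (tvs_power (model M) q)) T \<and> z \<in> T \<and> T \<subseteq> ?\<phi> c ` W" by blast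
  qed
  have "openin (tvs_topology (model (manifold_power M q))) (\<phi> ` W)"
    if DW: "(D, \<phi>) \<in> atlas (manifold_power M q)" "openin (mtop (manifold_power M q)) W" "W \<subseteq> D" for D \<phi> W
  proof -
    obtain c where "c \<in> {..q} \<rightarrow> atlas M" "D = ?D c" "\<phi> = ?\<phi> c" using DW(1) by (rule power_chartE)
    then show ?thesis using image[of c W] DW(2,3) by simp
  qed
  then show ?thesis using modP unfolding open_charts_def by blast
qed

lemma open_charts_real_line: "open_charts real_line"
  by (auto simp: open_charts_def modelled_def real_line_def tvs_real)

lemma modelled_unit_interval: "modelled unit_interval"
  by (auto simp: modelled_def unit_interval_def tvs_real)


subsection \<open>Rules for smooth maps\<close>

lemma smooth_mapD:
  assumes "smooth_map X N f"
  shows "continuous_map (mtop X) (mtop N) f"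
    and "(D, \<phi>) \<in> atlas X \<Longrightarrow> (D', \<psi>) \<in> atlas N \<Longrightarrow>
      bgn_smooth (model X) (model N) (\<phi> ` (D \<inter> f -` D')) (\<psi> \<circ> f \<circ> inv_into D \<phi>)"
  using assms by (auto simp: smooth_map_def)

lemma smooth_mapI:
  assumes "continuous_map (mtop X) (mtop N) f"
    and "\<And>D \<phi> D' \<psi>. (D, \<phi>) \<in> atlas X \<Longrightarrow> (D', \<psi>) \<in> atlas N \<Longrightarrow>
      bgn_smooth (model X) (model N) (\<phi> ` (D \<inter> f -` D')) (\<psi> \<circ> f \<circ> inv_into D \<phi>)"
  shows "smooth_map X N f"
  using assms by (auto simp: smooth_map_def)

lemma chart_image_carrier:
  assumes "modelled X" "(D, \<phi>) \<in> atlas X" shows "\<phi> ` (D \<inter> W) \<subseteq> carrier (model X)"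
  using modelled_chart(3)[OF assms] by blast

lemma smooth_map_locallyI:
  assumes X: "open_charts X" and N: "modelled N" and f: "continuous_map (mtop X) (mtop N) f"
    and loc: "\<And>D \<phi> D' \<psi> x. (D, \<phi>) \<in> atlas X \<Longrightarrow> (D', \<psi>) \<in> atlas N \<Longrightarrow> x \<in> D \<Longrightarrow> f x \<in> D' \<Longrightarrow>
      \<exists>W. openin (mtop X) W \<and> x \<in> W \<and> W \<subseteq> D \<inter> f -` D' \<and>
        bgn_smooth (model X) (model N) (\<phi> ` W) (\<psi> \<circ> f \<circ> inv_into D \<phi>)"
  shows "smooth_map X N f"
proof (rule smooth_mapI[OF f])
  fix D \<phi> D' \<psi> assume D: "(D, \<phi>) \<in> atlas X" and D': "(D', \<psi>) \<in> atlas N"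
  show "bgn_smooth (model X) (model N) (\<phi> ` (D \<inter> f -` D')) (\<psi> \<circ> f \<circ> inv_into D \<phi>)"
  proof (rule bgn_smooth_locally)
    show "tvs (model X)" "tvs (model N)" using modelledD(1) N open_chartsD[OF X] by blast+
    fix z assume "z \<in> \<phi> ` (D \<inter> f -` D')"
    then obtain x where x: "x \<in> D" "f x \<in> D'" "z = \<phi> x" by blast
    obtain W where W: "openin (mtop X) W" "x \<in> W" "W \<subseteq> D \<inter> f -` D'"
      "bgn_smooth (model X) (model N) (\<phi> ` W) (\<psi> \<circ> f \<circ> inv_into D \<phi>)"
      using loc[OF D D' x(1,2)] by blast
    have "openin (tvs_topology (model X)) (\<phi> ` W)"
      using W(3) by (intro open_charts_image[OF X D W(1)]) blast
    then show "\<exists>W. openin (tvs_topology (model X)) W \<and> z \<in> W \<and> W \<subseteq> \<phi> ` (D \<inter> f -` D') \<and>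
        bgn_smooth (model X) (model N) W (\<psi> \<circ> f \<circ> inv_into D \<phi>)"
      using W x(3) by (intro exI[of _ "\<phi> ` W"] conjI image_mono) auto
  qed
qed

lemma openin_preimage_Int:
  assumes "openin T D" "continuous_map T T' f" "openin T' D'" shows "openin T (D \<inter> f -` D')"
proof -
  have "D \<inter> f -` D' = D \<inter> {x \<in> topspace T. f x \<in> D'}" using openin_subset[OF assms(1)] by blast
  then show ?thesis using openin_continuous_map_preimage[OF assms(2,3)] assms(1) by auto
qed

text \<open>The chain rule applies near each point, where the first map stays in one chart of the intermediate
  manifold; the rest is locality.\<close>

lemma smooth_map_compose:
  assumes X: "open_charts X" and N: "modelled N" and P: "modelled P"
    and f: "smooth_map X N f" and g: "smooth_map N P g"
  shows "smooth_map X P (\<lambda>x. g (f x))"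
proof (rule smooth_map_locallyI[OF X P])
  note fc = smooth_mapD(1)[OF f]
  show gfc: "continuous_map (mtop X) (mtop P) (\<lambda>x. g (f x))"
    using continuous_map_compose[OF fc smooth_mapD(1)[OF g]] by (simp add: o_def)
  fix D \<phi> D'' \<xi> x assume D: "(D, \<phi>) \<in> atlas X" and D'': "(D'', \<xi>) \<in> atlas P" and x: "x \<in> D" "g (f x) \<in> D''"
  note XD = modelled_chart[OF open_chartsD[OF X] D]
  have "f x \<in> topspace (mtop N)" using fc XD(4) x(1) by (auto simp: continuous_map_def)
  with N obtain D' \<psi> where D': "(D', \<psi>) \<in> atlas N" "f x \<in> D'" by (rule modelled_chart_at)
  note ND = modelled_chart[OF N D'(1)]
  let ?W = "D \<inter> f -` D' \<inter> (\<lambda>x. g (f x)) -` D''"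
  have W: "openin (mtop X) ?W"
    by (intro openin_preimage_Int[OF openin_preimage_Int[OF XD(1) fc ND(1)] gfc modelled_chart(1)[OF P D''(1)]])
  have a: "bgn_smooth (model X) (model N) (\<phi> ` ?W) (\<psi> \<circ> f \<circ> inv_into D \<phi>)"
    by (rule bgn_smooth_subset[OF _ _ chart_image_carrier[OF open_chartsD[OF X] D] smooth_mapD(2)[OF f D D'(1)]])
      (use modelledD(1) N open_chartsD[OF X] in auto)
  have b: "bgn_smooth (model N) (model P) (\<psi> ` (D' \<inter> g -` D'')) (\<xi> \<circ> g \<circ> inv_into D' \<psi>)"
    by (rule smooth_mapD(2)[OF g D'(1) D''(1)])
  have c: "(\<psi> \<circ> f \<circ> inv_into D \<phi>) ` \<phi> ` ?W \<subseteq> \<psi> ` (D' \<inter> g -` D'')"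
    using XD(2) by (auto simp: inv_into_f_f)
  have "\<phi> ` ?W \<subseteq> carrier (model X)" "\<psi> ` (D' \<inter> g -` D'') \<subseteq> carrier (model N)"
    using XD(3) ND(3) by auto
  from bgn_smooth_compose[OF modelledD(1)[OF open_chartsD[OF X]] modelledD(1)[OF N] modelledD(1)[OF P] this a b c]
  have "bgn_smooth (model X) (model P) (\<phi> ` ?W)
      (\<lambda>z. (\<xi> \<circ> g \<circ> inv_into D' \<psi>) ((\<psi> \<circ> f \<circ> inv_into D \<phi>) z))" .
  then have "bgn_smooth (model X) (model P) (\<phi> ` ?W) (\<xi> \<circ> (\<lambda>x. g (f x)) \<circ> inv_into D \<phi>)"
    by (rule bgn_smooth_cong[OF modelledD(1)[OF open_chartsD[OF X]] modelledD(1)[OF P], rotated])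
      (use XD(2,3) ND(2) in \<open>auto simp: inv_into_f_f\<close>)
  then show "\<exists>W. openin (mtop X) W \<and> x \<in> W \<and> W \<subseteq> D \<inter> (\<lambda>x. g (f x)) -` D'' \<and>
      bgn_smooth (model X) (model P) (\<phi> ` W) (\<xi> \<circ> (\<lambda>x. g (f x)) \<circ> inv_into D \<phi>)"
    using W x D'(2) by (intro exI[of _ ?W]) auto
qed

lemma smooth_map_eq:
  assumes X: "modelled X" and N: "modelled N" and f: "smooth_map X N f"
    and eq: "\<And>x. x \<in> topspace (mtop X) \<Longrightarrow> f x = g x"
  shows "smooth_map X N g"
proof (rule smooth_mapI, goal_cases)
  case 1
  show ?case using smooth_mapD(1)[OF f] eq by (rule continuous_map_eq)
next
  case (2 D \<phi> D' \<psi>)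
  note XD = modelled_chart[OF X 2(1)]
  have sub: "D \<inter> f -` D' = D \<inter> g -` D'" using XD(4) eq by auto
  show ?case
    by (rule bgn_smooth_cong[OF modelledD(1)[OF X] modelledD(1)[OF N] chart_image_carrier[OF X 2(1)]
          smooth_mapD(2)[OF f 2, unfolded sub]])
      (use XD eq in \<open>auto simp: inv_into_f_f\<close>)
qed

lemma inv_into_Int:
  assumes "inj_on \<phi> D" "x \<in> D" "x \<in> W" shows "inv_into (D \<inter> W) \<phi> (\<phi> x) = inv_into D \<phi> (\<phi> x)"
  using assms inj_on_subset[OF assms(1), of "D \<inter> W"] by (simp add: inv_into_f_f)

lemma smooth_map_restrict:
  assumes X: "modelled X" and N: "modelled N" and f: "smooth_map X N f"
  shows "smooth_map (open_submanifold X W) N f"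
proof (rule smooth_mapI, goal_cases)
  case 1
  show ?case using smooth_mapD(1)[OF f] by (simp add: continuous_map_from_subtopology)
next
  case (2 DW \<phi> D' \<psi>)
  then obtain D where DW: "DW = D \<inter> W" and D: "(D, \<phi>) \<in> atlas X" by auto
  note XD = modelled_chart[OF X D]
  have "bgn_smooth (model X) (model N) (\<phi> ` (D \<inter> W \<inter> f -` D')) (\<psi> \<circ> f \<circ> inv_into (D \<inter> W) \<phi>)"
  proof (rule bgn_smooth_cong[OF modelledD(1)[OF X] modelledD(1)[OF N]])
    show "bgn_smooth (model X) (model N) (\<phi> ` (D \<inter> W \<inter> f -` D')) (\<psi> \<circ> f \<circ> inv_into D \<phi>)"
      by (rule bgn_smooth_subset[OF modelledD(1)[OF X] modelledD(1)[OF N] chart_image_carrier[OF X D]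
            smooth_mapD(2)[OF f D 2(2)]]) auto
  qed (use XD in \<open>auto simp: inv_into_Int\<close>)
  then show ?case by (simp add: DW)
qed

lemma smooth_map_locally:
  assumes X: "open_charts X" and N: "modelled N"
    and loc: "\<And>x. x \<in> topspace (mtop X) \<Longrightarrow> \<exists>W. openin (mtop X) W \<and> x \<in> W \<and> smooth_map (open_submanifold X W) N f"
  shows "smooth_map X N f"
proof (rule smooth_map_locallyI[OF X N])
  let ?\<A> = "{W. openin (mtop X) W \<and> smooth_map (open_submanifold X W) N f}"
  have "continuous_map (subtopology (mtop X) (\<Union>?\<A>)) (mtop N) f"
    using smooth_mapD(1) by (intro continuous_map_open_cover) force+
  moreover have "topspace (mtop X) \<subseteq> \<Union>?\<A>" using loc by blast
  ultimately show fc: "continuous_map (mtop X) (mtop N) f"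
    by (simp add: subtopology_superset)
  fix D \<phi> D' \<psi> x assume D: "(D, \<phi>) \<in> atlas X" and D': "(D', \<psi>) \<in> atlas N" and x: "x \<in> D" "f x \<in> D'"
  note XD = modelled_chart[OF open_chartsD[OF X] D]
  obtain W where W: "openin (mtop X) W" "x \<in> W" "smooth_map (open_submanifold X W) N f"
    using loc x XD(4) by blast
  let ?W = "D \<inter> W \<inter> f -` D'"
  have "bgn_smooth (model X) (model N) (\<phi> ` ?W) (\<psi> \<circ> f \<circ> inv_into (D \<inter> W) \<phi>)"
    using smooth_mapD(2)[OF W(3) _ D', of "D \<inter> W" \<phi>] D by auto
  then have "bgn_smooth (model X) (model N) (\<phi> ` ?W) (\<psi> \<circ> f \<circ> inv_into D \<phi>)"
    by (rule bgn_smooth_cong[OF modelledD(1)[OF open_chartsD[OF X]] modelledD(1)[OF N], rotated])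
      (use XD in \<open>auto simp: inv_into_Int\<close>)
  moreover have "openin (mtop X) ?W"
    using XD(1) W(1) by (intro openin_preimage_Int[OF _ fc modelled_chart(1)[OF N D']]) auto
  ultimately show "\<exists>W. openin (mtop X) W \<and> x \<in> W \<and> W \<subseteq> D \<inter> f -` D' \<and>
      bgn_smooth (model X) (model N) (\<phi> ` W) (\<psi> \<circ> f \<circ> inv_into D \<phi>)"
    using W x by (intro exI[of _ ?W]) auto
qed

lemma smooth_map_into_submanifold:
  assumes X: "modelled X" and f: "smooth_map X N f" "f ` topspace (mtop X) \<subseteq> W"
  shows "smooth_map X (open_submanifold N W) f"
proof (rule smooth_mapI, goal_cases)
  case 1
  show ?case using smooth_mapD(1)[OF f(1)] f(2) by (auto simp: continuous_map_in_subtopology)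
next
  case (2 D \<phi> DW \<psi>)
  then obtain D' where DW: "DW = D' \<inter> W" and D': "(D', \<psi>) \<in> atlas N" by auto
  note XD = modelled_chart[OF X 2(1)]
  have sub: "D \<inter> f -` (D' \<inter> W) = D \<inter> f -` D'" using XD(4) f(2) by auto
  show ?case unfolding DW sub using smooth_mapD(2)[OF f(1) 2(1) D'] by simp
qed

lemma smooth_map_const:
  assumes "modelled X" "modelled N" "c \<in> topspace (mtop N)" shows "smooth_map X N (\<lambda>_. c)"
proof (rule smooth_mapI, goal_cases)
  case 1
  show ?case using assms(3) by simp
next
  case (2 D \<phi> D' \<psi>)
  show ?case
  proof (cases "c \<in> D'")
    case True
    then have "\<psi> c \<in> carrier (model N)" using modelled_chart(3)[OF assms(2) 2(2)] by blast
    from bgn_smooth_const[OF modelledD(1)[OF assms(1)] modelledD(1)[OF assms(2)]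
        chart_image_carrier[OF assms(1) 2(1)] this]
    show ?thesis by (simp add: o_def)
  next
    case False
    have "bgn_smooth (model X) (model N) {} (\<psi> \<circ> (\<lambda>_. c) \<circ> inv_into D \<phi>)"
      by (rule bgn_smooth_locally[OF modelledD(1)[OF assms(1)] modelledD(1)[OF assms(2)]]) simp
    then show ?thesis using False by simp
  qed
qed

lemma smooth_map_pair:
  assumes X: "modelled X" and N: "modelled N" and P: "modelled P"
    and f: "smooth_map X N f" and g: "smooth_map X P g"
  shows "smooth_map X (manifold_prod N P) (\<lambda>x. (f x, g x))"
proof (rule smooth_mapI, goal_cases)
  case 1
  show ?case using smooth_mapD(1)[OF f] smooth_mapD(1)[OF g]
    by (simp add: manifold_prod_def continuous_map_paired)
next
  case (2 D \<phi> E h)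
  then obtain D' \<psi> D'' \<xi> where k': "E = D' \<times> D''" "h = map_prod \<psi> \<xi>" "(D', \<psi>) \<in> atlas N" "(D'', \<xi>) \<in> atlas P"
    by (auto simp: manifold_prod_def)
  note D = 2(1)
  note tv = modelledD(1)[OF X] modelledD(1)[OF N] modelledD(1)[OF P]
  let ?S = "\<phi> ` (D \<inter> (\<lambda>x. (f x, g x)) -` (D' \<times> D''))"
  have "bgn_smooth (model X) (model N) ?S (\<psi> \<circ> f \<circ> inv_into D \<phi>)"
    by (rule bgn_smooth_subset[OF tv(1,2) chart_image_carrier[OF X D] smooth_mapD(2)[OF f D k'(3)]]) auto
  moreover have "bgn_smooth (model X) (model P) ?S (\<xi> \<circ> g \<circ> inv_into D \<phi>)"
    by (rule bgn_smooth_subset[OF tv(1,3) chart_image_carrier[OF X D] smooth_mapD(2)[OF g D k'(4)]]) auto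
  ultimately have "bgn_smooth (model X) (tvs_prod (model N) (model P)) ?S
      (\<lambda>z. ((\<psi> \<circ> f \<circ> inv_into D \<phi>) z, (\<xi> \<circ> g \<circ> inv_into D \<phi>) z))"
    by (rule bgn_smooth_pair[OF tv chart_image_carrier[OF X D]])
  then show ?case unfolding k'(1,2) by (simp add: manifold_prod_def o_def)
qed

lemma smooth_map_tuple:
  assumes X: "modelled X" and M: "modelled M" and f: "\<And>l. l \<le> q \<Longrightarrow> smooth_map X M (f l)"
  shows "smooth_map X (manifold_power M q) (\<lambda>x. \<lambda>l\<in>{..q}. f l x)"
proof (rule smooth_mapI, goal_cases)
  case 1
  show ?case using smooth_mapD(1)[OF f] by (auto simp: continuous_map_componentwise extensional_def)
next
  case (2 D \<phi> D' \<psi>)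
  obtain c where c: "c \<in> {..q} \<rightarrow> atlas M"
    and k': "D' = (\<Pi>\<^sub>E i\<in>{..q}. fst (c i))" "\<psi> = (\<lambda>x. \<lambda>i\<in>{..q}. snd (c i) (x i))"
    using 2(2) by (rule power_chartE)
  note D = 2(1)
  note tv = modelledD(1)[OF X] modelledD(1)[OF M]
  let ?S = "\<phi> ` (D \<inter> (\<lambda>x. \<lambda>l\<in>{..q}. f l x) -` (\<Pi>\<^sub>E i\<in>{..q}. fst (c i)))"
  have "bgn_smooth (model X) (model M) ?S (snd (c l) \<circ> f l \<circ> inv_into D \<phi>)" if l: "l \<le> q" for l
  proof -
    have cl: "(fst (c l), snd (c l)) \<in> atlas M" using c l by auto
    show ?thesis
      by (rule bgn_smooth_subset[OF tv chart_image_carrier[OF X D] smooth_mapD(2)[OF f[OF l] D cl]])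
        (use l in \<open>auto simp: PiE_iff\<close>)
  qed
  from bgn_smooth_tuple[OF tv chart_image_carrier[OF X D] this]
  have "bgn_smooth (model X) (tvs_power (model M) q) ?S (\<lambda>z. \<lambda>l\<in>{..q}. (snd (c l) \<circ> f l \<circ> inv_into D \<phi>) z)" .
  moreover have "(\<lambda>z. \<lambda>l\<in>{..q}. (snd (c l) \<circ> f l \<circ> inv_into D \<phi>) z) =
      (\<lambda>x. \<lambda>i\<in>{..q}. snd (c i) (x i)) \<circ> (\<lambda>x. \<lambda>l\<in>{..q}. f l x) \<circ> inv_into D \<phi>"
    by (auto simp: fun_eq_iff restrict_def)
  ultimately show ?case unfolding k' by simp
qed

text \<open>In charts a projection is a projection of the model space followed by a transition map, as the charts of
  the source and of the target need not match.\<close>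

lemma smooth_map_proj:
  assumes M: "manifold M" and l: "l \<le> q"
  shows "smooth_map (manifold_power M q) M (\<lambda>u. u l)"
proof (rule smooth_mapI, goal_cases)
  case 1
  show ?case using l by (auto intro: continuous_map_product_projection)
next
  case (2 D \<phi> D' \<psi>)
  obtain c where c: "c \<in> {..q} \<rightarrow> atlas M"
    and k: "D = (\<Pi>\<^sub>E i\<in>{..q}. fst (c i))" "\<phi> = (\<lambda>x. \<lambda>i\<in>{..q}. snd (c i) (x i))"
    using 2(1) by (rule power_chartE)
  let ?D = "\<Pi>\<^sub>E i\<in>{..q}. fst (c i)" and ?\<phi> = "\<lambda>x. \<lambda>i\<in>{..q}. snd (c i) (x i)"
  have mod: "modelled M" "modelled (manifold_power M q)"
    using open_charts_manifold[OF M] open_charts_power open_chartsD by blast+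
  note tv = modelledD(1)[OF mod(1)] tvs_power[OF modelledD(1)[OF mod(1)]]
  have cl: "(fst (c l), snd (c l)) \<in> atlas M" using c l by auto
  note Mc = modelled_chart[OF mod(1) cl]
  have D: "(?D, ?\<phi>) \<in> atlas (manifold_power M q)" using 2(1) unfolding k .
  note PD = modelled_chart[OF mod(2) D]
  let ?S = "?\<phi> ` (?D \<inter> (\<lambda>u. u l) -` D')"
  have S: "?S \<subseteq> carrier (tvs_power (model M) q)" using PD(3) by auto
  have "clin (tvs_power (model M) q) (model M) (\<lambda>z. z l)"
    using l by (auto simp: clin_def intro: continuous_map_product_projection)
  from bgn_smooth_linear[OF tv(2,1) S this] have "bgn_smooth (tvs_power (model M) q) (model M) ?S (\<lambda>z. z l)" .
  moreover have "bgn_smooth (model M) (model M) (snd (c l) ` (fst (c l) \<inter> D')) (\<psi> \<circ> inv_into (fst (c l)) (snd (c l)))"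
    using manifold.transition_smooth[OF M cl 2(2)] .
  moreover have "(\<lambda>z. z l) ` ?S \<subseteq> snd (c l) ` (fst (c l) \<inter> D')" using l by (auto simp: PiE_iff)
  ultimately have "bgn_smooth (tvs_power (model M) q) (model M) ?S
      (\<lambda>z. (\<psi> \<circ> inv_into (fst (c l)) (snd (c l))) (z l))"
    by (rule bgn_smooth_compose[OF tv(2,1,1) S chart_image_carrier[OF mod(1) cl]])
  then have "bgn_smooth (tvs_power (model M) q) (model M) ?S (\<psi> \<circ> (\<lambda>u. u l) \<circ> inv_into ?D ?\<phi>)"
  proof (rule bgn_smooth_cong[OF tv(2,1) S])
    fix z assume "z \<in> ?S"
    then obtain u where u: "u \<in> ?D" "u l \<in> D'" "z = ?\<phi> u" by blast
    have "inv_into ?D ?\<phi> z = u" unfolding u(3) using PD(2) u(1) by (rule inv_into_f_f)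
    moreover have "inv_into (fst (c l)) (snd (c l)) (z l) = u l"
      unfolding u(3) using Mc(2) u(1) l by (auto simp: PiE_iff inv_into_f_f)
    ultimately show "(\<psi> \<circ> inv_into (fst (c l)) (snd (c l))) (z l) = (\<psi> \<circ> (\<lambda>u. u l) \<circ> inv_into ?D ?\<phi>) z" by simp
  qed
  then show ?case unfolding k by simp
qed

lemma smooth_map_real_iff:
  assumes "modelled X"
  shows "smooth_map X real_line f \<longleftrightarrow> continuous_map (mtop X) euclideanreal f \<and>
    (\<forall>(D, \<phi>)\<in>atlas X. bgn_smooth (model X) real_tvs (\<phi> ` D) (\<lambda>z. f (inv_into D \<phi> z)))"
  by (simp add: smooth_map_def real_line_def o_def)

lemma smooth_map_add:
  assumes X: "modelled X" and f: "smooth_map X real_line f" and g: "smooth_map X real_line g"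
  shows "smooth_map X real_line (\<lambda>x. f x + g x)"
proof -
  have "bgn_smooth (model X) real_tvs (\<phi> ` D) (\<lambda>z. f (inv_into D \<phi> z) + g (inv_into D \<phi> z))"
    if D: "(D, \<phi>) \<in> atlas X" for D \<phi>
    using bgn_smooth_add[OF modelledD(1)[OF X] tvs_real modelled_chart(3)[OF X D],
        of "\<lambda>z. f (inv_into D \<phi> z)" "\<lambda>z. g (inv_into D \<phi> z)"] f g D
    unfolding smooth_map_real_iff[OF X] by auto
  then show ?thesis
    using f g unfolding smooth_map_real_iff[OF X] by (auto intro!: continuous_map_add)
qed

lemma smooth_map_sum:
  assumes X: "modelled X" and "finite F" "\<And>i. i \<in> F \<Longrightarrow> smooth_map X real_line (f i)"
  shows "smooth_map X real_line (\<lambda>x. \<Sum>i\<in>F. f i x)"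
  using assms(2,3)
proof (induction F rule: finite_induct)
  case empty
  show ?case
    using smooth_map_const[OF X open_chartsD[OF open_charts_real_line], of 0] by (simp add: real_line_def)
next
  case (insert i F)
  then show ?case by (simp add: smooth_map_add[OF X])
qed

text \<open>A smooth function \<open>\<real> \<rightarrow> [0,1]\<close> with the values \<open>0\<close> at \<open>0\<close> and \<open>1\<close> at \<open>1\<close>. It makes
  sense of the contraction at all real parameters. Being rational, it is seen to be smooth by the quotient rule
  alone.\<close>

definition unit_bump :: "real \<Rightarrow> real" where
  "unit_bump s = (2 * s * inverse (1 + s * s)) * (2 * s * inverse (1 + s * s))"

lemma unit_bump_0 [simp]: "unit_bump 0 = 0" and unit_bump_1 [simp]: "unit_bump 1 = 1"
  by (simp_all add: unit_bump_def)

lemma unit_bump_bounds: "0 \<le> unit_bump s \<and> unit_bump s \<le> 1"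
proof -
  have pos: "0 < 1 + s * s" by (simp add: add_pos_nonneg)
  have "0 \<le> (1 - s) * (1 - s)" "0 \<le> (1 + s) * (1 + s)" by simp_all
  then have "\<bar>2 * s\<bar> \<le> 1 + s * s" by (simp add: algebra_simps abs_le_iff)
  then have "\<bar>2 * s * inverse (1 + s * s)\<bar> \<le> 1" using pos by (simp add: abs_mult divide_simps)
  then have "(2 * s * inverse (1 + s * s))\<^sup>2 \<le> 1" by (simp add: abs_square_le_1)
  then have "unit_bump s \<le> 1" unfolding unit_bump_def power2_eq_square .
  moreover have "0 \<le> unit_bump s" unfolding unit_bump_def by (rule zero_le_square)
  ultimately show ?thesis by simp
qed

lemma smooth_unit_bump: "smooth_map real_line unit_interval unit_bump"
proof -
  let ?S = "\<lambda>f. bgn_smooth real_tvs real_tvs UNIV f"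
  note c = tvs_real subset_UNIV[of UNIV, folded real_tvs_simps(1)]
  have id: "?S (\<lambda>x. x)" using bgn_smooth_linear[OF tvs_real tvs_real, of UNIV "\<lambda>x. x"] by (simp add: clin_def)
  have const: "?S (\<lambda>_. a)" for a using bgn_smooth_const[OF tvs_real tvs_real, of UNIV a] by simp
  have mult: "?S f \<Longrightarrow> ?S g \<Longrightarrow> ?S (\<lambda>x. f x * g x)" for f g
    using bgn_smooth_scale[OF tvs_real tvs_real, of UNIV f g] by simp
  have add: "?S f \<Longrightarrow> ?S g \<Longrightarrow> ?S (\<lambda>x. f x + g x)" for f g
    using bgn_smooth_add[OF tvs_real tvs_real, of UNIV f g] by simp
  have "1 + s * s \<noteq> 0" for s :: real using zero_le_square[of s] by linarith
  then have inv: "?S (\<lambda>s. inverse (1 + s * s))"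
    using bgn_smooth_inverse[OF tvs_real, of UNIV "\<lambda>s. 1 + s * s"] add[OF const mult[OF id id]] by simp
  have bump: "?S unit_bump"
    unfolding unit_bump_def[abs_def] by (rule mult; rule mult[OF mult[OF const id] inv])
  have "continuous_map euclideanreal euclideanreal unit_bump"
    using bgn_smooth_continuous[OF tvs_real tvs_real _ bump] by simp
  then have "continuous_map (mtop real_line) (mtop unit_interval) unit_bump"
    using unit_bump_bounds by (auto simp: real_line_def unit_interval_def continuous_map_in_subtopology)
  moreover have "unit_bump -` {0..1} = UNIV" using unit_bump_bounds by auto
  ultimately show ?thesis
    using bump by (simp add: smooth_map_def real_line_def unit_interval_def)
qed


section \<open>The edges of the double complex\<close>

text \<open>The edges consist of functions of points or of indices, the double complex of functions of pairs, whose other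
  component is the empty tuple. Properties of subgroups are pulled back along this relabelling.\<close>

lemma (in comm_group) relabel_subgroup:
  assumes "\<pi> ` S \<subseteq> T" "subgroup H (product_group S (\<lambda>_. G))"
  shows "subgroup {f \<in> T \<rightarrow>\<^sub>E carrier G. (\<lambda>x\<in>S. f (\<pi> x)) \<in> H} (product_group T (\<lambda>_. G))"
proof -
  interpret S: comm_group "product_group S (\<lambda>_. G)" by (rule comm_group_product_group)
  interpret T: comm_group "product_group T (\<lambda>_. G)" by (rule comm_group_product_group)
  have mult: "(\<lambda>x\<in>S. (\<lambda>y\<in>T. f y \<otimes> g y) (\<pi> x)) = (\<lambda>x\<in>S. (\<lambda>x\<in>S. f (\<pi> x)) x \<otimes> (\<lambda>x\<in>S. g (\<pi> x)) x)" for f g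
    using assms(1) by (auto simp: fun_eq_iff)
  show ?thesis
  proof (rule T.subgroupI)
    have "(\<lambda>x\<in>S. (\<lambda>y\<in>T. \<one>) (\<pi> x)) = (\<lambda>x\<in>S. \<one>)" using assms(1) by (auto simp: fun_eq_iff)
    then have "(\<lambda>y\<in>T. \<one>) \<in> {f \<in> T \<rightarrow>\<^sub>E carrier G. (\<lambda>x\<in>S. f (\<pi> x)) \<in> H}"
      using subgroup.one_closed[OF assms(2)] by simp
    then show "{f \<in> T \<rightarrow>\<^sub>E carrier G. (\<lambda>x\<in>S. f (\<pi> x)) \<in> H} \<noteq> {}" by blast
  next
    fix f assume f: "f \<in> {f \<in> T \<rightarrow>\<^sub>E carrier G. (\<lambda>x\<in>S. f (\<pi> x)) \<in> H}"
    then have fT: "f \<in> T \<rightarrow>\<^sub>E carrier G" by simp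
    have inv: "inv\<^bsub>product_group T (\<lambda>_. G)\<^esub> f = (\<lambda>y\<in>T. inv f y)"
      using fT by (intro inv_product_group) (auto simp: is_group)
    have rel: "(\<lambda>x\<in>S. f (\<pi> x)) \<in> S \<rightarrow>\<^sub>E carrier G" using fT assms(1) by (auto simp: PiE_iff)
    have "(\<lambda>x\<in>S. (\<lambda>y\<in>T. inv f y) (\<pi> x)) = (\<lambda>x\<in>S. inv (\<lambda>x\<in>S. f (\<pi> x)) x)"
      using assms(1) by (auto simp: fun_eq_iff)
    also have "\<dots> = inv\<^bsub>product_group S (\<lambda>_. G)\<^esub> (\<lambda>x\<in>S. f (\<pi> x))"
      using rel by (intro inv_product_group[symmetric]) (auto simp: is_group)
    also have "\<dots> \<in> H" using f subgroup.m_inv_closed[OF assms(2)] by simp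
    finally show "inv\<^bsub>product_group T (\<lambda>_. G)\<^esub> f \<in> {f \<in> T \<rightarrow>\<^sub>E carrier G. (\<lambda>x\<in>S. f (\<pi> x)) \<in> H}"
      using fT unfolding inv by (auto simp: PiE_iff)
  next
    fix f g assume fg: "f \<in> {f \<in> T \<rightarrow>\<^sub>E carrier G. (\<lambda>x\<in>S. f (\<pi> x)) \<in> H}" "g \<in> {f \<in> T \<rightarrow>\<^sub>E carrier G. (\<lambda>x\<in>S. f (\<pi> x)) \<in> H}"
    have "(\<lambda>x\<in>S. (\<lambda>y\<in>T. f y \<otimes> g y) (\<pi> x)) \<in> H"
      unfolding mult using subgroup.m_closed[OF assms(2), of "\<lambda>x\<in>S. f (\<pi> x)" "\<lambda>x\<in>S. g (\<pi> x)"] fg by simp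
    then show "f \<otimes>\<^bsub>product_group T (\<lambda>_. G)\<^esub> g \<in> {f \<in> T \<rightarrow>\<^sub>E carrier G. (\<lambda>x\<in>S. f (\<pi> x)) \<in> H}"
      using fg by (auto simp: PiE_iff)
  qed auto
qed

text \<open>The adjacent transpositions generate the symmetric group.\<close>

lemma (in comm_group) alternating_sign_iff:
  fixes v :: "(nat \<Rightarrow> 'i) \<Rightarrow> 'a"
  assumes T: "\<And>i \<sigma>. i \<in> T \<Longrightarrow> \<sigma> permutes {..p} \<Longrightarrow> i \<circ> \<sigma> \<in> T"
    and v: "\<And>i. i \<in> T \<Longrightarrow> v i \<in> carrier G"
  shows "(\<forall>i\<in>T. \<forall>\<sigma>. \<sigma> permutes {..p} \<longrightarrow> v (i \<circ> \<sigma>) = v i [^] sign \<sigma>) \<longleftrightarrow>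
    (\<forall>i\<in>T. \<forall>k<p. v (i \<circ> adj k) = inv v i)" (is "?L \<longleftrightarrow> ?R")
proof -
  define Q where "Q \<sigma> \<longleftrightarrow> (\<forall>i\<in>T. v (i \<circ> \<sigma>) = v i [^] sign \<sigma>)" for \<sigma>
  have adj_perm: "adj k permutes {..p}" if "k < p" for k using that by (intro permutes_swap_id) auto
  have Q_adj: "Q (adj k) \<longleftrightarrow> (\<forall>i\<in>T. v (i \<circ> adj k) = inv v i)" for k
    using v by (auto simp: Q_def sign_swap_id int_pow_neg)
  show ?thesis
  proof
    assume ?L
    then show ?R using Q_adj adj_perm unfolding Q_def by blast
  next
    assume R: ?R
    have comp: "Q (\<sigma> \<circ> \<rho>)" if "Q \<sigma>" "Q \<rho>" "\<sigma> permutes {..p}" "\<rho> permutes {..p}" for \<sigma> \<rho>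
      unfolding Q_def
    proof
      fix i assume i: "i \<in> T"
      have perm: "permutation \<sigma>" "permutation \<rho>" using that(3,4) by (auto simp: permutation_permutes)
      have "v (i \<circ> (\<sigma> \<circ> \<rho>)) = v ((i \<circ> \<sigma>) \<circ> \<rho>)" by (simp add: comp_assoc)
      also have "\<dots> = (v i [^] sign \<sigma>) [^] sign \<rho>"
        using that(1,2) i T[OF i that(3)] unfolding Q_def by simp
      also have "\<dots> = v i [^] sign (\<sigma> \<circ> \<rho>)"
        using v[OF i] perm by (simp add: int_pow_pow sign_compose)
      finally show "v (i \<circ> (\<sigma> \<circ> \<rho>)) = v i [^] sign (\<sigma> \<circ> \<rho>)" .
    qed
    have Qk: "Q (adj k)" if "k < p" for k using R that unfolding Q_adj by blast
    have trans_perm: "Transposition.transpose a b permutes {..p}" if "a \<le> p" "b \<le> p" for a b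
      using that by (intro permutes_swap_id) auto
    have Q_less: "Q (Transposition.transpose a (a + Suc n))" if "a + Suc n \<le> p" for a n
      using that
    proof (induction n)
      case 0
      then show ?case using Qk[of a] by simp
    next
      case (Suc n)
      let ?b = "a + Suc n"
      have "Q (adj ?b \<circ> Transposition.transpose a ?b \<circ> adj ?b)"
        using Suc by (intro comp Qk permutes_compose[OF trans_perm trans_perm] trans_perm adj_perm) auto
      moreover have "adj ?b \<circ> Transposition.transpose a ?b \<circ> adj ?b = Transposition.transpose a (Suc ?b)"
        using transpose_comp_triple[of "Suc ?b" a ?b] by (simp add: transpose_commute)
      ultimately show ?case by simp
    qed
    have Q_trans: "Q (Transposition.transpose a b)" if "a \<le> p" "b \<le> p" "a \<noteq> b" for a b
    proof (cases "a < b")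
      case True
      then show ?thesis using Q_less[of a "b - a - 1"] that by simp
    next
      case False
      then show ?thesis using Q_less[of b "a - b - 1"] that by (simp add: transpose_commute)
    qed
    have "Q \<sigma>" if "\<sigma> permutes {..p}" for \<sigma>
      using that finite_atMost
    proof (induction rule: permutes_induct)
      case id
      show ?case using v unfolding Q_def by (simp only: comp_id sign_id int_pow_1) simp
    next
      case (swap a b \<sigma>)
      then show ?case by (intro comp Q_trans trans_perm) auto
    qed
    then show ?L unfolding Q_def by blast
  qed
qed

lemma face_eq_del: "face q k u = del (Suc q) k u"
  by (simp add: face_def del_def lessThan_Suc_atMost)

lemma alt_diff_eq_asum:
  "alt_diff V S q f = (\<lambda>u\<in>S (Suc q). asum V (Suc q) f u)"
  by (simp add: alt_diff_def asum_def face_eq_del)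

definition (in dowker) reg_group :: "(nat \<Rightarrow> (nat \<Rightarrow> 'm) set \<Rightarrow> ((nat \<Rightarrow> 'm) \<Rightarrow> 'v) \<Rightarrow> bool) \<Rightarrow> nat \<Rightarrow>
    ((nat \<Rightarrow> 'm) \<Rightarrow> 'v) monoid" where
  "reg_group P q = (product_group (cov_power I U q) (\<lambda>_. V))\<lparr>carrier :=
     {f \<in> cov_power I U q \<rightarrow>\<^sub>E carrier V. P (Suc q) (cov_power I U q) f}\<rparr>"

context regular_dowker
begin

lemma inc_left_edge: "(i, u) \<in> inc 0 (Suc q) \<longleftrightarrow> i = (\<lambda>_. undefined) \<and> u \<in> cov_power I U q"
proof
  assume "(i, u) \<in> inc 0 (Suc q)"
  then show "i = (\<lambda>_. undefined) \<and> u \<in> cov_power I U q"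
    by (auto simp: inc_def cov_power_def PiE_iff lessThan_Suc_atMost less_Suc_eq_le)
next
  assume "i = (\<lambda>_. undefined) \<and> u \<in> cov_power I U q"
  then obtain j where j: "j \<in> I" "u \<in> {..q} \<rightarrow>\<^sub>E U j" and i: "i = (\<lambda>_. undefined)" by (auto simp: cov_power_def)
  have "u 0 \<in> X" using j U_subset by (auto simp: PiE_iff)
  moreover have "u \<in> {..<Suc q} \<rightarrow>\<^sub>E X"
    using j U_subset[OF j(1)] by (auto simp: PiE_iff lessThan_Suc_atMost)
  moreover have "\<forall>l<Suc q. u l \<in> U j" using j by (auto simp: PiE_iff)
  ultimately show "(i, u) \<in> inc 0 (Suc q)" using j(1) i by (auto simp: inc_def)
qed

lemma inc_lower_edge: "(i, u) \<in> inc (Suc p) 0 \<longleftrightarrow> u = (\<lambda>_. undefined) \<and> i \<in> nerve_tuples I U p"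
proof
  assume iu: "(i, u) \<in> inc (Suc p) 0"
  then obtain m where "m \<in> X" "\<forall>k<Suc p. m \<in> U (i k)" by (auto simp: inc_def)
  then have "m \<in> (\<Inter>k\<in>{..p}. U (i k))" by auto
  then show "u = (\<lambda>_. undefined) \<and> i \<in> nerve_tuples I U p"
    using iu by (auto simp: inc_def nerve_tuples_def lessThan_Suc_atMost)
next
  assume iu: "u = (\<lambda>_. undefined) \<and> i \<in> nerve_tuples I U p"
  then obtain m where m: "m \<in> (\<Inter>k\<in>{..p}. U (i k))" by (auto simp: nerve_tuples_def)
  have i: "i \<in> {..<Suc p} \<rightarrow>\<^sub>E I" using iu by (simp add: nerve_tuples_def lessThan_Suc_atMost)
  then have "i 0 \<in> I" by auto
  moreover have "m \<in> U (i 0)" "\<forall>k<Suc p. m \<in> U (i k)" using m by auto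
  ultimately show "(i, u) \<in> inc (Suc p) 0" using i iu U_subset unfolding inc_def by blast
qed

text \<open>The edges of the double complex are shifted by one: the cochains of degree \<open>q\<close> depend on \<open>q + 1\<close> points
  or indices.\<close>

definition left :: "nat \<Rightarrow> ((nat \<Rightarrow> 'm) \<Rightarrow> 'v) \<Rightarrow> (nat \<Rightarrow> 'i) \<times> (nat \<Rightarrow> 'm) \<Rightarrow> 'v" where
  "left q f = (\<lambda>x\<in>inc 0 (Suc q). f (snd x))"

definition lower :: "nat \<Rightarrow> ((nat \<Rightarrow> 'i) \<Rightarrow> 'v) \<Rightarrow> (nat \<Rightarrow> 'i) \<times> (nat \<Rightarrow> 'm) \<Rightarrow> 'v" where
  "lower p v = (\<lambda>x\<in>inc (Suc p) 0. v (fst x))"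

lemma left_cochains_iff:
  assumes "f \<in> cov_power I U q \<rightarrow>\<^sub>E carrier V"
  shows "left q f \<in> cochains 0 (Suc q) \<longleftrightarrow> P (Suc q) (cov_power I U q) f"
proof -
  have slice: "{u. ((\<lambda>_. undefined), u) \<in> inc 0 (Suc q)} = cov_power I U q"
    by (auto simp: inc_left_edge)
  have "left q f \<in> inc 0 (Suc q) \<rightarrow>\<^sub>E carrier V"
    using assms by (auto simp: left_def inc_left_edge PiE_iff)
  moreover have "alternating 0 (Suc q) (left q f)" by (simp add: alternating_def)
  moreover have "P (Suc q) (cov_power I U q) (\<lambda>u. left q f (\<lambda>_. undefined, u)) \<longleftrightarrow> P (Suc q) (cov_power I U q) f"
    using reg_cong[of q "cov_power I U q" f "\<lambda>u. left q f (\<lambda>_. undefined, u)"]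
      reg_cong[of q "cov_power I U q" "\<lambda>u. left q f (\<lambda>_. undefined, u)" f]
    by (auto simp: left_def inc_left_edge)
  ultimately show ?thesis by (simp add: cochains_def slice)
qed

lemma lower_cochains_iff:
  assumes v: "v \<in> nerve_tuples I U p \<rightarrow>\<^sub>E carrier V"
  shows "lower p v \<in> cochains (Suc p) 0 \<longleftrightarrow> v \<in> carrier (cech I U V p)"
proof -
  have closed: "i \<circ> \<sigma> \<in> nerve_tuples I U p" if i: "i \<in> nerve_tuples I U p" and s: "\<sigma> permutes {..p}" for i \<sigma>
  proof -
    have "i \<circ> \<sigma> \<in> {..p} \<rightarrow>\<^sub>E I"
    proof (rule PiE_I)
      fix k assume "k \<in> {..p}"
      then show "(i \<circ> \<sigma>) k \<in> I" using i permutes_in_image[OF s] by (auto simp: nerve_tuples_def PiE_iff)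
    next
      fix k assume k: "k \<notin> {..p}"
      then have "\<sigma> k = k" using s by (auto simp: permutes_def)
      then show "(i \<circ> \<sigma>) k = undefined" using i k by (auto simp: nerve_tuples_def PiE_iff extensional_def)
    qed
    moreover have "(\<Inter>k\<in>{..p}. U ((i \<circ> \<sigma>) k)) = (\<Inter>k\<in>\<sigma> ` {..p}. U (i k))" by auto
    ultimately show ?thesis using i permutes_image[OF s] by (simp add: nerve_tuples_def)
  qed
  have "v i \<in> carrier V" if "i \<in> nerve_tuples I U p" for i using v that by (rule PiE_mem)
  from alternating_sign_iff[of "nerve_tuples I U p" p v, OF closed this] have
    "v \<in> carrier (cech I U V p) \<longleftrightarrow> (\<forall>i\<in>nerve_tuples I U p. \<forall>k<p. v (i \<circ> adj k) = inv v i)"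
    using v by (simp add: cech_def)
  also have "\<dots> \<longleftrightarrow> alternating (Suc p) 0 (lower p v)"
    unfolding alternating_def by (auto simp: lower_def inc_adj_iff) (auto simp: inc_lower_edge)
  also have "\<dots> \<longleftrightarrow> lower p v \<in> cochains (Suc p) 0"
    using v by (auto simp: cochains_def lower_def inc_lower_edge PiE_iff)
  finally show ?thesis by simp
qed

lemma left_onto:
  assumes F: "F \<in> cochains 0 (Suc q)"
  shows "\<exists>f\<in>carrier (reg_group P q). left q f = F"
proof -
  let ?f = "\<lambda>u\<in>cov_power I U q. F (\<lambda>_. undefined, u)"
  have f: "?f \<in> cov_power I U q \<rightarrow>\<^sub>E carrier V"
    using cochains_closed[OF F] by (auto simp: inc_left_edge)
  moreover have "left q ?f = F"
    by (rule extensionalityI[of _ "inc 0 (Suc q)"])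
      (use cochains_carrier[OF F] in \<open>auto simp: left_def inc_left_edge PiE_def\<close>)
  ultimately show ?thesis
    using F left_cochains_iff[OF f] by (intro bexI[of _ ?f]) (auto simp: reg_group_def)
qed

lemma lower_onto:
  assumes F: "F \<in> cochains (Suc p) 0"
  shows "\<exists>v\<in>carrier (cech I U V p). lower p v = F"
proof -
  let ?v = "\<lambda>i\<in>nerve_tuples I U p. F (i, \<lambda>_. undefined)"
  have v: "?v \<in> nerve_tuples I U p \<rightarrow>\<^sub>E carrier V"
    using cochains_closed[OF F] by (auto simp: inc_lower_edge)
  moreover have "lower p ?v = F"
    by (rule extensionalityI[of _ "inc (Suc p) 0"])
      (use cochains_carrier[OF F] in \<open>auto simp: lower_def inc_lower_edge PiE_def\<close>)
  ultimately show ?thesis using F lower_cochains_iff[OF v] by (intro bexI[of _ ?v]) auto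
qed

lemma left_inj:
  assumes "f \<in> cov_power I U q \<rightarrow>\<^sub>E carrier V" "g \<in> cov_power I U q \<rightarrow>\<^sub>E carrier V" "left q f = left q g"
  shows "f = g"
proof (rule PiE_ext[OF assms(1,2)])
  fix u assume "u \<in> cov_power I U q"
  then show "f u = g u" using fun_cong[OF assms(3), of "(\<lambda>_. undefined, u)"] by (simp add: left_def inc_left_edge)
qed

lemma lower_inj:
  assumes "v \<in> nerve_tuples I U p \<rightarrow>\<^sub>E carrier V" "w \<in> nerve_tuples I U p \<rightarrow>\<^sub>E carrier V" "lower p v = lower p w"
  shows "v = w"
proof (rule PiE_ext[OF assms(1,2)])
  fix i assume "i \<in> nerve_tuples I U p"
  then show "v i = w i" using fun_cong[OF assms(3), of "(i, \<lambda>_. undefined)"] by (simp add: lower_def inc_lower_edge)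
qed

lemma left_mult: "left q (\<lambda>u\<in>cov_power I U q. f u \<otimes> g u) = (\<lambda>x\<in>inc 0 (Suc q). left q f x \<otimes> left q g x)"
  by (auto simp: left_def inc_left_edge fun_eq_iff)

lemma lower_mult: "lower p (\<lambda>i\<in>nerve_tuples I U p. f i \<otimes> g i) = (\<lambda>x\<in>inc (Suc p) 0. lower p f x \<otimes> lower p g x)"
  by (auto simp: lower_def inc_lower_edge fun_eq_iff)

lemma left_diff:
  assumes f: "f \<in> cov_power I U q \<rightarrow>\<^sub>E carrier V"
  shows "left (Suc q) (alt_diff V (cov_power I U) q f) = dv 0 (Suc q) (left q f)"
proof (rule extensionalityI[of _ "inc 0 (Suc (Suc q))"])
  fix x assume x: "x \<in> inc 0 (Suc (Suc q))"
  obtain i u where iu: "x = (i, u)" by force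
  have lf: "left q f \<in> inc 0 (Suc q) \<rightarrow>\<^sub>E carrier V"
    using f by (auto simp: left_def inc_left_edge PiE_iff)
  have "asum V (Suc q) f u = asum V (Suc q) (\<lambda>u. tot 0 (Suc q) (left q f) i u) u"
    using x inc_del_right tot_closed[OF lf] unfolding iu
    by (intro asum_cong) (auto simp: tot_inc left_def)
  then show "left (Suc q) (alt_diff V (cov_power I U) q f) x = dv 0 (Suc q) (left q f) x"
    using x unfolding iu by (simp add: dv_apply left_def alt_diff_eq_asum inc_left_edge)
qed (auto simp: left_def dv_def)

lemma lower_diff:
  assumes v: "v \<in> nerve_tuples I U p \<rightarrow>\<^sub>E carrier V"
  shows "lower (Suc p) (alt_diff V (nerve_tuples I U) p v) = dh (Suc p) 0 (lower p v)"
proof (rule extensionalityI[of _ "inc (Suc (Suc p)) 0"])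
  fix x assume x: "x \<in> inc (Suc (Suc p)) 0"
  obtain i u where iu: "x = (i, u)" by force
  have lv: "lower p v \<in> inc (Suc p) 0 \<rightarrow>\<^sub>E carrier V"
    using v by (auto simp: lower_def inc_lower_edge PiE_iff)
  have "asum V (Suc p) v i = asum V (Suc p) (\<lambda>i. tot (Suc p) 0 (lower p v) i u) i"
    using x inc_del_left tot_closed[OF lv] unfolding iu
    by (intro asum_cong) (auto simp: tot_inc lower_def)
  then show "lower (Suc p) (alt_diff V (nerve_tuples I U) p v) x = dh (Suc p) 0 (lower p v) x"
    using x unfolding iu by (simp add: dh_apply lower_def alt_diff_eq_asum inc_lower_edge)
qed (auto simp: lower_def dh_def)

lemma reg_group_carrier: "carrier (reg_group P q) =
    {f \<in> cov_power I U q \<rightarrow>\<^sub>E carrier V. (\<lambda>x\<in>inc 0 (Suc q). f (snd x)) \<in> cochains 0 (Suc q)}"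
  using left_cochains_iff by (auto simp: reg_group_def left_def)

lemma cech_carrier: "carrier (cech I U V p) =
    {v \<in> nerve_tuples I U p \<rightarrow>\<^sub>E carrier V. (\<lambda>x\<in>inc (Suc p) 0. v (fst x)) \<in> cochains (Suc p) 0}"
  using lower_cochains_iff by (auto simp: lower_def) (auto simp: cech_def)

lemma reg_group_subgroup: "subgroup (carrier (reg_group P q)) (product_group (cov_power I U q) (\<lambda>_. V))"
  unfolding reg_group_carrier using cochains_subgroup by (intro relabel_subgroup) (auto simp: inc_left_edge)

lemma comm_group_reg_group: "comm_group (reg_group P q)"
proof -
  have "comm_group ((product_group (cov_power I U q) (\<lambda>_. V))\<lparr>carrier := carrier (reg_group P q)\<rparr>)"
    by (intro comm_group.subgroup_comm_group comm_group_product_group reg_group_subgroup)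
  then show ?thesis by (simp add: reg_group_def)
qed

lemma comm_group_cech: "comm_group (cech I U V p)"
proof -
  have "subgroup (carrier (cech I U V p)) (product_group (nerve_tuples I U p) (\<lambda>_. V))"
    unfolding cech_carrier using cochains_subgroup by (intro relabel_subgroup) (auto simp: inc_lower_edge)
  then have "comm_group ((product_group (nerve_tuples I U p) (\<lambda>_. V))\<lparr>carrier := carrier (cech I U V p)\<rparr>)"
    by (intro comm_group.subgroup_comm_group comm_group_product_group)
  then show ?thesis by (simp add: cech_def)
qed

lemma reg_group_simps [simp]:
  "f \<otimes>\<^bsub>reg_group P q\<^esub> g = (\<lambda>u\<in>cov_power I U q. f u \<otimes> g u)" "\<one>\<^bsub>reg_group P q\<^esub> = (\<lambda>u\<in>cov_power I U q. \<one>)"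
  by (simp_all add: reg_group_def)

lemma cech_simps [simp]:
  "f \<otimes>\<^bsub>cech I U V p\<^esub> g = (\<lambda>i\<in>nerve_tuples I U p. f i \<otimes> g i)" "\<one>\<^bsub>cech I U V p\<^esub> = (\<lambda>i\<in>nerve_tuples I U p. \<one>)"
  by (simp_all add: cech_def)

lemma reg_group_PiE: "f \<in> carrier (reg_group P q) \<Longrightarrow> f \<in> cov_power I U q \<rightarrow>\<^sub>E carrier V"
  by (simp add: reg_group_def)

lemma cech_PiE: "v \<in> carrier (cech I U V p) \<Longrightarrow> v \<in> nerve_tuples I U p \<rightarrow>\<^sub>E carrier V"
  by (simp add: cech_def)

lemma left_cochains: "f \<in> carrier (reg_group P q) \<Longrightarrow> left q f \<in> cochains 0 (Suc q)"
  by (simp add: reg_group_carrier left_def)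

lemma lower_cochains: "v \<in> carrier (cech I U V p) \<Longrightarrow> lower p v \<in> cochains (Suc p) 0"
  by (simp add: cech_carrier lower_def)

lemma left_iso: "left q \<in> iso (reg_group P q) (Gr 0 (Suc q))"
  unfolding iso_def bij_betw_def
proof (intro CollectI conjI homI)
  show "inj_on (left q) (carrier (reg_group P q))"
    using left_inj reg_group_PiE by (meson inj_onI)
  show "left q ` carrier (reg_group P q) = carrier (Gr 0 (Suc q))"
    using left_onto left_cochains by fastforce
qed (simp_all add: left_cochains left_mult)

lemma lower_iso: "lower p \<in> iso (cech I U V p) (Gr (Suc p) 0)"
  unfolding iso_def bij_betw_def
proof (intro CollectI conjI homI)
  show "inj_on (lower p) (carrier (cech I U V p))"
    using lower_inj cech_PiE by (meson inj_onI)
  show "lower p ` carrier (cech I U V p) = carrier (Gr (Suc p) 0)"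
    using lower_onto lower_cochains by fastforce
qed (simp_all add: lower_cochains lower_mult)

end

text \<open>Along an isomorphism \<open>e\<close> the cocycle and the coboundary conditions correspond to each other. That \<open>d\<close> is
  additive and that its square is trivial is inherited from \<open>\<delta>\<close>.\<close>

locale complex_iso =
  fixes C :: "nat \<Rightarrow> 'c monoid" and d :: "nat \<Rightarrow> 'c \<Rightarrow> 'c" and H :: "nat \<Rightarrow> 'h monoid" and \<delta> :: "nat \<Rightarrow> 'h \<Rightarrow> 'h"
    and e :: "nat \<Rightarrow> 'c \<Rightarrow> 'h"
  assumes C: "comm_group (C q)" and H: "comm_group (H q)"
    and e: "e q \<in> iso (C q) (H q)" and \<delta>: "\<delta> q \<in> hom (H q) (H (Suc q))"
    and \<delta>_\<delta>: "y \<in> carrier (H q) \<Longrightarrow> \<delta> (Suc q) (\<delta> q y) = \<one>\<^bsub>H (Suc (Suc q))\<^esub>"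
    and d_closed: "x \<in> carrier (C q) \<Longrightarrow> d q x \<in> carrier (C (Suc q))"
    and e_d: "x \<in> carrier (C q) \<Longrightarrow> e (Suc q) (d q x) = \<delta> q (e q x)"
begin

sublocale C: comm_group "C q" for q by (rule C)
sublocale H: comm_group "H q" for q by (rule H)
sublocale e: group_hom "C q" "H q" "e q" for q using e by unfold_locales (auto simp: iso_def)
sublocale \<delta>: group_hom "H q" "H (Suc q)" "\<delta> q" for q by unfold_locales (rule \<delta>)

lemma e_inj: "x \<in> carrier (C q) \<Longrightarrow> y \<in> carrier (C q) \<Longrightarrow> e q x = e q y \<Longrightarrow> x = y"
  using e[of q] by (auto simp: iso_def bij_betw_def inj_on_def)

lemma e_onto: "y \<in> carrier (H q) \<Longrightarrow> \<exists>x\<in>carrier (C q). e q x = y"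
proof -
  assume y: "y \<in> carrier (H q)"
  have "bij_betw (e q) (carrier (C q)) (carrier (H q))" using e[of q] by (simp add: iso_def)
  from y[folded bij_betw_imp_surj_on[OF this]] show ?thesis by (auto simp: image_iff)
qed

lemma e_one_iff: "x \<in> carrier (C q) \<Longrightarrow> e q x = \<one>\<^bsub>H q\<^esub> \<longleftrightarrow> x = \<one>\<^bsub>C q\<^esub>"
  using e_inj[of x q "\<one>\<^bsub>C q\<^esub>"] by auto

lemma d_hom: "d q \<in> hom (C q) (C (Suc q))"
proof (rule homI)
  fix x y assume "x \<in> carrier (C q)" "y \<in> carrier (C q)"
  then show "d q (x \<otimes>\<^bsub>C q\<^esub> y) = d q x \<otimes>\<^bsub>C (Suc q)\<^esub> d q y"
    by (intro e_inj) (auto simp: d_closed e_d)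
qed (rule d_closed)

sublocale d: group_hom "C q" "C (Suc q)" "d q" for q by unfold_locales (rule d_hom)

lemma cocycle_iff:
  "x \<in> kernel (C q) (C (Suc q)) (d q) \<longleftrightarrow> x \<in> carrier (C q) \<and> e q x \<in> kernel (H q) (H (Suc q)) (\<delta> q)"
proof -
  have "d q x = \<one>\<^bsub>C (Suc q)\<^esub> \<longleftrightarrow> \<delta> q (e q x) = \<one>\<^bsub>H (Suc q)\<^esub>" if "x \<in> carrier (C q)"
    using e_one_iff[OF d_closed[OF that]] e_d[OF that] by simp
  then show ?thesis by (auto simp: kernel_def)
qed

lemma coboundary_iff:
  assumes x: "x \<in> carrier (C q)"
  shows "x \<in> coboundaries C d q \<longleftrightarrow> e q x \<in> coboundaries H \<delta> q"
proof (cases q)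
  case 0
  then show ?thesis using x by (simp add: coboundaries_def e_one_iff)
next
  case (Suc p)
  show ?thesis
  proof
    assume "x \<in> coboundaries C d q"
    then obtain y where "y \<in> carrier (C p)" "x = d p y" by (auto simp: Suc coboundaries_def)
    then show "e q x \<in> coboundaries H \<delta> q" by (auto simp: Suc coboundaries_def e_d)
  next
    assume "e q x \<in> coboundaries H \<delta> q"
    then obtain z where "z \<in> carrier (H p)" "e q x = \<delta> p z" by (auto simp: Suc coboundaries_def)
    moreover then obtain y where y: "y \<in> carrier (C p)" "e p y = z" using e_onto by blast
    ultimately have "e q x = e q (d p y)" by (simp add: Suc e_d)
    then have "x = d p y" using x y(1) by (intro e_inj[of x q]) (auto simp: Suc d_closed)
    then show "x \<in> coboundaries C d q" using y(1) by (simp add: Suc coboundaries_def)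
  qed
qed

lemma cocycles_subgroup: "subgroup (kernel (C q) (C (Suc q)) (d q)) (C q)"
  by (rule d.subgroup_kernel)

lemma coboundaries_subgroup: "subgroup (coboundaries C d q) (C q)"
proof (cases q)
  case 0
  then show ?thesis using C.triv_subgroup by (simp add: coboundaries_def)
next
  case (Suc p)
  then show ?thesis using d.img_is_subgroup by (simp add: coboundaries_def)
qed

lemma coboundaries_subset: "coboundaries C d q \<subseteq> kernel (C q) (C (Suc q)) (d q)"
proof
  fix x assume x: "x \<in> coboundaries C d q"
  then have xC: "x \<in> carrier (C q)" using subgroup.subset[OF coboundaries_subgroup] by blast
  have "\<delta> q (e q x) = \<one>\<^bsub>H (Suc q)\<^esub>"
    using x xC unfolding coboundary_iff[OF xC] by (auto simp: coboundaries_def \<delta>_\<delta> split: nat.splits)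
  then show "x \<in> kernel (C q) (C (Suc q)) (d q)"
    using xC unfolding cocycle_iff by (simp add: kernel_def)
qed

end

context regular_dowker
begin

interpretation D: double_complex Gr dh dv by (rule double_complex_Gr)

abbreviation "dA \<equiv> alt_diff V (cov_power I U)"
abbreviation "dC \<equiv> alt_diff V (nerve_tuples I U)"

lemma left_complex: "complex_iso (reg_group P) dA (\<lambda>q. Gr 0 (Suc q)) (\<lambda>q. dv 0 (Suc q)) left"
proof (rule complex_iso.intro)
  fix q f assume f: "f \<in> carrier (reg_group P q)"
  have diff: "left (Suc q) (dA q f) = dv 0 (Suc q) (left q f)"
    using f by (intro left_diff reg_group_PiE)
  then show "left (Suc q) (dA q f) = dv 0 (Suc q) (left q f)" .
  have F: "left (Suc q) (dA q f) \<in> cochains 0 (Suc (Suc q))"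
    unfolding diff using left_cochains[OF f] by (rule dv_cochains)
  have "dA q f u \<in> carrier V" if u: "u \<in> cov_power I U (Suc q)" for u
  proof -
    have x: "(\<lambda>_. undefined, u) \<in> inc 0 (Suc (Suc q))" using u by (simp add: inc_left_edge)
    from cochains_closed[OF F this] show ?thesis using x by (simp add: left_def)
  qed
  then have "dA q f \<in> cov_power I U (Suc q) \<rightarrow>\<^sub>E carrier V" by (auto simp: alt_diff_def)
  then show "dA q f \<in> carrier (reg_group P (Suc q))" using F by (simp add: reg_group_carrier left_def)
qed (use left_iso comm_group_reg_group comm_group_Gr D.dv_hom D.dv_dv in auto)

lemma lower_complex: "complex_iso (cech I U V) dC (\<lambda>p. Gr (Suc p) 0) (\<lambda>p. dh (Suc p) 0) lower"
proof (rule complex_iso.intro)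
  fix p v assume v: "v \<in> carrier (cech I U V p)"
  have diff: "lower (Suc p) (dC p v) = dh (Suc p) 0 (lower p v)"
    using v by (intro lower_diff cech_PiE)
  then show "lower (Suc p) (dC p v) = dh (Suc p) 0 (lower p v)" .
  have F: "lower (Suc p) (dC p v) \<in> cochains (Suc (Suc p)) 0"
    unfolding diff using lower_cochains[OF v] by (rule dh_cochains)
  have "dC p v i \<in> carrier V" if i: "i \<in> nerve_tuples I U (Suc p)" for i
  proof -
    have x: "(i, \<lambda>_. undefined) \<in> inc (Suc (Suc p)) 0" using i by (simp add: inc_lower_edge)
    from cochains_closed[OF F this] show ?thesis using x by (simp add: lower_def)
  qed
  then have "dC p v \<in> nerve_tuples I U (Suc p) \<rightarrow>\<^sub>E carrier V" by (auto simp: alt_diff_def)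
  then show "dC p v \<in> carrier (cech I U V (Suc p))" using F by (simp add: cech_carrier lower_def)
qed (use lower_iso comm_group_cech comm_group_Gr D.dh_hom D.dh_dh in auto)

lemma cochains_corner: "cochains 0 0 = {\<one>\<^bsub>Gr 0 0\<^esub>}"
  using D.G.one_closed[of 0 0] by (auto simp: cochains_def)

lemma coboundaries_left: "coboundaries (\<lambda>q. Gr 0 (Suc q)) (\<lambda>q. dv 0 (Suc q)) q = D.donor_B 0 (Suc q)"
  by (cases q) (simp_all add: coboundaries_def D.donor_B_column D.vcob_def cochains_corner D.dv.hom_one del: one_Gr)

lemma coboundaries_lower: "coboundaries (\<lambda>p. Gr (Suc p) 0) (\<lambda>p. dh (Suc p) 0) p = D.donor_B (Suc p) 0"
  by (cases p) (simp_all add: coboundaries_def D.donor_B_row D.hcob_def cochains_corner D.dh.hom_one del: one_Gr)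

text \<open>The correspondence between cocycles that is made up of the zigzags from one edge to the other.\<close>

definition corr :: "nat \<Rightarrow> ((nat \<Rightarrow> 'm) \<Rightarrow> 'v) \<Rightarrow> ((nat \<Rightarrow> 'i) \<Rightarrow> 'v) \<Rightarrow> bool" where
  "corr q f v \<longleftrightarrow> f \<in> carrier (reg_group P q) \<and> v \<in> carrier (cech I U V q) \<and>
     zigzag Gr dh dv (Suc q) 0 (left q f) (lower q v)"

abbreviation "ZA q \<equiv> kernel (reg_group P q) (reg_group P (Suc q)) (dA q)"
abbreviation "BA q \<equiv> coboundaries (reg_group P) dA q"
abbreviation "ZC q \<equiv> kernel (cech I U V q) (cech I U V (Suc q)) (dC q)"
abbreviation "BC q \<equiv> coboundaries (cech I U V) dC q"

lemma ZA_iff: "f \<in> ZA q \<longleftrightarrow> f \<in> carrier (reg_group P q) \<and> left q f \<in> D.donor_Z 0 (Suc q)"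
proof -
  have "left q f \<in> kernel (Gr 0 (Suc q)) (Gr 0 (Suc (Suc q))) (dv 0 (Suc q)) \<longleftrightarrow> left q f \<in> D.donor_Z 0 (Suc q)"
    by (simp add: kernel_def D.donor_Z_column)
  then show ?thesis by (subst complex_iso.cocycle_iff[OF left_complex]) simp
qed

lemma ZC_iff: "v \<in> ZC q \<longleftrightarrow> v \<in> carrier (cech I U V q) \<and> lower q v \<in> D.donor_Z (Suc q) 0"
proof -
  have "lower q v \<in> kernel (Gr (Suc q) 0) (Gr (Suc (Suc q)) 0) (dh (Suc q) 0) \<longleftrightarrow> lower q v \<in> D.donor_Z (Suc q) 0"
    by (simp add: kernel_def D.donor_Z_row)
  then show ?thesis by (subst complex_iso.cocycle_iff[OF lower_complex]) simp
qed

lemma corr_total: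
  assumes "f \<in> ZA q" shows "\<exists>v\<in>ZC q. corr q f v"
proof -
  have f: "f \<in> carrier (reg_group P q)" "left q f \<in> D.donor_Z 0 (Suc q + 0)" using assms ZA_iff by simp_all
  from D.zigzag_total[OF f(2)] obtain y where y: "y \<in> D.donor_Z (Suc q) 0" "zigzag Gr dh dv (Suc q) 0 (left q f) y"
    by blast
  then have "y \<in> cochains (Suc q) 0" by (simp add: D.donor_Z_def)
  then obtain v where "v \<in> carrier (cech I U V q)" "lower q v = y" using lower_onto by blast
  then show ?thesis using y f(1) by (intro bexI[of _ v]) (simp_all add: corr_def ZC_iff)
qed

lemma corr_onto:
  assumes "v \<in> ZC q" shows "\<exists>f\<in>ZA q. corr q f v"
proof -
  have v: "v \<in> carrier (cech I U V q)" "lower q v \<in> D.donor_Z (Suc q) 0" using assms ZC_iff by simp_all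
  from D.zigzag_onto[OF v(2)] obtain x where x: "x \<in> D.donor_Z 0 (Suc q)" "zigzag Gr dh dv (Suc q) 0 x (lower q v)"
    by auto
  then have "x \<in> cochains 0 (Suc q)" by (simp add: D.donor_Z_def)
  then obtain f where "f \<in> carrier (reg_group P q)" "left q f = x" using left_onto by blast
  then show ?thesis using x v(1) by (intro bexI[of _ f]) (simp_all add: corr_def ZA_iff)
qed

lemma corr_trivial:
  assumes "corr q f v" shows "f \<in> BA q \<longleftrightarrow> v \<in> BC q"
proof -
  have fv: "f \<in> carrier (reg_group P q)" "v \<in> carrier (cech I U V q)"
    "zigzag Gr dh dv (Suc q) 0 (left q f) (lower q v)" using assms by (simp_all add: corr_def)
  show ?thesis
    unfolding complex_iso.coboundary_iff[OF left_complex fv(1)] complex_iso.coboundary_iff[OF lower_complex fv(2)]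
      coboundaries_left coboundaries_lower
    using D.zigzag_trivial[OF fv(3)] by simp
qed

lemma corr_mult:
  assumes "corr q f v" "corr q f' v'"
  shows "corr q (f \<otimes>\<^bsub>reg_group P q\<^esub> f') (v \<otimes>\<^bsub>cech I U V q\<^esub> v')"
proof -
  interpret L: complex_iso "reg_group P" dA "\<lambda>q. Gr 0 (Suc q)" "\<lambda>q. dv 0 (Suc q)" left by (rule left_complex)
  interpret R: complex_iso "cech I U V" dC "\<lambda>p. Gr (Suc p) 0" "\<lambda>p. dh (Suc p) 0" lower by (rule lower_complex)
  have "zigzag Gr dh dv (Suc q) 0 (left q f \<otimes>\<^bsub>Gr 0 (Suc q)\<^esub> left q f') (lower q v \<otimes>\<^bsub>Gr (Suc q) 0\<^esub> lower q v')"
    using D.zigzag_mult[of "Suc q" 0 "left q f" "lower q v" "left q f'" "lower q v'"] assms by (simp add: corr_def)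
  then show ?thesis
    using assms L.C.m_closed R.C.m_closed L.e.hom_mult R.e.hom_mult
    unfolding corr_def by metis
qed

lemma corr_inv:
  assumes "corr q f v" shows "corr q (inv\<^bsub>reg_group P q\<^esub> f) (inv\<^bsub>cech I U V q\<^esub> v)"
proof -
  interpret L: complex_iso "reg_group P" dA "\<lambda>q. Gr 0 (Suc q)" "\<lambda>q. dv 0 (Suc q)" left by (rule left_complex)
  interpret R: complex_iso "cech I U V" dC "\<lambda>p. Gr (Suc p) 0" "\<lambda>p. dh (Suc p) 0" lower by (rule lower_complex)
  have "zigzag Gr dh dv (Suc q) 0 (inv\<^bsub>Gr 0 (Suc q)\<^esub> left q f) (inv\<^bsub>Gr (Suc q) 0\<^esub> lower q v)"
    using D.zigzag_inv[of "Suc q" 0 "left q f" "lower q v"] assms by (simp add: corr_def)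
  then show ?thesis
    using assms L.C.inv_closed R.C.inv_closed L.e.hom_inv R.e.hom_inv
    unfolding corr_def by metis
qed

lemma cohomology_iso_cech: "cohomology (reg_group P) dA q \<cong> cohomology (cech I U V) dC q"
proof -
  interpret L: complex_iso "reg_group P" dA "\<lambda>q. Gr 0 (Suc q)" "\<lambda>q. dv 0 (Suc q)" left by (rule left_complex)
  interpret R: complex_iso "cech I U V" dC "\<lambda>p. Gr (Suc p) 0" "\<lambda>p. dh (Suc p) 0" lower by (rule lower_complex)
  show ?thesis
    unfolding cohomology_def
  proof (rule correspondence_iso[where R = "corr q"])
    show "corr q (z \<otimes>\<^bsub>reg_group P q\<^esub> w) (z' \<otimes>\<^bsub>cech I U V q\<^esub> w')" if "corr q z z'" "corr q w w'" for z w z' w'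
      using that by (rule corr_mult)
    show "corr q (inv\<^bsub>reg_group P q\<^esub> z) (inv\<^bsub>cech I U V q\<^esub> z')" if "corr q z z'" for z z'
      using that by (rule corr_inv)
  qed (rule comm_group_reg_group comm_group_cech L.cocycles_subgroup L.coboundaries_subgroup L.coboundaries_subset
      R.cocycles_subgroup R.coboundaries_subgroup R.coboundaries_subset corr_total corr_onto corr_trivial; assumption)+
qed

end

text \<open>A zigzag for the smaller class \<open>P1\<close> is a zigzag for the larger class \<open>P2\<close>. If a cocycle of class \<open>P1\<close> is a
  coboundary for \<open>P2\<close>, then a Cech cocycle corresponding to it for \<open>P1\<close>, and thus for \<open>P2\<close>, is a coboundary,
  so that the given one is a coboundary for \<open>P1\<close>. A cocycle of class \<open>P2\<close> is cohomologous to any cocycle of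
  class \<open>P1\<close> that corresponds to the same Cech cocycle.\<close>

lemma cohomology_inclusion_iso:
  assumes R1: "regular_dowker V X I U opn1 P1 J1 mu1" and R2: "regular_dowker V X I U opn2 P2 J2 mu2"
    and imp: "\<And>q W f. P1 (Suc q) W f \<Longrightarrow> P2 (Suc q) W f"
  shows "(\<lambda>F. coboundaries (dowker.reg_group V I U P2) (alt_diff V (cov_power I U)) q
       <#>\<^bsub>dowker.reg_group V I U P2 q\<^esub> F)
     \<in> iso (cohomology (dowker.reg_group V I U P1) (alt_diff V (cov_power I U)) q)
           (cohomology (dowker.reg_group V I U P2) (alt_diff V (cov_power I U)) q)"
proof -
  interpret R1: regular_dowker V X I U opn1 P1 J1 mu1 by (rule R1)
  interpret R2: regular_dowker V X I U opn2 P2 J2 mu2 by (rule R2)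
  interpret L1: complex_iso "R1.reg_group P1" R1.dA "\<lambda>q. R1.Gr 0 (Suc q)" "\<lambda>q. R1.dv 0 (Suc q)" R1.left
    by (rule R1.left_complex)
  interpret L2: complex_iso "R1.reg_group P2" R1.dA "\<lambda>q. R2.Gr 0 (Suc q)" "\<lambda>q. R1.dv 0 (Suc q)" R1.left
    by (rule R2.left_complex)
  let ?Pr = "product_group (cov_power I U q) (\<lambda>_. V)"
  let ?G = "R1.reg_group P2 q"
  interpret RC: complex_iso "cech I U V" R1.dC "\<lambda>p. R2.Gr (Suc p) 0" "\<lambda>p. R1.dh (Suc p) 0" R1.lower
    by (rule R2.lower_complex)
  have carr: "carrier (R1.reg_group P1 n) \<subseteq> carrier (R1.reg_group P2 n)" for n
    using imp by (auto simp: R1.reg_group_def)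
  have coch: "R1.cochains p n \<subseteq> R2.cochains p n" for p n
  proof
    fix f assume f: "f \<in> R1.cochains p n"
    have "P2 n {u. (i, u) \<in> R1.inc p n} (\<lambda>u. f (i, u))" if "0 < n" "i \<in> {..<p} \<rightarrow>\<^sub>E I" for i
    proof -
      obtain m where "n = Suc m" using \<open>0 < n\<close> by (cases n) auto
      then show ?thesis using f that imp by (auto simp: R1.cochains_def)
    qed
    then show "f \<in> R2.cochains p n" using f by (auto simp: R1.cochains_def R2.cochains_def)
  qed
  have corr: "R2.corr q f v" if "R1.corr q f v" for f v
  proof -
    have "zigzag R1.Gr R1.dh R1.dv (Suc q) 0 (R1.left q f) (R1.lower q v)" using that by (simp add: R1.corr_def)
    then have "zigzag R2.Gr R1.dh R1.dv (Suc q) 0 (R1.left q f) (R1.lower q v)"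
      by (rule zigzag_mono) (simp add: coch)
    then show ?thesis using that subsetD[OF carr[of q]] by (simp add: R1.corr_def R2.corr_def)
  qed
  have P1_eq: "(R1.reg_group P1 q)\<lparr>carrier := S\<rparr> = ?G\<lparr>carrier := S\<rparr>" for S
    by (simp add: R1.reg_group_def)
  interpret Pr: comm_group ?Pr by (rule R1.comm_group_product_group)
  have RG: "?Pr\<lparr>carrier := carrier (R1.reg_group P' q)\<rparr> = R1.reg_group P' q" for P'
    by (simp add: R1.reg_group_def)
  have sub: "subgroup S ?G" if S: "subgroup S (R1.reg_group P1 q)" for S
  proof -
    have "subgroup S ?Pr"
      by (rule Pr.incl_subgroup[OF R1.reg_group_subgroup]) (unfold RG, rule S)
    moreover have "S \<subseteq> carrier ?G" using subgroup.subset[OF S] carr by blast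
    ultimately have "subgroup S (?Pr\<lparr>carrier := carrier ?G\<rparr>)"
      by (intro Pr.subgroup_incl R2.reg_group_subgroup)
    then show ?thesis unfolding RG .
  qed
  have Z_sub: "R1.ZA q \<subseteq> R2.ZA q"
    using carr by (auto simp: kernel_def)
  have B_sub: "R1.BA q \<subseteq> R2.BA q"
    using carr by (cases q) (auto simp: coboundaries_def)
  have "(\<lambda>F. R2.BA q <#>\<^bsub>?G\<^esub> F) \<in> iso ((?G\<lparr>carrier := R1.ZA q\<rparr>) Mod R1.BA q) ((?G\<lparr>carrier := R2.ZA q\<rparr>) Mod R2.BA q)"
  proof (rule subquotient_inclusion_iso)
    show "comm_group ?G" by (rule R2.comm_group_reg_group)
    show "subgroup (R1.ZA q) ?G" by (rule sub[OF L1.cocycles_subgroup])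
    show "subgroup (R1.BA q) ?G" by (rule sub[OF L1.coboundaries_subgroup])
    show "R1.BA q \<subseteq> R1.ZA q" by (rule L1.coboundaries_subset)
    show "subgroup (R2.ZA q) ?G" by (rule L2.cocycles_subgroup)
    show "subgroup (R2.BA q) ?G" by (rule L2.coboundaries_subgroup)
    show "R2.BA q \<subseteq> R2.ZA q" by (rule L2.coboundaries_subset)
    show "R1.ZA q \<subseteq> R2.ZA q" "R1.BA q \<subseteq> R2.BA q" by (rule Z_sub, rule B_sub)
    show "z \<in> R1.BA q" if z: "z \<in> R1.ZA q" "z \<in> R2.BA q" for z
    proof -
      obtain v where v: "R1.corr q z v" using R1.corr_total[OF z(1)] by blast
      from R2.corr_trivial[OF corr[OF v]] z(2) have "v \<in> R1.BC q" by simp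
      with R1.corr_trivial[OF v] show ?thesis by simp
    qed
    show "\<exists>w\<in>R1.ZA q. z \<otimes>\<^bsub>?G\<^esub> inv\<^bsub>?G\<^esub> w \<in> R2.BA q" if z: "z \<in> R2.ZA q" for z
    proof -
      obtain v where v: "v \<in> R1.ZC q" "R2.corr q z v" using R2.corr_total[OF z] by blast
      obtain w where w: "w \<in> R1.ZA q" "R1.corr q w v" using R1.corr_onto[OF v(1)] by blast
      have "R2.corr q (z \<otimes>\<^bsub>?G\<^esub> inv\<^bsub>?G\<^esub> w) (v \<otimes>\<^bsub>cech I U V q\<^esub> inv\<^bsub>cech I U V q\<^esub> v)"
        by (rule R2.corr_mult[OF v(2) R2.corr_inv[OF corr[OF w(2)]]])
      moreover have "v \<in> carrier (cech I U V q)" using v(2) by (simp add: R2.corr_def)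
      ultimately have "R2.corr q (z \<otimes>\<^bsub>?G\<^esub> inv\<^bsub>?G\<^esub> w) \<one>\<^bsub>cech I U V q\<^esub>"
        by (simp only: RC.C.r_inv)
      from R2.corr_trivial[OF this] have "z \<otimes>\<^bsub>?G\<^esub> inv\<^bsub>?G\<^esub> w \<in> R2.BA q"
        using subgroup.one_closed[OF RC.coboundaries_subgroup] by simp
      then show ?thesis using w(1) by blast
    qed
  qed
  then show ?thesis unfolding cohomology_def P1_eq .
qed


section \<open>Smooth and continuous cochains\<close>

text \<open>The smooth and the continuous case share their proofs.\<close>

definition reg_map :: "bool \<Rightarrow> ('m, 'e) manifold \<Rightarrow> ('n, 'f) manifold \<Rightarrow> ('m \<Rightarrow> 'n) \<Rightarrow> bool" where
  "reg_map b X N f \<longleftrightarrow> (if b then smooth_map X N f else continuous_map (mtop X) (mtop N) f)"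

lemma reg_map_smooth: "smooth_map X N f \<Longrightarrow> reg_map b X N f"
  by (simp add: reg_map_def smooth_mapD(1))

lemma reg_map_continuous: "reg_map b X N f \<Longrightarrow> continuous_map (mtop X) (mtop N) f"
  by (auto simp: reg_map_def smooth_mapD(1) split: if_splits)

lemma reg_map_compose:
  assumes "open_charts X" "modelled N" "modelled P" "reg_map b X N f" "reg_map b N P g"
  shows "reg_map b X P (\<lambda>x. g (f x))"
proof (cases b)
  case True
  then show ?thesis using assms smooth_map_compose[of X N P f g] by (simp add: reg_map_def)
next
  case False
  then show ?thesis using assms(4,5) continuous_map_compose[of "mtop X" "mtop N" f "mtop P" g] by (simp add: reg_map_def o_def)
qed

lemma reg_map_pair:
  assumes "modelled X" "modelled N" "modelled P" "reg_map b X N f" "reg_map b X P g"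
  shows "reg_map b X (manifold_prod N P) (\<lambda>x. (f x, g x))"
proof (cases b)
  case True
  then show ?thesis using assms smooth_map_pair[of X N P f g] by (simp add: reg_map_def)
next
  case False
  then show ?thesis using assms(4,5) by (simp add: reg_map_def manifold_prod_def continuous_map_paired)
qed

lemma reg_map_eq:
  assumes "modelled X" "modelled N" "reg_map b X N f" "\<And>x. x \<in> topspace (mtop X) \<Longrightarrow> f x = g x"
  shows "reg_map b X N g"
proof (cases b)
  case True
  then show ?thesis using assms smooth_map_eq[of X N f g] by (simp add: reg_map_def)
next
  case False
  then show ?thesis using continuous_map_eq[of "mtop X" "mtop N" f g] assms(3,4) by (simp add: reg_map_def)
qed

lemma reg_map_restrict:
  assumes "modelled X" "modelled N" "reg_map b X N f"
  shows "reg_map b (open_submanifold X W) N f"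
proof (cases b)
  case True
  then show ?thesis using assms smooth_map_restrict[of X N f W] by (simp add: reg_map_def)
next
  case False
  then show ?thesis using assms(3) by (simp add: reg_map_def continuous_map_from_subtopology)
qed

lemma reg_map_locally:
  assumes "open_charts X" "modelled N"
    and loc: "\<And>x. x \<in> topspace (mtop X) \<Longrightarrow> \<exists>W. openin (mtop X) W \<and> x \<in> W \<and> reg_map b (open_submanifold X W) N f"
  shows "reg_map b X N f"
proof (cases b)
  case True
  then show ?thesis using assms smooth_map_locally[of X N f] by (simp add: reg_map_def)
next
  case False
  let ?\<A> = "{W. openin (mtop X) W \<and> continuous_map (subtopology (mtop X) W) (mtop N) f}"
  have "continuous_map (subtopology (mtop X) (\<Union>?\<A>)) (mtop N) f"
    by (rule continuous_map_open_cover) auto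
  moreover have "topspace (mtop X) \<subseteq> \<Union>?\<A>" using loc False by (auto simp: reg_map_def)
  ultimately show ?thesis using False by (simp add: reg_map_def subtopology_superset)
qed

text \<open>The partial sums of the \<open>a i\<close> in increasing order of \<open>i\<close> cut the way from \<open>c\<close> to the total sum into
  pieces. The induction splits off the least index and starts anew from \<open>c + a m\<close>.\<close>

lemma (in comm_group) telescoping_product:
  fixes a :: "'i \<Rightarrow> real"
  assumes wf: "wf {(x, y). lt x y}" and total: "\<And>x y. x \<noteq> y \<Longrightarrow> lt x y \<or> lt y x"
    and "finite J" and f: "\<And>t. f t \<in> carrier G"
  shows "(\<Otimes>j\<in>J. f (c + (\<Sum>i\<in>{i \<in> J. lt i j}. a i)) \<otimes> inv f (c + (\<Sum>i\<in>{i \<in> J. lt i j}. a i) + a j)) =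
    f c \<otimes> inv f (c + (\<Sum>i\<in>J. a i))"
  using assms(3)
proof (induction "card J" arbitrary: J c)
  case 0
  then show ?case using f by simp
next
  case (Suc n)
  have "J \<noteq> {}" using Suc(2) by auto
  then obtain x where "x \<in> J" by blast
  then have "\<exists>m\<in>J. \<forall>y. (y, m) \<in> {(x, y). lt x y} \<longrightarrow> y \<notin> J"
    by (rule wfE_min[OF wf]) (intro bexI allI impI)
  then obtain m where m: "m \<in> J" "\<And>y. lt y m \<Longrightarrow> y \<notin> J" by auto
  let ?K = "J - {m}"
  have irrefl: "\<not> lt x x" for x using wf_not_refl[OF wf, of x] by simp
  have K: "J = insert m ?K" "finite ?K" "m \<notin> ?K" using m(1) Suc(3) by auto
  have below_m: "{i \<in> J. lt i m} = {}" using m(2) by blast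
  have below: "{i \<in> J. lt i j} = insert m {i \<in> ?K. lt i j}" if "j \<in> ?K" for j
  proof -
    have "lt m j" using total[of m j] m(2)[of j] that by blast
    then show ?thesis using m(1) by auto
  qed
  have shift: "c + (\<Sum>i\<in>{i \<in> J. lt i j}. a i) = (c + a m) + (\<Sum>i\<in>{i \<in> ?K. lt i j}. a i)" if "j \<in> ?K" for j
    using K(2) unfolding below[OF that] by (subst sum.insert) auto
  let ?T = "\<lambda>J c j. f (c + (\<Sum>i\<in>{i \<in> J. lt i j}. a i)) \<otimes> inv f (c + (\<Sum>i\<in>{i \<in> J. lt i j}. a i) + a j)"
  have "(\<Otimes>j\<in>J. ?T J c j) = ?T J c m \<otimes> (\<Otimes>j\<in>?K. ?T J c j)"
    using f K(2,3) by (subst (1) K(1), subst finprod_insert) auto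
  also have "(\<Otimes>j\<in>?K. ?T J c j) = (\<Otimes>j\<in>?K. ?T ?K (c + a m) j)"
    using f by (intro finprod_cong') (auto simp: shift)
  also have "\<dots> = f (c + a m) \<otimes> inv f (c + a m + (\<Sum>i\<in>?K. a i))"
    using Suc(2,3) m(1) by (intro Suc(1)) auto
  also have "c + a m + (\<Sum>i\<in>?K. a i) = c + (\<Sum>i\<in>J. a i)"
    using m(1) Suc(3) by (simp add: sum.remove[of J m])
  also have "?T J c m = f c \<otimes> inv f (c + a m)" unfolding below_m by simp
  also have "(f c \<otimes> inv f (c + a m)) \<otimes> (f (c + a m) \<otimes> inv f (c + (\<Sum>i\<in>J. a i))) = f c \<otimes> inv f (c + (\<Sum>i\<in>J. a i))"
  proof -
    have "inv x \<otimes> (x \<otimes> y) = y" if "x \<in> carrier G" "y \<in> carrier G" for x y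
      using that by (simp add: m_assoc[symmetric])
    then show ?thesis using f by (simp add: m_assoc)
  qed
  finally show ?case .
qed

locale numerably_covered =
  fixes V :: "('v, 'f) lie_group" (structure) and M :: "('m, 'e) manifold"
    and I :: "'i set" and U :: "'i \<Rightarrow> 'm set"
  assumes lie: "lie_group V" and comm: "comm_group V"
    and contractible: "smoothly_loop_contractible V"
    and M: "manifold M"
    and covering: "open_covering M I U"
    and numerable: "\<And>q. smoothly_numerable (open_submanifold (manifold_power M q) (cov_power I U q)) I
               (\<lambda>i. {..q} \<rightarrow>\<^sub>E U i)"
begin

abbreviation "X \<equiv> topspace (mtop M)"
abbreviation "cv q \<equiv> cov_power I U q"
abbreviation "sub q W \<equiv> open_submanifold (manifold_power M q) W"

lemma U_open: "i \<in> I \<Longrightarrow> openin (mtop M) (U i)"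
  using covering by (simp add: open_covering_def)

sublocale dowker V X I U
proof (intro dowker.intro comm dowker_axioms.intro)
  show "U i \<subseteq> X" if "i \<in> I" for i using openin_subset[OF U_open[OF that]] .
qed

lemma V_modelled: "modelled (mfd V)"
  using lie_group.axioms(2)[OF lie] by (intro open_chartsD open_charts_manifold)

lemma V_topspace: "topspace (mtop (mfd V)) = carrier V"
  using lie by (rule lie_group.carrier_eq)

lemma M_modelled: "modelled M"
  using M by (intro open_chartsD open_charts_manifold)

lemma power_open_charts: "open_charts (manifold_power M q)"
  using M by (intro open_charts_power open_charts_manifold)

lemma sub_open_charts: "openin (mtop (manifold_power M q)) W \<Longrightarrow> open_charts (sub q W)"
  by (rule open_charts_submanifold[OF power_open_charts])

lemma sub_modelled: "modelled (sub q W)"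
  by (rule modelled_submanifold[OF open_chartsD[OF power_open_charts]])

lemma box_open: "i \<in> I \<Longrightarrow> openin (mtop (manifold_power M q)) ({..q} \<rightarrow>\<^sub>E U i)"
  using U_open by (simp add: openin_PiE)

lemma cv_open: "openin (mtop (manifold_power M q)) (cv q)"
  unfolding cov_power_def using box_open by (intro openin_Union) auto

lemma topspace_sub: "openin (mtop (manifold_power M q)) W \<Longrightarrow> topspace (mtop (sub q W)) = W"
  using openin_subset[of "mtop (manifold_power M q)" W] by (auto simp: topspace_submanifold)

lemma openin_sub: "openin (mtop (manifold_power M q)) W \<Longrightarrow>
    openin (mtop (sub q W)) S \<longleftrightarrow> openin (mtop (manifold_power M q)) S \<and> S \<subseteq> W"
proof -
  assume W: "openin (mtop (manifold_power M q)) W"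
  have "mtop (sub q W) = subtopology (mtop (manifold_power M q)) W" unfolding open_submanifold_def by simp
  then show ?thesis using openin_open_subtopology[OF W, of S] by (simp only:)
qed

lemma reg_group_mult:
  assumes X: "open_charts X'" and f: "reg_map b X' (mfd V) f" and g: "reg_map b X' (mfd V) g"
  shows "reg_map b X' (mfd V) (\<lambda>x. f x \<otimes> g x)"
proof -
  have "reg_map b X' (manifold_prod (mfd V) (mfd V)) (\<lambda>x. (f x, g x))"
    by (rule reg_map_pair[OF open_chartsD[OF X] V_modelled V_modelled f g])
  from reg_map_compose[OF X modelled_prod[OF V_modelled V_modelled] V_modelled this
      reg_map_smooth[OF lie_group.smooth_mult[OF lie]]]
  show ?thesis by simp
qed

lemma reg_group_inv:
  assumes X: "open_charts X'" and f: "reg_map b X' (mfd V) f"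
  shows "reg_map b X' (mfd V) (\<lambda>x. inv f x)"
  using reg_map_compose[OF X V_modelled V_modelled f reg_map_smooth[OF lie_group.smooth_inv[OF lie]]] .

definition \<Phi> :: "'v \<times> real \<Rightarrow> 'v" where
  "\<Phi> = (SOME \<Phi>. smooth_map (manifold_prod (mfd V) unit_interval) (mfd V) \<Phi> \<and>
          (\<forall>g\<in>carrier V. \<Phi> (g, 0) = g \<and> \<Phi> (g, 1) = \<one>) \<and>
          (\<forall>t\<in>{0..1}. (\<lambda>g. \<Phi> (g, t)) \<in> lie_hom V V))"

lemma \<Phi>:
  shows "smooth_map (manifold_prod (mfd V) unit_interval) (mfd V) \<Phi>"
    and "g \<in> carrier V \<Longrightarrow> \<Phi> (g, 0) = g" "g \<in> carrier V \<Longrightarrow> \<Phi> (g, 1) = \<one>"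
    and "(\<lambda>g. \<Phi> (g, unit_bump s)) \<in> hom V V"
proof -
  have "smooth_map (manifold_prod (mfd V) unit_interval) (mfd V) \<Phi> \<and>
          (\<forall>g\<in>carrier V. \<Phi> (g, 0) = g \<and> \<Phi> (g, 1) = \<one>) \<and>
          (\<forall>t\<in>{0..1}. (\<lambda>g. \<Phi> (g, t)) \<in> lie_hom V V)"
    unfolding \<Phi>_def using contractible unfolding smoothly_loop_contractible_def by (rule someI_ex)
  then show "smooth_map (manifold_prod (mfd V) unit_interval) (mfd V) \<Phi>"
    "g \<in> carrier V \<Longrightarrow> \<Phi> (g, 0) = g" "g \<in> carrier V \<Longrightarrow> \<Phi> (g, 1) = \<one>"
    "(\<lambda>g. \<Phi> (g, unit_bump s)) \<in> hom V V"
    using unit_bump_bounds[of s] by (auto simp: lie_hom_def)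
qed

lemma \<Phi>_closed: "g \<in> carrier V \<Longrightarrow> \<Phi> (g, unit_bump s) \<in> carrier V"
  using \<Phi>(4)[of s] by (auto simp: hom_def)

lemma reg_\<Phi>:
  assumes X: "open_charts X'" and f: "reg_map b X' (mfd V) f" and s: "smooth_map X' real_line s"
  shows "reg_map b X' (mfd V) (\<lambda>x. \<Phi> (f x, unit_bump (s x)))"
proof -
  have "smooth_map X' unit_interval (\<lambda>x. unit_bump (s x))"
    by (rule smooth_map_compose[OF X open_chartsD[OF open_charts_real_line] modelled_unit_interval s smooth_unit_bump])
  then have "reg_map b X' (manifold_prod (mfd V) unit_interval) (\<lambda>x. (f x, unit_bump (s x)))"
    by (intro reg_map_pair[OF open_chartsD[OF X] V_modelled modelled_unit_interval f] reg_map_smooth)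
  from reg_map_compose[OF X modelled_prod[OF V_modelled modelled_unit_interval] V_modelled this
      reg_map_smooth[OF \<Phi>(1)]]
  show ?thesis .
qed

definition part :: "nat \<Rightarrow> 'i \<Rightarrow> (nat \<Rightarrow> 'm) \<Rightarrow> real" where
  "part q = (SOME \<phi>. smooth_partition_of_unity (sub q (cv q)) I \<phi> \<and>
     (\<forall>i\<in>I. supp_on (sub q (cv q)) (\<phi> i) \<subseteq> {..q} \<rightarrow>\<^sub>E U i))"

abbreviation "supp q i \<equiv> supp_on (sub q (cv q)) (part q i)"

lemma part: "smooth_partition_of_unity (sub q (cv q)) I (part q)" "i \<in> I \<Longrightarrow> supp q i \<subseteq> {..q} \<rightarrow>\<^sub>E U i"
proof -
  have "\<exists>\<phi>. smooth_partition_of_unity (sub q (cv q)) I \<phi> \<and> (\<forall>i\<in>I. supp_on (sub q (cv q)) (\<phi> i) \<subseteq> {..q} \<rightarrow>\<^sub>E U i)"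
    using numerable[of q] unfolding smoothly_numerable_def by blast
  then have "smooth_partition_of_unity (sub q (cv q)) I (part q) \<and> (\<forall>i\<in>I. supp q i \<subseteq> {..q} \<rightarrow>\<^sub>E U i)"
    unfolding part_def by (rule someI_ex)
  then show "smooth_partition_of_unity (sub q (cv q)) I (part q)" "i \<in> I \<Longrightarrow> supp q i \<subseteq> {..q} \<rightarrow>\<^sub>E U i" by auto
qed

lemma part_smooth: "i \<in> I \<Longrightarrow> smooth_map (sub q (cv q)) real_line (part q i)"
  and part_sum: "u \<in> cv q \<Longrightarrow> (\<Sum>i\<in>{i \<in> I. part q i u \<noteq> 0}. part q i u) = 1"
  using part(1)[of q] topspace_sub[OF cv_open] unfolding smooth_partition_of_unity_def by auto

lemma part_supp: "u \<in> cv q \<Longrightarrow> part q i u \<noteq> 0 \<Longrightarrow> u \<in> supp q i"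
  unfolding supp_on_def topspace_sub[OF cv_open]
  using closure_of_subset[of "{x \<in> cv q. part q i x \<noteq> 0}" "mtop (sub q (cv q))"] topspace_sub[OF cv_open]
  by auto

lemma part_locally_finite:
  assumes "u \<in> cv q"
  obtains W where "openin (mtop (manifold_power M q)) W" "u \<in> W" "W \<subseteq> cv q" "finite {i \<in> I. supp q i \<inter> W \<noteq> {}}"
proof -
  obtain W where W: "openin (mtop (sub q (cv q))) W" "u \<in> W" "finite {i \<in> I. supp q i \<inter> W \<noteq> {}}"
    using part(1)[of q] assms topspace_sub[OF cv_open] unfolding smooth_partition_of_unity_def by blast
  have "openin (mtop (manifold_power M q)) W" "W \<subseteq> cv q"
    using W(1) openin_sub[OF cv_open] by simp_all
  then show thesis using W that by blast
qed

lemma supp_closed: "openin (mtop (manifold_power M q)) W \<Longrightarrow> W \<subseteq> cv q \<Longrightarrow>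
    openin (mtop (manifold_power M q)) (W - supp q i)"
proof -
  assume W: "openin (mtop (manifold_power M q)) W" "W \<subseteq> cv q"
  have "openin (mtop (sub q (cv q))) W" using W unfolding openin_sub[OF cv_open] by (rule conjI)
  moreover have "closedin (mtop (sub q (cv q))) (supp q i)" unfolding supp_on_def by (rule closedin_closure_of)
  ultimately have "openin (mtop (sub q (cv q))) (W - supp q i)" by (rule openin_diff)
  then show ?thesis using openin_sub[OF cv_open] by simp
qed

text \<open>A well-founded total relation on the type of indices; it orders the summands of the telescope.\<close>

definition lt :: "'i \<Rightarrow> 'i \<Rightarrow> bool" where
  "lt = (SOME lt. wf {(x, y). lt x y} \<and> (\<forall>x y. x \<noteq> y \<longrightarrow> lt x y \<or> lt y x))"

lemma lt: "wf {(x, y). lt x y}" "x \<noteq> y \<Longrightarrow> lt x y \<or> lt y x"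
proof -
  from well_ordering[where ?'a = 'i] obtain r :: "'i rel" where r: "Well_order r" "Field r = UNIV"
    by (elim exE conjE)
  have "wf {(x, y). (x, y) \<in> r - Id}" using r(1) by (simp only: well_order_on_def split_def prod.collapse Collect_mem_eq)
  moreover have "x \<noteq> y \<longrightarrow> (x, y) \<in> r - Id \<or> (y, x) \<in> r - Id" for x y
  proof -
    have "total_on UNIV r" using r by (simp only: well_order_on_def linear_order_on_def)
    then show ?thesis by (simp add: total_on_def)
  qed
  ultimately have "\<exists>lt :: 'i \<Rightarrow> 'i \<Rightarrow> bool. wf {(x, y). lt x y} \<and> (\<forall>x y. x \<noteq> y \<longrightarrow> lt x y \<or> lt y x)"
    by (intro exI[of _ "\<lambda>x y. (x, y) \<in> r - Id"] conjI allI)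
  then have "wf {(x, y). lt x y} \<and> (\<forall>x y. x \<noteq> y \<longrightarrow> lt x y \<or> lt y x)" unfolding lt_def by (rule someI_ex)
  then show "wf {(x, y). lt x y}" "x \<noteq> y \<Longrightarrow> lt x y \<or> lt y x" by blast+
qed

definition J :: "nat \<Rightarrow> (nat \<Rightarrow> 'm) \<Rightarrow> 'i set" where
  "J q u = {j \<in> I. part (q - 1) j u \<noteq> 0}"

text \<open>The sum over the predecessors of \<open>j\<close>. It is smooth near a point, where only finitely many
  summands fail to vanish identically.\<close>

definition pre :: "nat \<Rightarrow> 'i \<Rightarrow> (nat \<Rightarrow> 'm) \<Rightarrow> real" where
  "pre q j u = (\<Sum>i\<in>{i \<in> I. part q i u \<noteq> 0 \<and> lt i j}. part q i u)"

text \<open>The substitute for the multiplication by the \<open>j\<close>-th function of the partition of unity. Its first argument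
  is the length of the tuple \<open>u\<close>, hence larger by one than the index of the power of the manifold.\<close>

definition mu :: "nat \<Rightarrow> 'i \<Rightarrow> (nat \<Rightarrow> 'm) \<Rightarrow> 'v \<Rightarrow> 'v" where
  "mu q j u v = \<Phi> (v, unit_bump (pre (q - 1) j u)) \<otimes>
     inv \<Phi> (v, unit_bump (pre (q - 1) j u + part (q - 1) j u))"

lemma cov_eq: "cov (Suc q) = cv q"
  by (simp add: cov_def cov_power_def lessThan_Suc_atMost)

lemma J_supp: "u \<in> cv q \<Longrightarrow> j \<in> J (Suc q) u \<Longrightarrow> j \<in> I \<and> u \<in> supp q j"
  using part_supp[of u q j] by (simp add: J_def)

lemma J_finite: assumes "u \<in> cv q" shows "finite (J (Suc q) u)"
proof -
  obtain W where W: "openin (mtop (manifold_power M q)) W" "u \<in> W" "W \<subseteq> cv q"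
    "finite {i \<in> I. supp q i \<inter> W \<noteq> {}}" using assms by (rule part_locally_finite)
  have "J (Suc q) u \<subseteq> {i \<in> I. supp q i \<inter> W \<noteq> {}}" using W(2) J_supp[OF assms] by blast
  then show ?thesis by (rule finite_subset[OF _ W(4)])
qed

lemma J_cov: "u \<in> cv q \<Longrightarrow> j \<in> J (Suc q) u \<Longrightarrow> j \<in> I \<and> u \<in> {..q} \<rightarrow>\<^sub>E U j"
  using J_supp[of u q j] part(2)[of j q] by blast

lemma mu_hom: "mu q j u \<in> hom V V"
proof (rule homI)
  fix v w assume vw: "v \<in> carrier V" "w \<in> carrier V"
  have "\<Phi> (v \<otimes> w, unit_bump s) = \<Phi> (v, unit_bump s) \<otimes> \<Phi> (w, unit_bump s)" for s
    using \<Phi>(4)[of s] vw by (simp add: hom_def)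
  then show "mu q j u (v \<otimes> w) = mu q j u v \<otimes> mu q j u w"
    using vw \<Phi>_closed by (simp add: mu_def inv_mult m_ac)
qed (simp add: mu_def \<Phi>_closed)

lemma mu_sum:
  assumes u: "u \<in> cv q" and v: "v \<in> carrier V"
  shows "(\<Otimes>j\<in>J (Suc q) u. mu (Suc q) j u v) = v"
proof -
  have "pre q j u = 0 + (\<Sum>i\<in>{i \<in> J (Suc q) u. lt i j}. part q i u)" for j
    by (auto simp: pre_def J_def intro!: sum.cong)
  then have "(\<Otimes>j\<in>J (Suc q) u. mu (Suc q) j u v) = \<Phi> (v, unit_bump 0) \<otimes>
      inv \<Phi> (v, unit_bump (0 + (\<Sum>i\<in>J (Suc q) u. part q i u)))"
    unfolding mu_def diff_Suc_1
    using telescoping_product[OF lt J_finite[OF u], of "\<lambda>s. \<Phi> (v, unit_bump s)" 0 "\<lambda>i. part q i u"] \<Phi>_closed[OF v]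
    by simp
  also have "(\<Sum>i\<in>J (Suc q) u. part q i u) = 1" using part_sum[OF u] by (simp add: J_def)
  finally show ?thesis using v by (simp add: \<Phi>)
qed

lemma mu_trivial: "part q j u = 0 \<Longrightarrow> v \<in> carrier V \<Longrightarrow> mu (Suc q) j u v = \<one>"
  by (simp add: mu_def \<Phi>_closed)

text \<open>In an open set that meets finitely many supports, the sum over the predecessors of \<open>j\<close> is finite with a
  fixed set of summands.\<close>

lemma reg_mu:
  assumes W: "openin (mtop (manifold_power M q)) W" "W \<subseteq> cv q"
    and fin: "finite {i \<in> I. supp q i \<inter> W \<noteq> {}}" and j: "j \<in> I"
    and W': "openin (mtop (manifold_power M q)) W'" "W' \<subseteq> W"
    and f: "reg_map b (sub q W') (mfd V) f"
  shows "reg_map b (sub q W') (mfd V) (\<lambda>u. mu (Suc q) j u (f u))"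
proof -
  note oc = sub_open_charts[OF W'(1)]
  have part: "smooth_map (sub q W') real_line (part q i)" if "i \<in> I" for i
  proof -
    have "sub q W' = open_submanifold (sub q (cv q)) W'" using W(2) W'(2) by (simp add: open_submanifold_twice)
    then show ?thesis
      using smooth_map_restrict[OF sub_modelled open_chartsD[OF open_charts_real_line] part_smooth[OF that]] by simp
  qed
  let ?F = "{i \<in> {i \<in> I. supp q i \<inter> W \<noteq> {}}. lt i j}"
  have fin': "finite ?F" by (rule finite_subset[OF _ fin]) blast
  have "smooth_map (sub q W') real_line (\<lambda>u. \<Sum>i\<in>?F. part q i u)"
    by (rule smooth_map_sum[OF sub_modelled fin']) (rule part, blast)
  moreover have "(\<Sum>i\<in>?F. part q i u) = pre q j u" if "u \<in> W'" for u
  proof -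
    have u: "u \<in> cv q" "u \<in> W" using that W(2) W'(2) by auto
    show ?thesis unfolding pre_def
      by (rule sum.mono_neutral_right) (use fin' part_supp[OF u(1)] u(2) in blast)+
  qed
  ultimately have pre: "smooth_map (sub q W') real_line (pre q j)"
    by (rule smooth_map_eq[OF sub_modelled open_chartsD[OF open_charts_real_line]]) (simp only: topspace_sub[OF W'(1)])
  show ?thesis
    unfolding mu_def diff_Suc_1
    by (rule reg_group_mult[OF oc reg_\<Phi>[OF oc f pre] reg_group_inv[OF oc reg_\<Phi>[OF oc f
          smooth_map_add[OF sub_modelled pre part[OF j]]]]])
qed

definition opn :: "nat \<Rightarrow> (nat \<Rightarrow> 'm) set \<Rightarrow> bool" where
  "opn q W \<longleftrightarrow> openin (mtop (manifold_power M (q - 1))) W"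

definition P :: "bool \<Rightarrow> nat \<Rightarrow> (nat \<Rightarrow> 'm) set \<Rightarrow> ((nat \<Rightarrow> 'm) \<Rightarrow> 'v) \<Rightarrow> bool" where
  "P b q W f \<longleftrightarrow> reg_map b (sub (q - 1) W) (mfd V) f"

lemma reg_finprod:
  assumes X: "open_charts X'" and "finite F" "\<And>j. j \<in> F \<Longrightarrow> reg_map b X' (mfd V) (f j)"
  shows "reg_map b X' (mfd V) (\<lambda>x. \<Otimes>j\<in>F. f j x)"
  using assms(2,3)
proof (induction F rule: finite_induct)
  case empty
  show ?case
    using smooth_map_const[OF open_chartsD[OF X] V_modelled, of \<one>] V_topspace by (simp add: reg_map_smooth)
next
  case (insert j F)
  have closed: "f i x \<in> carrier V" if "i \<in> insert j F" "x \<in> topspace (mtop X')" for i x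
    using reg_map_continuous[OF insert.prems[OF that(1)]] that(2) V_topspace by (auto simp: continuous_map_def)
  have "reg_map b X' (mfd V) (\<lambda>x. f j x \<otimes> (\<Otimes>j\<in>F. f j x))"
    using insert by (intro reg_group_mult[OF X]) auto
  then show ?case
    by (rule reg_map_eq[OF open_chartsD[OF X] V_modelled])
      (use insert closed in \<open>auto intro!: finprod_insert[symmetric]\<close>)
qed

text \<open>Near each point the product is one over a fixed finite set of indices, and the factor with index \<open>j\<close>,
  extended by the neutral element, is regular: near the points of \<open>U\<^sub>j\<^sup>q\<^sup>+\<^sup>1\<close> by assumption, and near all
  other points because they lie outside the support of the \<open>j\<close>-th function of the partition.\<close>

lemma reg_partition:
  assumes W: "openin (mtop (manifold_power M q)) W" "W \<subseteq> cv q"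
    and g: "\<And>j. j \<in> I \<Longrightarrow> reg_map b (sub q (W \<inter> ({..q} \<rightarrow>\<^sub>E U j))) (mfd V) (g j)"
    and gC: "\<And>j u. j \<in> I \<Longrightarrow> u \<in> W \<inter> ({..q} \<rightarrow>\<^sub>E U j) \<Longrightarrow> g j u \<in> carrier V"
  shows "reg_map b (sub q W) (mfd V) (\<lambda>u. \<Otimes>j\<in>J (Suc q) u. mu (Suc q) j u (g j u))"
proof (rule reg_map_locally[OF sub_open_charts[OF W(1)] V_modelled])
  fix x assume "x \<in> topspace (mtop (sub q W))"
  then have x: "x \<in> W" by (simp only: topspace_sub[OF W(1)])
  then have xc: "x \<in> cv q" using W(2) by blast
  obtain W1 where W1: "openin (mtop (manifold_power M q)) W1" "x \<in> W1" "W1 \<subseteq> cv q"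
    "finite {i \<in> I. supp q i \<inter> W1 \<noteq> {}}" using xc by (rule part_locally_finite)
  let ?F = "{i \<in> I. supp q i \<inter> W1 \<noteq> {}}"
  let ?O = "W \<inter> W1"
  have O: "openin (mtop (manifold_power M q)) ?O" by (rule openin_Int[OF W(1) W1(1)])
  let ?t = "\<lambda>j u. if u \<in> {..q} \<rightarrow>\<^sub>E U j then mu (Suc q) j u (g j u) else \<one>"
  have t: "reg_map b (sub q ?O) (mfd V) (?t j)" if j: "j \<in> I" for j
  proof (rule reg_map_locally[OF sub_open_charts[OF O] V_modelled])
    fix u assume "u \<in> topspace (mtop (sub q ?O))"
    then have u: "u \<in> ?O" by (simp only: topspace_sub[OF O])
    show "\<exists>T. openin (mtop (sub q ?O)) T \<and> u \<in> T \<and> reg_map b (open_submanifold (sub q ?O) T) (mfd V) (?t j)"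
    proof (cases "u \<in> {..q} \<rightarrow>\<^sub>E U j")
      case True
      let ?T = "?O \<inter> ({..q} \<rightarrow>\<^sub>E U j)"
      have T: "openin (mtop (manifold_power M q)) ?T" by (rule openin_Int[OF O box_open[OF j]])
      have "reg_map b (open_submanifold (sub q (W \<inter> ({..q} \<rightarrow>\<^sub>E U j))) ?T) (mfd V) (g j)"
        by (rule reg_map_restrict[OF sub_modelled V_modelled g[OF j]])
      moreover have "open_submanifold (sub q (W \<inter> ({..q} \<rightarrow>\<^sub>E U j))) ?T = sub q ?T"
        by (rule open_submanifold_twice) blast
      ultimately have "reg_map b (sub q ?T) (mfd V) (g j)" by (simp only:)
      then have "reg_map b (sub q ?T) (mfd V) (\<lambda>u. mu (Suc q) j u (g j u))"
        by (rule reg_mu[OF W1(1,3,4) j T Int_lower1[THEN subset_trans, OF Int_lower2]])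
      then have "reg_map b (sub q ?T) (mfd V) (?t j)"
        by (rule reg_map_eq[OF sub_modelled V_modelled]) (simp only: topspace_sub[OF T] Int_iff if_True)
      moreover have "open_submanifold (sub q ?O) ?T = sub q ?T" by (rule open_submanifold_twice) blast
      ultimately show ?thesis
        using u True T unfolding openin_sub[OF O] by (intro exI[of _ ?T] conjI IntI Int_lower1) (simp_all only: Int_iff)
    next
      case False
      let ?T = "?O - supp q j"
      have T: "openin (mtop (manifold_power M q)) ?T" by (rule supp_closed[OF O]) (use W(2) in blast)
      have uT: "u \<in> ?T" using u False part(2)[OF j, of q] by blast
      have triv: "?t j w = \<one>" if "w \<in> ?T" for w
      proof -
        have "part q j w = 0" using part_supp[of w q j] that W(2) by blast
        then have "mu (Suc q) j w (g j w) = \<one>" if "w \<in> {..q} \<rightarrow>\<^sub>E U j"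
          using mu_trivial gC[OF j, of w] that \<open>w \<in> ?T\<close> by blast
        then show ?thesis by simp
      qed
      have "reg_map b (sub q ?T) (mfd V) (\<lambda>_. \<one>)"
        using smooth_map_const[OF sub_modelled V_modelled, of \<one>] V_topspace by (simp add: reg_map_smooth)
      then have "reg_map b (sub q ?T) (mfd V) (?t j)"
        by (rule reg_map_eq[OF sub_modelled V_modelled]) (unfold topspace_sub[OF T], rule triv[symmetric])
      moreover have "open_submanifold (sub q ?O) ?T = sub q ?T" by (rule open_submanifold_twice) blast
      ultimately show ?thesis
        using uT T unfolding openin_sub[OF O] by (intro exI[of _ ?T] conjI Diff_subset) (simp_all only:)
    qed
  qed
  have "reg_map b (sub q ?O) (mfd V) (\<lambda>u. \<Otimes>j\<in>?F. ?t j u)"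
    by (rule reg_finprod[OF sub_open_charts[OF O] W1(4)]) (rule t, blast)
  moreover have "(\<Otimes>j\<in>?F. ?t j u) = (\<Otimes>j\<in>J (Suc q) u. mu (Suc q) j u (g j u))" if u: "u \<in> ?O" for u
  proof (rule finprod_mono_neutral_cong_right)
    have uc: "u \<in> cv q" using u W(2) by blast
    show "finite ?F" by (rule W1(4))
    show "J (Suc q) u \<subseteq> ?F" using J_supp[OF uc] u by blast
    show "?t j u = \<one>" if "j \<in> ?F - J (Suc q) u" for j
    proof (cases "u \<in> {..q} \<rightarrow>\<^sub>E U j")
      case True
      have "part q j u = 0" "j \<in> I" using that by (simp_all add: J_def)
      then show ?thesis using mu_trivial[OF _ gC[of j u]] u True by simp
    qed simp
    show "?t j u = mu (Suc q) j u (g j u)" if "j \<in> J (Suc q) u" for j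
      using J_cov[OF uc that] by (simp only: if_True)
    show "(\<lambda>j. ?t j u) \<in> ?F \<rightarrow> carrier V"
    proof (rule Pi_I)
      fix j assume "j \<in> ?F"
      then have "g j u \<in> carrier V" if "u \<in> {..q} \<rightarrow>\<^sub>E U j" using gC[of j u] u that by blast
      then show "?t j u \<in> carrier V" using hom_in_carrier[OF mu_hom] by simp
    qed
  qed
  ultimately have "reg_map b (sub q ?O) (mfd V) (\<lambda>u. \<Otimes>j\<in>J (Suc q) u. mu (Suc q) j u (g j u))"
    by (rule reg_map_eq[OF sub_modelled V_modelled]) (simp only: topspace_sub[OF O])
  moreover have "open_submanifold (sub q W) ?O = sub q ?O" by (rule open_submanifold_twice) blast
  ultimately show "\<exists>T. openin (mtop (sub q W)) T \<and> x \<in> T \<and>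
      reg_map b (open_submanifold (sub q W) T) (mfd V) (\<lambda>u. \<Otimes>j\<in>J (Suc q) u. mu (Suc q) j u (g j u))"
    using x W1(2) O unfolding openin_sub[OF W(1)] by (intro exI[of _ ?O]) auto
qed

text \<open>The points that fit to the index tuple \<open>i\<close> form a union of boxes over the finite intersections of the sets
  \<open>U (i k)\<close> with one further set \<open>U j\<close>.\<close>

lemma slice_open:
  assumes i: "i \<in> {..<p} \<rightarrow>\<^sub>E I"
  shows "openin (mtop (manifold_power M q)) {u. (i, u) \<in> inc p (Suc q)}"
proof -
  let ?B = "\<lambda>j. U j \<inter> {x. \<forall>k<p. x \<in> U (i k)}"
  have eq: "{u. (i, u) \<in> inc p (Suc q)} = (\<Union>j\<in>I. {..q} \<rightarrow>\<^sub>E ?B j)"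
  proof (intro equalityI subsetI)
    fix u assume "u \<in> {u. (i, u) \<in> inc p (Suc q)}"
    then have "u \<in> {..<Suc q} \<rightarrow>\<^sub>E X \<and> (\<forall>k<p. \<forall>l<Suc q. u l \<in> U (i k)) \<and> (\<exists>j\<in>I. \<forall>l<Suc q. u l \<in> U j)"
      unfolding inc_def mem_Collect_eq case_prod_conv by (elim conjE) (intro conjI)
    then obtain j where j: "j \<in> I" "u \<in> {..<Suc q} \<rightarrow>\<^sub>E X" "\<forall>k<p. \<forall>l<Suc q. u l \<in> U (i k)" "\<forall>l<Suc q. u l \<in> U j"
      by (elim conjE bexE)
    have "u \<in> extensional {..q}" using j(2) by (simp only: lessThan_Suc_atMost PiE_iff)
    moreover have "u l \<in> ?B j" if "l \<in> {..q}" for l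
    proof -
      have "l < Suc q" using that by simp
      then show ?thesis using j(3,4) by (intro IntI CollectI allI impI) (simp_all only:)
    qed
    ultimately have "u \<in> {..q} \<rightarrow>\<^sub>E ?B j" unfolding PiE_iff by (intro conjI ballI)
    then show "u \<in> (\<Union>j\<in>I. {..q} \<rightarrow>\<^sub>E ?B j)" by (rule UN_I[OF j(1)])
  next
    fix u assume "u \<in> (\<Union>j\<in>I. {..q} \<rightarrow>\<^sub>E ?B j)"
    then obtain j where j: "j \<in> I" "u \<in> {..q} \<rightarrow>\<^sub>E ?B j" by (elim UN_E)
    have uB: "u l \<in> ?B j" if "l < Suc q" for l by (rule PiE_mem[OF j(2)]) (use that in simp)
    have "u \<in> extensional {..<Suc q}" using j(2) by (simp only: lessThan_Suc_atMost PiE_iff)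
    moreover have "u l \<in> X" if "l \<in> {..<Suc q}" for l
      using uB[of l] that subsetD[OF U_subset[OF j(1)], of "u l"] by simp
    ultimately have "u \<in> {..<Suc q} \<rightarrow>\<^sub>E X" unfolding PiE_iff by (intro conjI ballI)
    moreover have "\<exists>m\<in>X. \<forall>k<p. m \<in> U (i k)"
      using uB[of 0] subsetD[OF U_subset[OF j(1)], of "u 0"] by (intro bexI[of _ "u 0"]) simp_all
    moreover have "\<forall>k<p. \<forall>l<Suc q. u l \<in> U (i k)" using uB by simp
    moreover have "\<exists>j\<in>I. \<forall>l<Suc q. u l \<in> U j" using uB by (intro bexI[OF _ j(1)]) simp
    ultimately show "u \<in> {u. (i, u) \<in> inc p (Suc q)}"
      using i by (simp only: inc_def mem_Collect_eq case_prod_conv)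
  qed
  have "openin (mtop M) (?B j)" if j: "j \<in> I" for j
  proof -
    have "openin (mtop M) (U j \<inter> {x. \<forall>k<n. x \<in> U (i k)})" if "n \<le> p" for n
      using that
    proof (induction n)
      case 0
      show ?case using U_open[OF j] by simp
    next
      case (Suc n)
      have "U j \<inter> {x. \<forall>k<Suc n. x \<in> U (i k)} = (U j \<inter> {x. \<forall>k<n. x \<in> U (i k)}) \<inter> U (i n)"
        by (auto simp: less_Suc_eq)
      moreover have "i n \<in> I" by (rule PiE_mem[OF i]) (use Suc.prems in simp)
      moreover have "openin (mtop M) (U j \<inter> {x. \<forall>k<n. x \<in> U (i k)})" by (rule Suc.IH) (use Suc.prems in simp)
      ultimately show ?case using openin_Int[OF _ U_open] by (simp only:)
    qed
    from this[OF order_refl] show ?thesis .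
  qed
  then have "openin (mtop (manifold_power M q)) ({..q} \<rightarrow>\<^sub>E ?B j)" if "j \<in> I" for j
    using that by (simp add: openin_PiE)
  then show ?thesis unfolding eq by (intro openin_Union) blast
qed

text \<open>This covers the deletion of a point and the insertion of a constant one.\<close>

lemma smooth_coordinates:
  assumes "\<And>l. l \<le> r \<Longrightarrow> (\<exists>c\<in>X. f l = (\<lambda>_. c)) \<or> (\<exists>k\<le>q. f l = (\<lambda>u. u k))"
  shows "smooth_map (sub q W) (manifold_power M r) (\<lambda>u. \<lambda>l\<in>{..r}. f l u)"
proof (rule smooth_map_tuple[OF sub_modelled M_modelled])
  fix l assume "l \<le> r"
  from assms[OF this] show "smooth_map (sub q W) M (f l)"
  proof (elim disjE bexE exE conjE)
    fix c assume "c \<in> X" "f l = (\<lambda>_. c)"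
    then show ?thesis using smooth_map_const[OF sub_modelled M_modelled] by simp
  next
    fix k assume "k \<le> q" "f l = (\<lambda>u. u k)"
    then show ?thesis
      using smooth_map_restrict[OF open_chartsD[OF power_open_charts] M_modelled smooth_map_proj[OF M]] by simp
  qed
qed

lemma reg_substitute:
  assumes f: "reg_map b (sub r W) (mfd V) f" and W': "openin (mtop (manifold_power M q)) W'"
    and d: "smooth_map (sub q W') (manifold_power M r) d" "\<And>u. u \<in> W' \<Longrightarrow> d u \<in> W"
  shows "reg_map b (sub q W') (mfd V) (\<lambda>u. f (d u))"
proof -
  have "smooth_map (sub q W') (sub r W) d"
    using topspace_sub[OF W'] d by (intro smooth_map_into_submanifold[OF sub_modelled]) auto
  then show ?thesis
    using reg_map_compose[OF sub_open_charts[OF W'] sub_modelled V_modelled reg_map_smooth f] by blast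
qed

lemma regular: "regular_dowker V X I U opn (P b) J mu"
proof (intro regular_dowker.intro regular_dowker_axioms.intro dowker_axioms)
  fix q W W' f g and v and k :: nat and c and i and p
  show "opn (Suc q) {u. (i, u) \<in> inc p (Suc q)}" if "i \<in> {..<p} \<rightarrow>\<^sub>E I"
    using slice_open[OF that] by (simp add: opn_def)
  show "P b (Suc q) W' f" if "P b (Suc q) W f" "opn (Suc q) W'" "W' \<subseteq> W"
  proof -
    have "sub q W' = open_submanifold (sub q W) W'" by (rule open_submanifold_twice[OF that(3), symmetric])
    moreover have "reg_map b (sub q W) (mfd V) f" using that(1) by (simp only: P_def diff_Suc_1)
    ultimately show ?thesis
      using reg_map_restrict[OF sub_modelled V_modelled, of b q W f W'] by (simp only: P_def diff_Suc_1)
  qed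
  show "P b (Suc q) W g" if "P b (Suc q) W f" "\<And>u. u \<in> W \<Longrightarrow> f u = g u"
  proof -
    have "reg_map b (sub q W) (mfd V) f" using that(1) by (simp only: P_def diff_Suc_1)
    then have "reg_map b (sub q W) (mfd V) g"
      by (rule reg_map_eq[OF sub_modelled V_modelled]) (use that(2) in \<open>auto simp: topspace_submanifold\<close>)
    then show ?thesis by (simp only: P_def diff_Suc_1)
  qed
  show "P b (Suc q) W (\<lambda>_. v)" if "v \<in> carrier V" "opn (Suc q) W"
    using smooth_map_const[OF sub_modelled V_modelled, of v q W] that(1) V_topspace by (simp add: P_def reg_map_smooth)
  show "P b (Suc q) W (\<lambda>u. f u \<otimes> g u)" if "opn (Suc q) W" "P b (Suc q) W f" "P b (Suc q) W g"
    using that reg_group_mult[OF sub_open_charts, of q W b f g] by (simp only: P_def opn_def diff_Suc_1)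
  show "P b (Suc q) W (\<lambda>u. inv f u)" if "opn (Suc q) W" "P b (Suc q) W f"
    using that reg_group_inv[OF sub_open_charts, of q W b f] by (simp only: P_def opn_def diff_Suc_1)
  show "P b (Suc (Suc q)) W' (\<lambda>u. f (del (Suc q) k u))"
    if "P b (Suc q) W f" "opn (Suc q) W" "opn (Suc (Suc q)) W'" "k \<le> Suc q" "\<And>u. u \<in> W' \<Longrightarrow> del (Suc q) k u \<in> W"
  proof -
    have "smooth_map (sub (Suc q) W') (manifold_power M q) (\<lambda>u. \<lambda>l\<in>{..q}. u (if l < k then l else Suc l))"
    proof (rule smooth_coordinates)
      fix l assume "l \<le> q"
      then show "(\<exists>c\<in>X. (\<lambda>u. u (if l < k then l else Suc l)) = (\<lambda>_. c)) \<or>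
          (\<exists>k'\<le>Suc q. (\<lambda>u. u (if l < k then l else Suc l)) = (\<lambda>u :: nat \<Rightarrow> 'm. u k'))"
        by (intro disjI2 exI[of _ "if l < k then l else Suc l"]) simp
    qed
    then have "smooth_map (sub (Suc q) W') (manifold_power M q) (del (Suc q) k)"
      by (simp add: del_def[abs_def] lessThan_Suc_atMost)
    then show ?thesis
      using that reg_substitute[of b q W f "Suc q" W' "del (Suc q) k"] by (simp only: P_def opn_def diff_Suc_1)
  qed
  show "P b (Suc q) W' (\<lambda>u. f (cons (Suc q) c u))"
    if "P b (Suc (Suc q)) W f" "opn (Suc (Suc q)) W" "opn (Suc q) W'" "c \<in> X" "\<And>u. u \<in> W' \<Longrightarrow> cons (Suc q) c u \<in> W"
  proof -
    have "smooth_map (sub q W') (manifold_power M (Suc q)) (\<lambda>u. \<lambda>l\<in>{..Suc q}. case l of 0 \<Rightarrow> c | Suc l' \<Rightarrow> u l')"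
    proof (rule smooth_coordinates)
      fix l assume l: "l \<le> Suc q"
      show "(\<exists>c'\<in>X. (\<lambda>u. case l of 0 \<Rightarrow> c | Suc l' \<Rightarrow> u l') = (\<lambda>_. c')) \<or>
          (\<exists>k\<le>q. (\<lambda>u. case l of 0 \<Rightarrow> c | Suc l' \<Rightarrow> u l') = (\<lambda>u. u k))"
      proof (cases l)
        case 0
        then show ?thesis using that(4) by (intro disjI1 bexI[of _ c]) simp_all
      next
        case (Suc l')
        then show ?thesis using l by (intro disjI2 exI[of _ l']) simp
      qed
    qed
    then have "smooth_map (sub q W') (manifold_power M (Suc q)) (cons (Suc q) c)"
      by (simp add: cons_def[abs_def] lessThan_Suc_atMost)
    then show ?thesis
      using that reg_substitute[of b "Suc q" W f q W' "cons (Suc q) c"] by (simp only: P_def opn_def diff_Suc_1)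
  qed
next
  fix q W h
  show "P b (Suc q) W (\<lambda>u. \<Otimes>j\<in>J (Suc q) u. mu (Suc q) j u (h j u))"
    if "opn (Suc q) W" "W \<subseteq> cov (Suc q)" "\<And>j. j \<in> I \<Longrightarrow> P b (Suc q) (W \<inter> ({..<Suc q} \<rightarrow>\<^sub>E U j)) (h j)"
      "\<And>j u. j \<in> I \<Longrightarrow> u \<in> W \<inter> ({..<Suc q} \<rightarrow>\<^sub>E U j) \<Longrightarrow> h j u \<in> carrier V"
    using reg_partition[of q W b h] that by (simp only: P_def opn_def diff_Suc_1 cov_eq lessThan_Suc_atMost)
next
  fix q u j v
  assume u: "u \<in> cov (Suc q)"
  show "finite (J (Suc q) u)" using J_finite u by (simp add: cov_eq)
  show "j \<in> I \<and> u \<in> {..<Suc q} \<rightarrow>\<^sub>E U j" if "j \<in> J (Suc q) u"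
    using J_cov[OF _ that] u by (simp add: cov_eq lessThan_Suc_atMost)
  show "mu (Suc q) j u \<in> hom V V" by (rule mu_hom)
  show "(\<Otimes>j\<in>J (Suc q) u. mu (Suc q) j u v) = v" if "v \<in> carrier V"
    using mu_sum that u by (simp add: cov_eq)
qed

text \<open>The endomorphisms \<open>mu\<close> contract the rows for the class of all functions as well.\<close>

lemma regular_all: "regular_dowker V X I U (\<lambda>_ _. True) (\<lambda>_ _ _. True) J mu"
proof -
  interpret R: regular_dowker V X I U opn "P True" J mu by (rule regular)
  show ?thesis
    by (intro regular_dowker.intro regular_dowker_axioms.intro dowker_axioms R.J_finite R.J_cov R.mu_hom R.mu_sum TrueI)
qed

end


section \<open>The comparison of the cohomologies\<close>

lemma (in regular_dowker) comm_group_cohomology: "comm_group (cohomology (reg_group P) dA q)"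
proof -
  interpret L: complex_iso "reg_group P" dA "\<lambda>q. Gr 0 (Suc q)" "\<lambda>q. dv 0 (Suc q)" left by (rule left_complex)
  have "comm_group ((reg_group P q)\<lparr>carrier := ZA q\<rparr>)"
    by (rule comm_group.subgroup_comm_group[OF comm_group_reg_group L.cocycles_subgroup])
  moreover have "subgroup (BA q) ((reg_group P q)\<lparr>carrier := ZA q\<rparr>)"
    by (rule L.C.subgroup_incl[OF L.coboundaries_subgroup L.cocycles_subgroup L.coboundaries_subset])
  ultimately show ?thesis unfolding cohomology_def by (rule comm_group.abelian_FactGroup)
qed

lemma (in regular_dowker) cech_iso_cohomology: "cohomology (cech I U V) dC q \<cong> cohomology (reg_group P) dA q"
  by (rule group.iso_sym[OF comm_group.axioms(2)[OF comm_group_cohomology] cohomology_iso_cech])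

lemma iso_via_cech:
  assumes "regular_dowker V X I U opn1 P1 J1 mu1" "regular_dowker V X I U opn2 P2 J2 mu2"
  shows "cohomology (dowker.reg_group V I U P1) (alt_diff V (cov_power I U)) q
    \<cong> cohomology (dowker.reg_group V I U P2) (alt_diff V (cov_power I U)) q"
  by (rule iso_trans[OF regular_dowker.cohomology_iso_cech[OF assms(1)] regular_dowker.cech_iso_cohomology[OF assms(2)]])

context numerably_covered
begin

lemma A_all_eq: "A_all I U V = reg_group (\<lambda>_ _ _. True)"
  by (rule ext) (simp add: A_all_def reg_group_def)

lemma A_cont_eq: "A_cont M I U V = reg_group (P False)"
  by (rule ext) (simp add: A_cont_def A_all_def reg_group_def P_def reg_map_def)

lemma A_smooth_eq: "A_smooth M I U V = reg_group (P True)"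
  by (rule ext) (simp add: A_smooth_def A_all_def reg_group_def P_def reg_map_def)

lemma cohomologies_isomorphic:
  "H_cech I U V q \<cong> H_smooth M I U V q" "H_smooth M I U V q \<cong> H_cont M I U V q"
  "H_cont M I U V q \<cong> H_all I U V q"
  unfolding H_cech_def H_smooth_def H_cont_def H_all_def A_all_eq A_cont_eq A_smooth_eq
  by (rule regular_dowker.cech_iso_cohomology[OF regular] iso_via_cech[OF regular regular]
      iso_via_cech[OF regular regular_all])+

lemma smooth_inclusion_iso:
  "cohomology_map (A_all I U V) (alt_diff V (cov_power I U)) (\<lambda>_ f. f) q \<in> iso (H_smooth M I U V q) (H_all I U V q)"
  unfolding H_smooth_def H_all_def A_all_eq A_smooth_eq cohomology_map_def[abs_def] image_ident
  by (rule cohomology_inclusion_iso[OF regular regular_all]) simp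

end

theorem theorem7p10:
  fixes V :: "('v, 'f) lie_group"
    and M :: "('m, 'e) manifold"
    and I :: "'i set"
    and U :: "'i \<Rightarrow> 'm set"
  assumes "lie_group V" and "comm_group V"
    and "smoothly_loop_contractible V"
    and "manifold M"
    and "open_covering M I U"
    and "\<And>q. smoothly_numerable (open_submanifold (manifold_power M q) (cov_power I U q)) I
               (\<lambda>i. {..q} \<rightarrow>\<^sub>E U i)"
  shows "(\<forall>q. cohomology_map (A_all I U V) (alt_diff V (cov_power I U)) (\<lambda>_ f. f) q
                \<in> iso (H_smooth M I U V q) (H_all I U V q)) \<and>
         (\<forall>q. H_cech I U V q \<cong> H_smooth M I U V q \<and>
              H_smooth M I U V q \<cong> H_cont M I U V q \<and>
              H_cont M I U V q \<cong> H_all I U V q)"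
proof -
  interpret numerably_covered V M I U by (rule numerably_covered.intro[OF assms])
  show ?thesis by (intro conjI allI cohomologies_isomorphic smooth_inclusion_iso)
qed

end
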